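(* For every integer $k\ge 3$, every integer $\ell$ with $1\le \ell<k/2$ and every $\gamma>0$ there exist $c>0$ and $n_0>0$ such that the following holds. If $(\mathcal H,\phi)$ is an $n$-vertex colored $k$-graph with $(k-\ell)\mid n$, $n\ge n_0$, $\delta_{k-1}(\mathcal H)\ge\left(\frac{1}{2(k-\ell)}+\gamma\right)n$ and $\Delta_{\ell}(\mathcal H_i)\le cn^{k-\ell}$ for every $i\in\mathbb N$, then $(\mathcal H,\phi)$ contains a properly colored Hamilton $(k,\ell)$-cycle $C_n^{(k)}(\ell)$.
   Context: A $k$-graph is a $k$-uniform hypergraph. A colored hypergraph is a pair $(\mathcal H,\phi)$ where $\phi:\mathcal H\to\mathbb N$ colors the edges; $\mathcal H_i=\{e\in\mathcal H:\phi(e)=i\}$. For $S\subseteq V(\mathcal H)$, $\deg(S)$ is the number of edges containing $S$; $\delta_s(\mathcal H)=\min\{\deg(S):|S|=s\}$ and $\Delta_s(\mathcal H)=\max\{\deg(S):|S|=s\}$. A $(k,\ell)$-cycle $C_n^{(k)}(\ell)$ is an $n$-vertex $k$-graph whose vertices can be cyclically ordered so that every edge consists of $k$ consecutive vertices and every two consecutive edges share exactly $\ell$ vertices. A Hamilton $(k,\ell)$-cycle in $\mathcal H$ is a spanning subhypergraph that is a $(k,\ell)$-cycle. A hypergraph is properly colored if every two intersecting edges receive different colors. *)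

theory Defs
  imports Complex_Main
begin

text \<open>
  A hypergraph is given by its vertex set \<open>V\<close> and its edge set \<open>E\<close>. A colouring is a total
  function on vertex sets, of which only the values on \<open>E\<close> are relevant.
\<close>

definition k_graph :: "nat \<Rightarrow> 'a set \<Rightarrow> 'a set set \<Rightarrow> bool" where
  "k_graph k V E \<longleftrightarrow> finite V \<and> (\<forall>e\<in>E. e \<subseteq> V \<and> card e = k)"

definition hdeg :: "'a set set \<Rightarrow> 'a set \<Rightarrow> nat" where
  "hdeg E S = card {e \<in> E. S \<subseteq> e}"

text \<open>
  For finite \<open>V\<close> the minimum and maximum below range over a finite set, which is nonempty iff
  \<open>s \<le> card V\<close>; the values are not meaningful for \<open>s > card V\<close>.
\<close>

definition min_hdeg :: "nat \<Rightarrow> 'a set \<Rightarrow> 'a set set \<Rightarrow> nat" where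
  "min_hdeg s V E = Min {hdeg E S | S. S \<subseteq> V \<and> card S = s}"

definition max_hdeg :: "nat \<Rightarrow> 'a set \<Rightarrow> 'a set set \<Rightarrow> nat" where
  "max_hdeg s V E = Max {hdeg E S | S. S \<subseteq> V \<and> card S = s}"

definition color_class :: "'a set set \<Rightarrow> ('a set \<Rightarrow> nat) \<Rightarrow> nat \<Rightarrow> 'a set set" where
  "color_class E \<phi> i = {e \<in> E. \<phi> e = i}"

text \<open>The \<open>k\<close> consecutive vertices from position \<open>p\<close> on in the cyclic order
  \<open>v 0, \<dots>, v (n - 1)\<close>.\<close>

definition cyc_segment :: "(nat \<Rightarrow> 'a) \<Rightarrow> nat \<Rightarrow> nat \<Rightarrow> nat \<Rightarrow> 'a set" where
  "cyc_segment v n k p = {v ((p + j) mod n) | j. j < k}"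

text \<open>
  The \<open>n div (k - l)\<close> edges of the cycle are the segments starting at the multiples of
  \<open>k - l\<close>, so they run once around the cyclic order. The index \<open>Suc i\<close> in the
  last conjunct wraps around, since positions are taken modulo \<open>n\<close>. For \<open>n \<ge> 2 * k - l\<close> that
  conjunct follows from the others; it excludes degenerate small cases.
\<close>

definition kl_cycle :: "nat \<Rightarrow> nat \<Rightarrow> 'a set \<Rightarrow> 'a set set \<Rightarrow> bool" where
  "kl_cycle k l V E \<longleftrightarrow>
     k_graph k V E \<and> (k - l) dvd card V \<and>
     (\<exists>v. bij_betw v {..<card V} V \<and>
       (let n = card V; m = n div (k - l); e = (\<lambda>i. cyc_segment v n k (i * (k - l)))
        in E = e ` {..<m} \<and> (\<forall>i<m. card (e i \<inter> e (Suc i)) = l)))"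

definition hamilton_kl_cycle :: "nat \<Rightarrow> nat \<Rightarrow> 'a set \<Rightarrow> 'a set set \<Rightarrow> 'a set set \<Rightarrow> bool" where
  "hamilton_kl_cycle k l V E C \<longleftrightarrow> C \<subseteq> E \<and> kl_cycle k l V C"

definition properly_colored :: "'a set set \<Rightarrow> ('a set \<Rightarrow> nat) \<Rightarrow> bool" where
  "properly_colored E \<phi> \<longleftrightarrow>
     (\<forall>e\<in>E. \<forall>f\<in>E. e \<noteq> f \<and> e \<inter> f \<noteq> {} \<longrightarrow> \<phi> e \<noteq> \<phi> f)"

end

theory Submission
  imports Defs "HOL-Library.Multiset"
begin

text \<open>
  Put \<open>h = k - l\<close> and cut the cyclic order into chunks of \<open>h\<close> vertices: a Hamilton cycle is a cyclic
  sequence of chunks such that each chunk together with the first \<open>l\<close> vertices of the next one is an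
  edge. Since \<open>2 * l < k\<close>, edges through two prescribed disjoint \<open>l\<close>-sets abound, so paths can be joined
  by three edges inside any large set of unused vertices. In the same way every set of \<open>h\<close> vertices
  has a positive density of absorbers, that is, pieces of path into which it can be inserted. Choosing
  absorbers one by one, with weight \<open>2 ^ (- j)\<close> on the sets that already have \<open>j\<close> of them, yields
  a short path that can absorb every sufficiently small leftover.

  This path is extended by boundedly many vertices at a time until the set \<open>L\<close> of unused vertices is
  small. The process can continue as long as \<open>|N(S) \<inter> L| \<ge> (1 / (2 * h) + \<gamma>) * |L|\<close> for all
  \<open>(k - 1)\<close>-sets \<open>S\<close>. To maintain this, one controls the sum of \<open>exp (- \<eta> * |N(S) \<inter> L| / |L|)\<close>
  over all \<open>S\<close>; to first order this means that the vertices used in a step have to be of at most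
  average weight for a certain weight function on \<open>L\<close>. Let \<open>A\<close> consist of the lightest vertices of \<open>L\<close>.
  A pair of edges that share \<open>l\<close> vertices uses \<open>2 * h\<close> new vertices of a path, and one of the shared
  vertices suffices to be outside \<open>A\<close>. As \<open>(k - 1)\<close>-subsets of \<open>A\<close> have more than \<open>|L| / (2 * h)\<close>
  neighbours, that vertex can be chosen so light that the pair has at most average weight. A subfamily
  of large minimum degree of the edges obtained in this way contains long paths.

  Paths are only extended at the front: once the next chunk is fixed, all \<open>h\<close> vertices of the new
  chunk are free, so the hypothesis on \<open>\<Delta>\<^sub>l\<close> excludes only few of them on account of their colour.
\<close>

text \<open>The obstacle is the small codegree: at density barely above \<open>1 / (2 * h)\<close>
  two (k - 1)-sets need not have a common neighbour. Hence every local structure is listed in an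
  order in which no vertex completes two edges; the codegree condition then leaves linearly many
  choices at each position, so a positive proportion of all lists. Colour clashes are subtracted
  afterwards: a clash prescribes the colour of an edge through an \<open>l\<close>-set fixed by the
  other entries, so it removes only a proportion of order \<open>c\<close>. Nothing is chosen at
  random. The exponential sum controls the minimum density over all (k - 1)-sets at once: with
  \<eta> = \<kappa> * n their number, at most n^(k - 1), costs O(log n) in the exponent, while the
  slack in the density is worth a multiple of \<gamma> * \<kappa> * n. A step of b vertices changes
  each exponent by at most \<beta>, of order \<eta> * b / |L|. Light vertices reduce the first-order
  effect to \<epsilon> * \<beta>, the second-order effect is \<beta>^2, and \<kappa> is so small
  that n / b steps use up less than the slack.\<close>

abbreviation verts :: "'a list list \<Rightarrow> 'a set" where
  "verts P \<equiv> set (concat P)"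

section \<open>Counting lists, fibres of large size, and an exponential inequality\<close>

text \<open>Each admissible initial segment has at least \<open>D\<close> admissible continuations,
  and different segments or continuations give different lists. This yields the lower bounds on
  connections and absorbers before colours are considered.\<close>

lemma card_lists_sequential_choice:
  fixes D :: real
  assumes "finite X" "D \<ge> 0" "G []"
    and step: "\<And>p. length p < N \<Longrightarrow> set p \<subseteq> X \<Longrightarrow> G p \<Longrightarrow> D \<le> real (card {x\<in>X. G (p @ [x])})"
  shows "D ^ N \<le> real (card {xs. length xs = N \<and> set xs \<subseteq> X \<and> G xs})"
  using step
proof (induction N)
  case 0
  have "{xs. length xs = 0 \<and> set xs \<subseteq> X \<and> G xs} = {[]}" using \<open>G []\<close> by auto
  then show ?case by simp
next
  case (Suc N)
  let ?A = "{xs. length xs = N \<and> set xs \<subseteq> X \<and> G xs}"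
  let ?B = "{xs. length xs = Suc N \<and> set xs \<subseteq> X \<and> G xs}"
  let ?S = "SIGMA p:?A. {x\<in>X. G (p @ [x])}"
  have fl: "finite {xs. set xs \<subseteq> X \<and> length xs = m}" for m
    using assms(1) by (rule finite_lists_length_eq)
  have fA: "finite ?A" by (rule finite_subset[OF _ fl[of N]]) auto
  have fB: "finite ?B" by (rule finite_subset[OF _ fl[of "Suc N"]]) auto
  have IH: "D ^ N \<le> real (card ?A)" using Suc by auto
  have "D ^ Suc N \<le> real (card ?A) * D"
    using mult_right_mono[OF IH assms(2)] by (simp add: mult.commute)
  also have "\<dots> = (\<Sum>p\<in>?A. D)" by simp
  also have "\<dots> \<le> (\<Sum>p\<in>?A. real (card {x\<in>X. G (p @ [x])}))"
    by (rule sum_mono) (use Suc.prems in auto)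
  also have "\<dots> = real (card ?S)" using fA assms(1) by (subst card_SigmaI) auto
  also have "card ?S \<le> card ?B"
  proof (rule card_inj_on_le[OF _ _ fB])
    show "inj_on (\<lambda>(p, x). p @ [x]) ?S" by (auto simp: inj_on_def)
    show "(\<lambda>(p, x). p @ [x]) ` ?S \<subseteq> ?B" by auto
  qed
  finally show ?case by simp
qed

text \<open>Once the \<open>a + b\<close> outer entries are fixed, at most \<open>K\<close> middles
  remain. In the colour counts the middle completes an \<open>l\<close>-set to an edge whose
  forbidden colour is dictated by the outer entries, hence the dependence of \<open>P\<close> on
  \<open>u\<close> and \<open>w\<close>.\<close>

lemma card_lists_middle_le:
  fixes K :: real
  assumes "finite X"
    and bound: "\<And>u w. set u \<subseteq> X \<Longrightarrow> set w \<subseteq> X \<Longrightarrow> length u = a \<Longrightarrow> length w = b \<Longrightarrow>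
      real (card {m. length m = h \<and> set m \<subseteq> X \<and> P u m w}) \<le> K"
  shows "real (card {xs. length xs = a + h + b \<and> set xs \<subseteq> X \<and>
      P (take a xs) (take h (drop a xs)) (drop (a + h) xs)}) \<le> K * real (card X) ^ (a + b)"
proof -
  let ?L = "\<lambda>m. {xs. set xs \<subseteq> X \<and> length xs = m}"
  let ?B = "{xs. length xs = a + h + b \<and> set xs \<subseteq> X \<and>
      P (take a xs) (take h (drop a xs)) (drop (a + h) xs)}"
  let ?M = "\<lambda>(u, w). {m. length m = h \<and> set m \<subseteq> X \<and> P u m w}"
  let ?S = "SIGMA uw:(?L a \<times> ?L b). ?M uw"
  have fl: "finite (?L m)" for m using assms(1) by (rule finite_lists_length_eq)
  have fM: "finite (?M uw)" for uw by (rule finite_subset[OF _ fl[of h]]) auto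
  have fS: "finite ?S" using fl fM by (intro finite_SigmaI finite_cartesian_product) auto
  have "card ?B \<le> card ?S"
  proof (rule card_inj_on_le[OF _ _ fS])
    let ?f = "\<lambda>xs. ((take a xs, drop (a + h) xs), take h (drop a xs))"
    show "inj_on ?f ?B"
    proof (rule inj_onI)
      fix xs ys assume "?f xs = ?f ys"
      then have "take a xs @ take h (drop a xs) @ drop h (drop a xs) =
        take a ys @ take h (drop a ys) @ drop h (drop a ys)" by (simp add: add.commute)
      then show "xs = ys" by (simp only: append_take_drop_id)
    qed
    show "?f ` ?B \<subseteq> ?S" using set_take_subset set_drop_subset
      by (fastforce dest: in_set_takeD in_set_dropD)
  qed
  also have "real (card ?S) = (\<Sum>uw\<in>?L a \<times> ?L b. real (card (?M uw)))"
    using fl fM by (subst card_SigmaI) auto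
  also have "\<dots> \<le> (\<Sum>uw\<in>?L a \<times> ?L b. K)" by (rule sum_mono) (use bound in auto)
  also have "\<dots> = K * real (card X) ^ (a + b)"
    using assms(1) by (simp add: card_cartesian_product card_lists_length_eq power_add)
  finally show ?thesis by simp
qed

text \<open>Regard \<open>F\<close> as the edges of a bipartite multigraph, \<open>x\<close> joining
  \<open>p x\<close> to \<open>q x\<close>. Deleting a vertex of degree below \<theta> together with
  its edges keeps (edges) - \<theta> * (vertices) positive, so the deletions stop at a nonempty
  subgraph of minimum degree at least \<theta>.\<close>

lemma large_fibres_subset:
  fixes p q :: "'a \<Rightarrow> 'b" and \<theta> :: real
  assumes "finite F" "\<theta> \<ge> 0" "real (card F) > \<theta> * (real (card (p ` F)) + real (card (q ` F)))"
  shows "\<exists>G\<subseteq>F. G \<noteq> {} \<and> (\<forall>x\<in>G. real (card {y\<in>G. p y = p x}) \<ge> \<theta>)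
    \<and> (\<forall>x\<in>G. real (card {y\<in>G. q y = q x}) \<ge> \<theta>)"
  using assms(1,3)
proof (induction F rule: finite_psubset_induct)
  case (psubset F)
  define w where "w = (\<lambda>G. real (card G) - \<theta> * (real (card (p ` G)) + real (card (q ` G))))"
  have wF: "w F > 0" using psubset.prems by (simp add: w_def)
  have reduce: ?case if x: "x \<in> F" "H = {y\<in>F. r y = r x}" "real (card H) < \<theta>"
    and r: "r = p \<or> r = q" for x H r
  proof -
    have "F - H \<subset> F" using x by auto
    have c: "card (F - H) = card F - card H" "card H \<le> card F"
      using psubset.hyps x(2) by (auto intro!: card_Diff_subset card_mono finite_subset[of H F])
    have rr: "card (r ` (F - H)) + 1 \<le> card (r ` F)"
    proof -
      have "r x \<notin> r ` (F - H)" "r x \<in> r ` F" using x by auto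
      then have "r ` (F - H) \<subset> r ` F" by blast
      then have "card (r ` (F - H)) < card (r ` F)" using psubset.hyps by (intro psubset_card_mono) auto
      then show ?thesis by simp
    qed
    have le: "card (s ` (F - H)) \<le> card (s ` F)" for s
      using psubset.hyps by (intro card_mono) auto
    have "real (card (p ` (F - H))) + real (card (q ` (F - H))) + 1
      \<le> real (card (p ` F)) + real (card (q ` F))"
      using r rr le[of p] le[of q] by (elim disjE) auto
    from mult_left_mono[OF this assms(2)]
    have "\<theta> * (real (card (p ` (F - H))) + real (card (q ` (F - H)))) + \<theta>
      \<le> \<theta> * (real (card (p ` F)) + real (card (q ` F)))" by (simp add: algebra_simps)
    then have "real (card (F - H)) > \<theta> * (real (card (p ` (F - H))) + real (card (q ` (F - H))))"
      using wF c x(3) by (simp add: w_def of_nat_diff)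
    from psubset.IH[OF \<open>F - H \<subset> F\<close> this] show ?thesis by blast
  qed
  have "F \<noteq> {}" using wF by (auto simp: w_def)
  show ?case
  proof (cases "\<exists>x\<in>F. real (card {y\<in>F. p y = p x}) < \<theta> \<or> real (card {y\<in>F. q y = q x}) < \<theta>")
    case True
    then obtain x where x: "x \<in> F"
      "real (card {y\<in>F. p y = p x}) < \<theta> \<or> real (card {y\<in>F. q y = q x}) < \<theta>" by blast
    from x(2) show ?thesis
    proof
      assume "real (card {y\<in>F. p y = p x}) < \<theta>"
      from reduce[where r = p, OF x(1) refl this] show ?thesis by simp
    next
      assume "real (card {y\<in>F. q y = q x}) < \<theta>"
      from reduce[where r = q, OF x(1) refl this] show ?thesis by simp
    qed
  next
    case False
    then show ?thesis using \<open>F \<noteq> {}\<close> by (intro exI[of _ F]) (auto simp: not_less)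
  qed
qed

text \<open>For negative \<open>x\<close> this follows from (1 + x + x^2) * (1 - x) = 1 - x^3 and 1
  - x \<le> exp (- x). It supplies the second-order error in \<open>potential_step\<close>.\<close>

lemma exp_le_quadratic:
  fixes x :: real
  assumes "\<bar>x\<bar> \<le> 1"
  shows "exp x \<le> 1 + x + x\<^sup>2"
proof (cases "x \<ge> 0")
  case True
  then show ?thesis using assms exp_bound[of x] by auto
next
  case False
  have "1 \<le> (1 + x + x\<^sup>2) * (1 - x)" 
  proof -
    have "(1 + x + x\<^sup>2) * (1 - x) = 1 - x * x\<^sup>2" by (simp add: algebra_simps power2_eq_square)
    then show ?thesis using False by (simp add: mult_le_0_iff)
  qed
  also have "\<dots> \<le> (1 + x + x\<^sup>2) * exp (- x)"
    using exp_ge_add_one_self[of "-x"] assms False by (intro mult_left_mono) (auto simp: add_nonneg_nonneg)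
  finally show ?thesis by (simp add: exp_minus field_simps)
qed

subsection \<open>Connecting two paths\<close>

text \<open>Here k = \<open>l + h\<close>. Of the \<open>h\<close> vertices of a chunk the first
  \<open>l\<close> lie in two edges of the cycle and the other \<open>g\<close> = k - 2 * l in one;
  \<open>1 \<le> g\<close> is the condition l < k / 2.\<close>

locale coloured_graph =
  fixes V :: "'a set" and E :: "'a set set" and \<phi> :: "'a set \<Rightarrow> nat"
    and l g h :: nat and c :: real
  assumes graph: "k_graph (l + h) V E" and l_pos: "1 \<le> l" and g_pos: "1 \<le> g" and h: "h = l + g"
    and colour_degree: "\<And>S j. S \<subseteq> V \<Longrightarrow> card S = l \<Longrightarrow>
      real (card {e\<in>E. \<phi> e = j \<and> S \<subseteq> e}) \<le> c * real (card V) ^ h"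
begin

text \<open>The edge spanned by two consecutive chunks.\<close>

definition ed :: "'a list \<Rightarrow> 'a list \<Rightarrow> 'a set" where
  "ed a b = set a \<union> set (take l b)"

definition codegree_ge :: "'a set \<Rightarrow> real \<Rightarrow> bool" where
  "codegree_ge L D \<longleftrightarrow> L \<subseteq> V \<and> D \<le> real (card L) \<and>
    (\<forall>S\<subseteq>V. card S = l + h - 1 \<longrightarrow> D \<le> real (card {x\<in>L. insert x S \<in> E}))"

lemma finV: "finite V" using graph by (simp add: k_graph_def)

lemma edgeD: "e \<in> E \<Longrightarrow> e \<subseteq> V" "e \<in> E \<Longrightarrow> card e = l + h" "e \<in> E \<Longrightarrow> finite e"
  using graph finV by (auto simp: k_graph_def intro: finite_subset)

lemma finE: "finite E"
  by (rule finite_subset[of _ "Pow V"]) (auto simp: finV dest: edgeD)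

text \<open>At most c * n^h edges of a given colour contain a given \<open>l\<close>-set, and each
  leaves an \<open>h\<close>-set over which there are h^h lists of length \<open>h\<close>.\<close>

definition fillings :: real where "fillings = real h ^ h * (c * real (card V) ^ h)"

lemma card_fillings_le:
  assumes "S \<subseteq> V" "card S = l"
  shows "real (card {m. length m = h \<and> set m \<subseteq> V \<and> S \<union> set m \<in> E \<and> \<phi> (S \<union> set m) = j}) \<le> fillings"
proof -
  let ?A = "{m. length m = h \<and> set m \<subseteq> V \<and> S \<union> set m \<in> E \<and> \<phi> (S \<union> set m) = j}"
  let ?F = "{e\<in>E. \<phi> e = j \<and> S \<subseteq> e}"
  let ?L = "\<lambda>e. {m. set m \<subseteq> e - S \<and> length m = h}"
  have fF: "finite ?F" using finE by auto
  have finS: "finite S" using assms finV finite_subset by blast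
  have fL: "finite (?L e)" if "e \<in> ?F" for e
    using that edgeD(3) by (intro finite_lists_length_eq) auto
  have "card ?A \<le> card (SIGMA e:?F. ?L e)"
  proof (rule card_inj_on_le)
    show "inj_on (\<lambda>m. (S \<union> set m, m)) ?A" by (auto simp: inj_on_def)
    show "(\<lambda>m. (S \<union> set m, m)) ` ?A \<subseteq> (SIGMA e:?F. ?L e)"
    proof (rule image_subsetI)
      fix m assume "m \<in> ?A"
      then have m: "length m = h" "S \<union> set m \<in> E" "\<phi> (S \<union> set m) = j" by auto
      have "card (S \<union> set m) + card (S \<inter> set m) = card S + card (set m)"
        using card_Un_Int[OF finS, of "set m"] by simp
      moreover have "card (S \<union> set m) = l + h" using edgeD(2)[OF m(2)] .
      moreover have "card (set m) \<le> h" using m(1) card_length by blast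
      ultimately have "card (S \<inter> set m) = 0" using assms by linarith
      then have "S \<inter> set m = {}" using finS by auto
      \<comment> \<open>An edge has \<open>l + h\<close> vertices, so \<open>m\<close> can only fill
        the part outside \<open>S\<close>; this places \<open>m\<close> among the lists over
        \<open>e - S\<close>.\<close>
      then show "(S \<union> set m, m) \<in> (SIGMA e:?F. ?L e)" using m by auto
    qed
    show "finite (SIGMA e:?F. ?L e)" using fF fL by auto
  qed
  also have "real (card (SIGMA e:?F. ?L e)) = (\<Sum>e\<in>?F. real (card (?L e)))"
    using fF fL by (subst card_SigmaI) auto
  also have "\<dots> = (\<Sum>e\<in>?F. real h ^ h)"
  proof (rule sum.cong[OF refl])
    fix e assume e: "e \<in> ?F"
    then have "card (e - S) = h" using edgeD assms finS by (subst card_Diff_subset) auto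
    then show "real (card (?L e)) = real h ^ h"
      using e edgeD(3) by (subst card_lists_length_eq) auto
  qed
  also have "\<dots> \<le> fillings" unfolding fillings_def
    using mult_right_mono[OF colour_degree[OF assms, of j], of "real h ^ h"] by (simp add: mult_ac)
  finally show ?thesis by simp
qed

text \<open>The locale fixes no sign of \<open>c\<close>; the sign of the bound comes from counting
  the fillings of an actual \<open>l\<close>-set.\<close>

lemma fillings_nonneg: assumes "finite S" "S \<subseteq> V" "card S = l" shows "fillings \<ge> 0"
  by (rule order_trans[OF of_nat_0_le_iff card_fillings_le[OF assms(2,3)]])

text \<open>Both the \<open>l\<close>-set \<open>S\<close> and the forbidden colour are functions of
  the outer entries. A clash between two edges fits this form when the \<open>h\<close> free entries
  belong to one of them and avoid the other. \<open>C\<close> carries the distinctness that gives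
  \<open>S\<close> its size.\<close>

lemma card_conflicts_le:
  assumes "N = a + h + b" and nonneg: "fillings \<ge> 0"
    and S: "\<And>u w. C u w \<Longrightarrow> set u \<subseteq> V \<Longrightarrow> set w \<subseteq> V \<Longrightarrow> length u = a \<Longrightarrow> length w = b \<Longrightarrow> S u w \<subseteq> V \<and> card (S u w) = l"
  shows "real (card {xs. length xs = N \<and> set xs \<subseteq> V \<and>
      C (take a xs) (drop (a + h) xs) \<and>
      S (take a xs) (drop (a + h) xs) \<union> set (take h (drop a xs)) \<in> E \<and>
      \<phi> (S (take a xs) (drop (a + h) xs) \<union> set (take h (drop a xs))) = j (take a xs) (drop (a + h) xs)})
    \<le> fillings * real (card V) ^ (a + b)"
proof -
  have "real (card {m. length m = h \<and> set m \<subseteq> V \<and>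
      (C u w \<and> S u w \<union> set m \<in> E \<and> \<phi> (S u w \<union> set m) = j u w)}) \<le> fillings"
    if "set u \<subseteq> V" "set w \<subseteq> V" "length u = a" "length w = b" for u w
  proof (cases "C u w")
    case True
    with card_fillings_le S that show ?thesis by simp
  qed (simp add: nonneg)
  from card_lists_middle_le[OF finV, where P = "\<lambda>u m w. C u w \<and> S u w \<union> set m \<in> E \<and> \<phi> (S u w \<union> set m) = j u w",
      OF this]
  show ?thesis unfolding assms(1) .
qed

lemma card_extensions_ge:
  assumes "codegree_ge L D" "S \<subseteq> V" "card S = l + h - 1" "length p \<le> N"
  shows "D - N \<le> real (card {x\<in>L. x \<notin> set p \<and> insert x S \<in> E})"
proof -
  have fin: "finite L" using assms finV finite_subset by (auto simp: codegree_ge_def)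
  have "D \<le> real (card {x\<in>L. insert x S \<in> E})" using assms by (auto simp: codegree_ge_def)
  also have "card {x\<in>L. insert x S \<in> E} \<le> card ({x\<in>L. x \<notin> set p \<and> insert x S \<in> E} \<union> set p)"
    using fin by (intro card_mono) auto
  also have "\<dots> \<le> card {x\<in>L. x \<notin> set p \<and> insert x S \<in> E} + card (set p)" by (rule card_Un_le)
  also have "card (set p) \<le> N" using card_length[of p] assms by linarith
  finally show ?thesis by simp
qed

lemma card_free_extensions_ge:
  assumes "codegree_ge L D" "length p \<le> N"
  shows "D - N \<le> real (card {x\<in>L. x \<notin> set p})"
proof -
  have "finite L" using assms finV finite_subset by (auto simp: codegree_ge_def)
  then have "card L \<le> card ({x\<in>L. x \<notin> set p} \<union> set p)" by (intro card_mono) auto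
  also have "\<dots> \<le> card {x\<in>L. x \<notin> set p} + card (set p)" by (rule card_Un_le)
  finally show ?thesis using card_length[of p] assms by (simp add: codegree_ge_def)
qed

text \<open>The list \<open>B @ z1 @ z2\<close> is chosen vertex by vertex. Its edges are complete
  at the lengths \<open>h\<close>, \<open>h + h\<close> and \<open>g + h + h\<close>, so every
  vertex meets at most one codegree condition. The two colours \<open>j\<close> and
  \<open>j'\<close> are those of the edges already present beyond \<open>r\<close> and
  \<open>s\<close>.\<close>

lemma connect:
  assumes L: "codegree_ge L D" and N: "N = g + h + h" and D: "D \<ge> N"
    and many: "4 * (fillings * real (card V) ^ (g + h)) < (D - N) ^ N"
    and r: "length r = l" "distinct r" "set r \<subseteq> V" "set r \<inter> L = {}"
    and s: "length s = l" "distinct s" "set s \<subseteq> V" "set s \<inter> L = {}"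
  obtains B z1 z2 where "length B = g" "length z1 = h" "length z2 = h"
    "distinct (B @ z1 @ z2)" "set (B @ z1 @ z2) \<subseteq> L"
    "ed (r @ B) z1 \<in> E" "ed z1 z2 \<in> E" "ed z2 s \<in> E"
    "\<phi> (ed (r @ B) z1) \<noteq> j" "\<phi> (ed (r @ B) z1) \<noteq> \<phi> (ed z1 z2)"
    "\<phi> (ed z1 z2) \<noteq> \<phi> (ed z2 s)" "\<phi> (ed z2 s) \<noteq> j'"
proof -
  have LV: "L \<subseteq> V" using L by (simp add: codegree_ge_def)
  then have fL: "finite L" using finV finite_subset by blast
  define G where "G = (\<lambda>p. distinct p \<and>
    (h \<le> length p \<longrightarrow> set r \<union> set (take h p) \<in> E) \<and>
    (h + h \<le> length p \<longrightarrow> set (take (h + l) (drop g p)) \<in> E) \<and>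
    (N \<le> length p \<longrightarrow> set s \<union> set (drop (g + h) p) \<in> E))"
  have step: "D - N \<le> real (card {x\<in>L. G (p @ [x])})"
    if p: "length p < N" "set p \<subseteq> L" "G p" for p
  proof -
    have dp: "distinct p" using p by (simp add: G_def)
    have dd: "card (set (drop m p)) = length p - m" for m
      using dp by (simp add: distinct_card)
    have dis: "set r \<inter> set p = {}" "set s \<inter> set (drop m p) = {}" for m
      using p r s set_drop_subset[of m p] by blast+
    have *: ?thesis if S: "S \<subseteq> V" "card S = l + h - 1"
      and GS: "\<And>x. x \<in> L \<Longrightarrow> x \<notin> set p \<Longrightarrow> insert x S \<in> E \<Longrightarrow> G (p @ [x])" for S
    proof -
      have "D - N \<le> real (card {x\<in>L. x \<notin> set p \<and> insert x S \<in> E})"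
        using p S by (intro card_extensions_ge[OF L]) auto
      also have "\<dots> \<le> real (card {x\<in>L. G (p @ [x])})"
        unfolding of_nat_le_iff by (rule card_mono) (use fL GS in auto)
      finally show ?thesis .
    qed
    consider "length p = h - 1" | "length p = h + h - 1" | "length p = N - 1"
      | "length p \<noteq> h - 1" "length p \<noteq> h + h - 1" "length p \<noteq> N - 1" by blast
    then show ?thesis
    proof cases
      case 1
      show ?thesis
      proof (rule *[of "set r \<union> set p"])
        show "card (set r \<union> set p) = l + h - 1"
          using dis r dp 1 l_pos h by (simp add: card_Un_disjoint distinct_card)
        show "G (p @ [x])" if "x \<notin> set p" "insert x (set r \<union> set p) \<in> E" for x
          using that 1 dp h l_pos g_pos N by (auto simp: G_def)
      qed (use p r LV in auto)
    next
      case 2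
      show ?thesis
      proof (rule *[of "set (drop g p)"])
        show "card (set (drop g p)) = l + h - 1" using 2 dd h by simp
        show "G (p @ [x])" if "x \<notin> set p" "insert x (set (drop g p)) \<in> E" for x
          using that 2 p h l_pos g_pos N by (auto simp: G_def)
      qed (use p LV in \<open>auto dest: in_set_dropD\<close>)
    next
      case 3
      show ?thesis
      proof (rule *[of "set s \<union> set (drop (g + h) p)"])
        show "card (set s \<union> set (drop (g + h) p)) = l + h - 1"
          using dis s dd 3 l_pos h N by (simp add: card_Un_disjoint distinct_card)
        show "G (p @ [x])" if "x \<notin> set p" "insert x (set s \<union> set (drop (g + h) p)) \<in> E" for x
          using that 3 p h l_pos g_pos N by (auto simp: G_def)
      qed (use p s LV in \<open>auto dest: in_set_dropD\<close>)
    next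
      case 4
      have "D - N \<le> real (card {x\<in>L. x \<notin> set p})"
        using p by (intro card_free_extensions_ge[OF L]) auto
      also have "\<dots> \<le> real (card {x\<in>L. G (p @ [x])})"
        unfolding of_nat_le_iff
      proof (rule card_mono)
        show "{x\<in>L. x \<notin> set p} \<subseteq> {x\<in>L. G (p @ [x])}"
          using 4 p h l_pos g_pos N by (auto simp: G_def)
      qed (use fL in auto)
      finally show ?thesis .
    qed
  qed
  let ?G = "{xs. length xs = N \<and> set xs \<subseteq> L \<and> G xs}"
  have "G []" using h l_pos N by (auto simp: G_def)
  then have cardG: "(D - N) ^ N \<le> real (card ?G)"
    using step D by (intro card_lists_sequential_choice[OF fL]) auto
  have nn: "fillings \<ge> 0" using fillings_nonneg[of "set r"] r by (simp add: distinct_card)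
  let ?bad = "\<lambda>a b C S j. {xs. length xs = N \<and> set xs \<subseteq> V \<and>
      C (take a xs) (drop (a + h) xs) \<and>
      S (take a xs) (drop (a + h) xs) \<union> set (take h (drop a xs)) \<in> E \<and>
      \<phi> (S (take a xs) (drop (a + h) xs) \<union> set (take h (drop a xs))) = j (take a xs) (drop (a + h) xs)}"
  let ?f1 = "\<lambda>xs. set r \<union> set (take h xs)" and ?f2 = "\<lambda>xs. set (take (h + l) (drop g xs))"
    and ?f3 = "\<lambda>xs. set s \<union> set (drop (g + h) xs)"
  \<comment> \<open>The free \<open>h\<close> entries are, in turn: the first edge without
    \<open>r\<close>; the second edge without the first \<open>l\<close> vertices of
    \<open>z1\<close>; the list \<open>z1\<close>; the list \<open>z2\<close>. In \<open>?X2\<close>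
    and \<open>?X3\<close> the other edge of the clash is determined by the remaining
    entries.\<close>
  let ?X1 = "?bad 0 (g + h) (\<lambda>u w. True) (\<lambda>u w. set r) (\<lambda>u w. j)"
  let ?X2 = "?bad h g (\<lambda>u w. distinct u) (\<lambda>u w. set (drop g u)) (\<lambda>u w. \<phi> (set r \<union> set u))"
  let ?X3 = "?bad g h (\<lambda>u w. distinct w) (\<lambda>u w. set (take l w)) (\<lambda>u w. \<phi> (set s \<union> set w))"
  let ?X4 = "?bad (g + h) 0 (\<lambda>u w. True) (\<lambda>u w. set s) (\<lambda>u w. j')"
  let ?K = "fillings * real (card V) ^ (g + h)"
  have b1: "real (card ?X1) \<le> fillings * real (card V) ^ (0 + (g + h))"
    using r N by (intro card_conflicts_le nn) (auto simp: distinct_card)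
  have b2: "real (card ?X2) \<le> fillings * real (card V) ^ (h + g)"
    using h N by (intro card_conflicts_le nn) (auto simp: distinct_card dest: in_set_dropD)
  have b3: "real (card ?X3) \<le> fillings * real (card V) ^ (g + h)"
    using h N by (intro card_conflicts_le nn) (auto simp: distinct_card dest: in_set_takeD)
  have b4: "real (card ?X4) \<le> fillings * real (card V) ^ ((g + h) + 0)"
    using s N by (intro card_conflicts_le nn) (auto simp: distinct_card)
  have fin: "finite {xs. length xs = N \<and> set xs \<subseteq> V \<and> P xs}" for P
    by (rule finite_subset[OF _ finite_lists_length_eq[OF finV, of N]]) auto
  have "\<exists>xs\<in>?G. xs \<notin> ?X1 \<union> ?X2 \<union> ?X3 \<union> ?X4"
  proof (rule ccontr)
    assume "\<not> ?thesis"
    then have "?G \<subseteq> ?X1 \<union> ?X2 \<union> ?X3 \<union> ?X4" by blast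
    then have "card ?G \<le> card (?X1 \<union> ?X2 \<union> ?X3 \<union> ?X4)" using fin by (intro card_mono) auto
    also have "\<dots> \<le> card ?X1 + card ?X2 + card ?X3 + card ?X4"
      using card_Un_le[of "?X1 \<union> ?X2 \<union> ?X3" ?X4] card_Un_le[of "?X1 \<union> ?X2" ?X3]
        card_Un_le[of ?X1 ?X2] by linarith
    finally have "real (card ?G) \<le> real (card ?X1) + real (card ?X2) + real (card ?X3) + real (card ?X4)"
      by linarith
    also have "\<dots> \<le> 4 * ?K" using b1 b2 b3 b4 by (simp add: add.commute)
    finally show False using cardG many by linarith
  qed
  then obtain xs where xs: "length xs = N" "set xs \<subseteq> L" "G xs"
    and nb: "xs \<notin> ?X1" "xs \<notin> ?X2" "xs \<notin> ?X3" "xs \<notin> ?X4" by auto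
  define B z1 z2 where "B = take g xs" and "z1 = take h (drop g xs)" and "z2 = drop (g + h) xs"
  have sp: "xs = B @ z1 @ z2" 
    unfolding B_def z1_def z2_def by (metis add.commute append_take_drop_id drop_drop)
  have len: "length B = g" "length z1 = h" "length z2 = h"
    using xs(1) N by (auto simp: B_def z1_def z2_def)
  have tk: "take h xs = B @ take l z1" "drop h xs = drop l z1 @ z2"
    using len h by (simp_all add: sp)
  have td: "take (h + l) (drop g xs) = z1 @ take l z2" using len by (simp add: sp)
  have e1: "set r \<union> set (take h xs) = ed (r @ B) z1" unfolding tk by (auto simp: ed_def)
  have e2: "set (take (h + l) (drop g xs)) = ed z1 z2" unfolding td by (auto simp: ed_def)
  have e3: "set s \<union> set (drop (g + h) xs) = ed z2 s" using s by (auto simp: ed_def z2_def)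
  have ds: "distinct xs" using xs by (simp add: G_def)
  have E: "ed (r @ B) z1 \<in> E" "ed z1 z2 \<in> E" "ed z2 s \<in> E"
    using xs N unfolding G_def e1 e2 e3 by auto
  have xsV: "set xs \<subseteq> V" using xs LV by auto
  have n1: "\<phi> (ed (r @ B) z1) \<noteq> j"
  proof
    assume "\<phi> (ed (r @ B) z1) = j"
    then have "xs \<in> ?X1" using xs(1) xsV E(1) e1 by simp
    then show False by (rule notE[OF nb(1)])
  qed
  have n4: "\<phi> (ed z2 s) \<noteq> j'"
  proof
    assume "\<phi> (ed z2 s) = j'"
    moreover have "take h (drop (g + h) xs) = z2" using xs(1) N by (simp add: z2_def)
    ultimately have "xs \<in> ?X4" using xs(1) xsV E(3) e3 by (simp add: z2_def)
    then show False by (rule notE[OF nb(4)])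
  qed
  have n2: "\<phi> (ed (r @ B) z1) \<noteq> \<phi> (ed z1 z2)"
  proof
    assume a: "\<phi> (ed (r @ B) z1) = \<phi> (ed z1 z2)"
    have "set (drop g (take h xs)) \<union> set (take h (drop h xs)) = ed z1 z2"
    proof -
      have "drop g (take h xs) = take l z1" using len by (simp add: tk)
      moreover have "take h (drop h xs) = drop l z1 @ take l z2"
        unfolding tk(2) using len h by simp
      moreover have "set z1 = set (take l z1) \<union> set (drop l z1)"
        by (metis append_take_drop_id set_append)
      ultimately show ?thesis by (simp add: ed_def Un_assoc)
    qed
    then have "xs \<in> ?X2" using xs(1) xsV E(2) a e1 ds by simp
    then show False by (rule notE[OF nb(2)])
  qed
  have n3: "\<phi> (ed z1 z2) \<noteq> \<phi> (ed z2 s)"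
  proof
    assume a: "\<phi> (ed z1 z2) = \<phi> (ed z2 s)"
    have "set (take l (drop (g + h) xs)) \<union> set (take h (drop g xs)) = ed z1 z2"
      by (simp only: ed_def z1_def z2_def Un_commute)
    then have "xs \<in> ?X3" using xs(1) xsV E(2) a e3 ds by simp
    then show False by (rule notE[OF nb(3)])
  qed
  show thesis
    by (rule that[OF len _ _ E n1 n2 n3 n4]) (use ds xs sp in auto)
qed

subsection \<open>Absorbers\<close>

text \<open>
  An absorber is a path through the chunks \<open>a, d, rotate1 c\<close> and the \<open>l\<close>-list \<open>r\<close>; absorbing \<open>t\<close> turns
  it into \<open>a, d, t, c, r\<close>. The rotation changes the first \<open>l\<close> vertices of \<open>c\<close>, but not the edge of
  \<open>c\<close> and \<open>r\<close>. The vertices are stored in the order first \<open>l\<close> of \<open>c\<close>, \<open>d\<close>, rest of \<open>c\<close>, \<open>r\<close>, \<open>a\<close>,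
  in which each of the five edges involved is completed by a vertex of its own.
\<close>

definition part_a :: "'a list \<Rightarrow> 'a list" where "part_a xs = drop (l + h + h) xs"
definition part_d :: "'a list \<Rightarrow> 'a list" where "part_d xs = take h (drop l xs)"
definition part_c :: "'a list \<Rightarrow> 'a list" where "part_c xs = take l xs @ take g (drop (l + h) xs)"
definition part_r :: "'a list \<Rightarrow> 'a list" where "part_r xs = take l (drop (l + h + g) xs)"

definition absorber :: "'a list \<Rightarrow> bool" where
  "absorber xs \<longleftrightarrow> distinct xs \<and> length xs = l + h + h + h \<and>
    ed (part_a xs) (part_d xs) \<in> E \<and> ed (part_d xs) (rotate1 (part_c xs)) \<in> E \<and>
    ed (part_c xs) (part_r xs) \<in> E \<and>
    \<phi> (ed (part_a xs) (part_d xs)) \<noteq> \<phi> (ed (part_d xs) (rotate1 (part_c xs))) \<and>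
    \<phi> (ed (part_d xs) (rotate1 (part_c xs))) \<noteq> \<phi> (ed (part_c xs) (part_r xs))"

definition absorbs :: "'a list \<Rightarrow> 'a list \<Rightarrow> bool" where
  "absorbs xs t \<longleftrightarrow> ed (part_d xs) t \<in> E \<and> ed t (part_c xs) \<in> E \<and>
    \<phi> (ed (part_a xs) (part_d xs)) \<noteq> \<phi> (ed (part_d xs) t) \<and>
    \<phi> (ed (part_d xs) t) \<noteq> \<phi> (ed t (part_c xs)) \<and>
    \<phi> (ed t (part_c xs)) \<noteq> \<phi> (ed (part_c xs) (part_r xs))"

text \<open>The edge conditions on an absorber of \<open>t\<close>, as far as they concern the initial segment \<open>p\<close>.\<close>

definition frame :: "'a list \<Rightarrow> 'a list \<Rightarrow> bool" where
  "frame t p \<longleftrightarrow> distinct p \<and>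
    (l \<le> length p \<longrightarrow> set t \<union> set (take l p) \<in> E) \<and>
    (l + h \<le> length p \<longrightarrow> set (take l t) \<union> set (take h (drop l p)) \<in> E) \<and>
    (l + h + 1 \<le> length p \<longrightarrow> set (take (l + h) (drop 1 p)) \<in> E) \<and>
    (l + h + h \<le> length p \<longrightarrow> set (take l p) \<union> set (take h (drop (l + h) p)) \<in> E) \<and>
    (l + h + h + h \<le> length p \<longrightarrow> set (take l (drop l p)) \<union> set (drop (l + h + h) p) \<in> E)"

text \<open>This count is the reason for \<open>rotate1\<close>. With \<open>part_c\<close>
  unrotated, the edges on t and \<open>take l c\<close>, on d and \<open>take l t\<close>, and on d
  and \<open>take l c\<close> could not be completed separately: in any order, the last vertex of d
  and \<open>take l c\<close> would complete two of them. After the rotation the third edge contains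
  one further vertex of c, and the five edges are complete at the distinct lengths \<open>l\<close>,
  \<open>l + h\<close>, \<open>l + h + 1\<close>, \<open>l + h + h\<close> and
  \<open>l + h + h + h\<close>.\<close>

lemma card_frames_ge:
  assumes L: "codegree_ge L D" and N: "N = l + h + h + h" and D: "D \<ge> N"
    and t: "length t = h" "distinct t" "set t \<subseteq> V" "set t \<inter> L = {}"
  shows "(D - N) ^ N \<le> real (card {xs. length xs = N \<and> set xs \<subseteq> L \<and> frame t xs})"
proof -
  have LV: "L \<subseteq> V" using L by (simp add: codegree_ge_def)
  then have fL: "finite L" using finV finite_subset by blast
  define G where "G = frame t"
  note G_eq = G_def
  note G_def = fun_cong[OF G_eq, unfolded frame_def]
  have ctl: "card (set (take l t)) = l" using t h by (simp add: distinct_card)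
  have step: "D - N \<le> real (card {x\<in>L. G (p @ [x])})"
    if p: "length p < N" "set p \<subseteq> L" "G p" for p
  proof -
    have dp: "distinct p" using p by (simp add: G_def)
    have dis: "set t \<inter> set p = {}" using p t by blast
    have dis2: "set (take l t) \<inter> set (drop m p) = {}" for m
      using dis set_take_subset[of l t] set_drop_subset[of m p] by blast
    have *: ?thesis if S: "S \<subseteq> V" "card S = l + h - 1"
      and GS: "\<And>x. x \<in> L \<Longrightarrow> x \<notin> set p \<Longrightarrow> insert x S \<in> E \<Longrightarrow> G (p @ [x])" for S
    proof -
      have "D - N \<le> real (card {x\<in>L. x \<notin> set p \<and> insert x S \<in> E})"
        using p S by (intro card_extensions_ge[OF L]) auto
      also have "\<dots> \<le> real (card {x\<in>L. G (p @ [x])})"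
        unfolding of_nat_le_iff by (rule card_mono) (use fL GS in auto)
      finally show ?thesis .
    qed
    consider "length p = l - 1" | "length p = l + h - 1" | "length p = l + h"
      | "length p = l + h + h - 1" | "length p = N - 1"
      | "length p \<noteq> l - 1" "length p \<noteq> l + h - 1" "length p \<noteq> l + h"
        "length p \<noteq> l + h + h - 1" "length p \<noteq> N - 1" by blast
    then show ?thesis
    proof cases
      case 1
      show ?thesis
      proof (rule *[of "set t \<union> set p"])
        show "card (set t \<union> set p) = l + h - 1"
          using dis t dp 1 l_pos by (simp add: card_Un_disjoint distinct_card)
        show "G (p @ [x])" if "x \<in> L" "x \<notin> set p" "insert x (set t \<union> set p) \<in> E" for x
          using 1 dp h l_pos g_pos N that by (auto simp: G_def)
      qed (use t p LV in auto)
    next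
      case 2
      show ?thesis
      proof (rule *[of "set (take l t) \<union> set (drop l p)"])
        show "card (set (take l t) \<union> set (drop l p)) = l + h - 1"
          using dis2[of l] ctl dp 2 l_pos g_pos h by (simp add: card_Un_disjoint distinct_card)
        show "G (p @ [x])" if "x \<in> L" "x \<notin> set p" "insert x (set (take l t) \<union> set (drop l p)) \<in> E" for x
          using 2 p h l_pos g_pos N that by (auto simp: G_def)
      qed (use t p LV in \<open>auto dest: in_set_dropD in_set_takeD\<close>)
    next
      case 3
      show ?thesis
      proof (rule *[of "set (drop 1 p)"])
        show "card (set (drop 1 p)) = l + h - 1"
          using dp 3 l_pos by (simp add: distinct_card)
        show "G (p @ [x])" if "x \<in> L" "x \<notin> set p" "insert x (set (drop 1 p)) \<in> E" for x
          using 3 p h l_pos g_pos N that by (auto simp: G_def)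
      qed (use t p LV in \<open>auto dest: in_set_dropD in_set_takeD\<close>)
    next
      case 4
      have dd: "set (take l p) \<inter> set (drop (l + h) p) = {}" using dp
        by (simp add: set_take_disj_set_drop_if_distinct)
      show ?thesis
      proof (rule *[of "set (take l p) \<union> set (drop (l + h) p)"])
        show "card (set (take l p) \<union> set (drop (l + h) p)) = l + h - 1"
          using dd dp 4 l_pos g_pos h by (simp add: card_Un_disjoint distinct_card)
        show "G (p @ [x])" if "x \<in> L" "x \<notin> set p" "insert x (set (take l p) \<union> set (drop (l + h) p)) \<in> E" for x
          using 4 p h l_pos g_pos N that by (auto simp: G_def)
      qed (use t p LV in \<open>auto dest: in_set_dropD in_set_takeD\<close>)
    next
      case 5
      have "set (take l (drop l p)) \<inter> set (drop (h + h) (drop l p)) = {}" using dp h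
        by (intro set_take_disj_set_drop_if_distinct) auto
      then have dd: "set (take l (drop l p)) \<inter> set (drop (l + h + h) p) = {}"
        by (simp add: add_ac)
      have "set (take l (drop l p)) \<union> set (drop (l + h + h) p) \<subseteq> set p"
        by (meson Un_least order_trans set_drop_subset set_take_subset)
      then have sub: "set (take l (drop l p)) \<union> set (drop (l + h + h) p) \<subseteq> V"
        using p LV by blast
      show ?thesis
      proof (rule *[of "set (take l (drop l p)) \<union> set (drop (l + h + h) p)"])
        show "card (set (take l (drop l p)) \<union> set (drop (l + h + h) p)) = l + h - 1"
          using dd dp 5 l_pos g_pos h N by (simp add: card_Un_disjoint distinct_card)
        show "G (p @ [x])" if "x \<in> L" "x \<notin> set p"
            "insert x (set (take l (drop l p)) \<union> set (drop (l + h + h) p)) \<in> E" for x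
          using 5 p h l_pos g_pos N that by (auto simp: G_def)
      qed (rule sub)
    next
      case 6
      have "D - N \<le> real (card {x\<in>L. x \<notin> set p})"
        using p by (intro card_free_extensions_ge[OF L]) auto
      also have "\<dots> \<le> real (card {x\<in>L. G (p @ [x])})"
        unfolding of_nat_le_iff
      proof (rule card_mono)
        have "(l \<le> Suc (length p)) = (l \<le> length p)" using 6(1) l_pos by linarith
        moreover have "(l + h \<le> Suc (length p)) = (l + h \<le> length p)" using 6(2) l_pos by linarith
        moreover have "(l + h + 1 \<le> Suc (length p)) = (l + h + 1 \<le> length p)" using 6(3) by linarith
        moreover have "(l + h + h \<le> Suc (length p)) = (l + h + h \<le> length p)" using 6(4) l_pos by linarith
        moreover have "\<not> l + h + h + h \<le> Suc (length p)" using 6(5) p(1) N by linarith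
        ultimately have "G (p @ [x])" if "x \<in> L" "x \<notin> set p" for x
          using p(3) that by (simp add: G_def)
        then show "{x\<in>L. x \<notin> set p} \<subseteq> {x\<in>L. G (p @ [x])}" by blast
      qed (use fL in auto)
      finally show ?thesis .
    qed
  qed
  let ?G = "{xs. length xs = N \<and> set xs \<subseteq> L \<and> G xs}"
  have "G []" using h l_pos N by (auto simp: G_def)
  then show ?thesis unfolding G_eq[symmetric]
    using step D by (intro card_lists_sequential_choice[OF fL]) auto
qed

text \<open>The path has two consecutive pairs of edges without t and three with t, hence five
  possible clashes, each excluding at most \<open>fillings\<close> times n^(l + 2 * h) of the
  frames.\<close>

lemma card_absorbers_ge:
  assumes L: "codegree_ge L D" and N: "N = l + h + h + h" and D: "D \<ge> N"
    and t: "length t = h" "distinct t" "set t \<subseteq> V" "set t \<inter> L = {}"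
  shows "(D - N) ^ N - 5 * (fillings * real (card V) ^ (l + h + h)) \<le>
    real (card {xs. length xs = N \<and> set xs \<subseteq> L \<and> absorber xs \<and> absorbs xs t})"
proof -
  have LV: "L \<subseteq> V" using L by (simp add: codegree_ge_def)
  then have fL: "finite L" using finV finite_subset by blast
  have ctl: "card (set (take l t)) = l" using t h by (simp add: distinct_card)
  note G_def = frame_def
  let ?G = "{xs. length xs = N \<and> set xs \<subseteq> L \<and> frame t xs}"
  have cardG: "(D - N) ^ N \<le> real (card ?G)" using card_frames_ge[OF assms] .
  have tl: "set (take l t) \<subseteq> V" using t by (auto dest: in_set_takeD)
  have nn: "fillings \<ge> 0" using fillings_nonneg[OF _ tl ctl] by simp
  let ?bad = "\<lambda>a b C S j. {xs. length xs = N \<and> set xs \<subseteq> V \<and>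
      C (take a xs) (drop (a + h) xs) \<and>
      S (take a xs) (drop (a + h) xs) \<union> set (take h (drop a xs)) \<in> E \<and>
      \<phi> (S (take a xs) (drop (a + h) xs) \<union> set (take h (drop a xs))) = j (take a xs) (drop (a + h) xs)}"
  \<comment> \<open>The free entries are \<open>part_a\<close> in \<open>?X1\<close> and
    \<open>?X2\<close>, \<open>part_d\<close> in \<open>?X3\<close> and \<open>?X4\<close>, and in
    \<open>?X5\<close> the last \<open>h\<close> vertices of the edge on \<open>part_c\<close> and
    \<open>part_r\<close>. In each case the other edge of the clash avoids them.\<close>
  let ?X1 = "?bad (l + h + h) 0 (\<lambda>u w. distinct u) (\<lambda>u w. set (take l (drop l u)))
    (\<lambda>u w. \<phi> (set (take (l + h) (drop 1 u))))"
  let ?X2 = "?bad (l + h + h) 0 (\<lambda>u w. distinct u) (\<lambda>u w. set (take l (drop l u)))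
    (\<lambda>u w. \<phi> (set (take l t) \<union> set (take h (drop l u))))"
  let ?X3 = "?bad l (h + h) (\<lambda>u w. distinct (u @ w)) (\<lambda>u w. set (drop 1 u @ take 1 w))
    (\<lambda>u w. \<phi> (set u \<union> set (take h w)))"
  let ?X4 = "?bad l (h + h) (\<lambda>u w. True) (\<lambda>u w. set (take l t)) (\<lambda>u w. \<phi> (set t \<union> set u))"
  let ?X5 = "?bad (l + h) h (\<lambda>u w. distinct u) (\<lambda>u w. set (take l u)) (\<lambda>u w. \<phi> (set t \<union> set (take l u)))"
  let ?Y = "{xs. length xs = N \<and> set xs \<subseteq> L \<and> absorber xs \<and> absorbs xs t}"
  have b1: "real (card ?X1) \<le> fillings * real (card V) ^ ((l + h + h) + 0)"
    using h N by (intro card_conflicts_le nn) (auto simp: distinct_card dest: in_set_takeD in_set_dropD)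
  have b2: "real (card ?X2) \<le> fillings * real (card V) ^ ((l + h + h) + 0)"
    using h N by (intro card_conflicts_le nn) (auto simp: distinct_card dest: in_set_takeD in_set_dropD)
  have b3: "real (card ?X3) \<le> fillings * real (card V) ^ (l + (h + h))"
  proof (intro card_conflicts_le nn)
    fix u w :: "'a list"
    assume a: "distinct (u @ w)" "set u \<subseteq> V" "set w \<subseteq> V" "length u = l" "length w = h + h"
    have "distinct (drop 1 u @ take 1 w)" using a(1)
      by (auto dest: in_set_takeD in_set_dropD)
    then have "card (set (drop 1 u @ take 1 w)) = length (drop 1 u @ take 1 w)" by (rule distinct_card)
    then show "set (drop 1 u @ take 1 w) \<subseteq> V \<and> card (set (drop 1 u @ take 1 w)) = l"
      using a l_pos h by (auto dest: in_set_takeD in_set_dropD)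
  qed (use N in simp)
  have b4: "real (card ?X4) \<le> fillings * real (card V) ^ (l + (h + h))"
    using tl ctl N by (intro card_conflicts_le nn) auto
  have b5: "real (card ?X5) \<le> fillings * real (card V) ^ ((l + h) + h)"
    using h N by (intro card_conflicts_le nn) (auto simp: distinct_card dest: in_set_takeD)
  have fin: "finite {xs. length xs = N \<and> set xs \<subseteq> V \<and> P xs}" for P
    by (rule finite_subset[OF _ finite_lists_length_eq[OF finV, of N]]) auto
  have finY: "finite ?Y"
    by (rule finite_subset[OF _ finite_lists_length_eq[OF finV, of N]]) (use LV in auto)
  have sub: "xs \<in> ?Y" if G: "xs \<in> ?G" and nb: "xs \<notin> ?X1" "xs \<notin> ?X2" "xs \<notin> ?X3" "xs \<notin> ?X4" "xs \<notin> ?X5" for xs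
  proof -
    have xs: "length xs = N" "set xs \<subseteq> L" "distinct xs" using G by (auto simp: G_def)
    have xsV: "set xs \<subseteq> V" using xs LV by auto
    let ?a = "part_a xs" and ?d = "part_d xs" and ?c = "part_c xs" and ?r = "part_r xs"
    define M Q where "M = take l xs" and "Q = take g (drop (l + h) xs)"
    have sp: "xs = M @ ?d @ Q @ ?r @ ?a"
    proof -
      have "xs = take l xs @ take h (drop l xs) @ take g (drop h (drop l xs)) @
          take l (drop g (drop h (drop l xs))) @ drop l (drop g (drop h (drop l xs)))"
        by (simp only: append_take_drop_id)
      moreover have "drop l (drop g (drop h (drop l xs))) = drop (l + h + h) xs"
        unfolding drop_drop by (rule arg_cong[where f = "\<lambda>i. drop i xs"]) (simp add: h)
      ultimately have "xs = take l xs @ take h (drop l xs) @ take g (drop h (drop l xs)) @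
          take l (drop g (drop h (drop l xs))) @ drop (l + h + h) xs" by simp
      then show ?thesis
        unfolding M_def Q_def part_a_def part_d_def part_r_def by (simp add: add_ac)
    qed
    have len: "length M = l" "length ?d = h" "length Q = g" "length ?r = l" "length ?a = h"
      unfolding M_def Q_def part_d_def part_r_def part_a_def using xs(1) N h by auto
    have c: "?c = M @ Q" by (simp add: part_c_def M_def Q_def)
    obtain m M' where M: "M = m # M'" using len(1) l_pos by (cases M) auto
    obtain q Q' where Q: "Q = q # Q'" using len(3) g_pos by (cases Q) auto
    have e_tc: "set t \<union> set (take l xs) = ed t ?c" by (auto simp: ed_def c len(1) M_def[symmetric])
    have e_dt: "set (take l t) \<union> set (take h (drop l xs)) = ed ?d t"
      by (auto simp: ed_def part_d_def)
    have tk1: "take (l + h) (drop 1 xs) = M' @ ?d @ [q]"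
    proof -
      have "drop 1 xs = (M' @ ?d @ [q]) @ Q' @ ?r @ ?a" by (subst sp) (simp add: M Q)
      moreover have "length (M' @ ?d @ [q]) = l + h" using len by (simp add: M)
      ultimately show ?thesis by (metis append_eq_conv_conj)
    qed
    \<comment> \<open>Rotation drops \<open>m\<close> from the first \<open>l\<close> vertices of
      \<open>part_c\<close> and takes in \<open>q\<close> instead; together with
      \<open>part_d\<close> these occupy positions 1 to \<open>l + h\<close> of
      \<open>xs\<close>.\<close>
    have e_dc: "set (take (l + h) (drop 1 xs)) = ed ?d (rotate1 ?c)"
    proof -
      have "take l (rotate1 ?c) = M' @ [q]" 
      proof -
        have "rotate1 ?c = (M' @ [q]) @ Q' @ [m]" by (simp add: c M Q)
        moreover have "length (M' @ [q]) = l" using len by (simp add: M)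
        ultimately show ?thesis by (metis append_eq_conv_conj)
      qed
      then show ?thesis unfolding tk1 by (auto simp: ed_def)
    qed
    have dr: "drop (l + h) xs = (Q @ ?r) @ ?a"
    proof -
      have "xs = (M @ ?d) @ ((Q @ ?r) @ ?a)" by (subst sp) simp
      moreover have "length (M @ ?d) = l + h" using len by simp
      ultimately show ?thesis by (metis append_eq_conv_conj)
    qed
    have "length (Q @ ?r) = h" using len(3,4) by (metis add.commute h length_append)
    then have tk: "take h (drop (l + h) xs) = Q @ ?r" unfolding dr by simp
    have e_cr: "set (take l xs) \<union> set (take h (drop (l + h) xs)) = ed ?c ?r"
      unfolding tk by (auto simp: ed_def c len M_def[symmetric])
    have e_ad: "set (take l (drop l xs)) \<union> set (drop (l + h + h) xs) = ed ?a ?d"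
    proof -
      have "take l (drop l xs) = take l ?d" unfolding part_d_def using h by simp
      then show ?thesis by (auto simp: ed_def part_a_def)
    qed
    have E: "ed t ?c \<in> E" "ed ?d t \<in> E" "ed ?d (rotate1 ?c) \<in> E" "ed ?c ?r \<in> E" "ed ?a ?d \<in> E"
    proof -
      have "1 \<le> h" using h g_pos by simp
      then have "set t \<union> set (take l xs) \<in> E" "set (take l t) \<union> set (take h (drop l xs)) \<in> E"
        "set (take (l + h) (drop 1 xs)) \<in> E" "set (take l xs) \<union> set (take h (drop (l + h) xs)) \<in> E"
        "set (take l (drop l xs)) \<union> set (drop (l + h + h) xs) \<in> E"
        using G N unfolding mem_Collect_eq frame_def by simp_all
      then show "ed t ?c \<in> E" "ed ?d t \<in> E" "ed ?d (rotate1 ?c) \<in> E" "ed ?c ?r \<in> E" "ed ?a ?d \<in> E"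
        unfolding e_tc e_dt e_dc e_cr e_ad .
    qed
    have u1: "take h (drop (l + h + h) xs) = ?a" using xs(1) N by (simp add: part_a_def)
    have t1: "take l (drop l (take (l + h + h) xs)) = take l (drop l xs)"
      and t2: "take h (drop l (take (l + h + h) xs)) = take h (drop l xs)"
      and t3: "take (l + h) (drop 1 (take (l + h + h) xs)) = take (l + h) (drop 1 xs)"
      using h g_pos by (simp_all add: drop_take)
    have n1: "\<phi> (ed ?a ?d) \<noteq> \<phi> (ed ?d (rotate1 ?c))"
    proof
      assume a: "\<phi> (ed ?a ?d) = \<phi> (ed ?d (rotate1 ?c))"
      have s1: "set (take l (drop l (take (l + h + h) xs))) \<union> set (take h (drop (l + h + h) xs)) = ed ?a ?d"
        unfolding u1 t1 by (rule e_ad[folded part_a_def])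
      have s2: "set (take (l + h) (drop 1 (take (l + h + h) xs))) = ed ?d (rotate1 ?c)"
        unfolding t3 by (rule e_dc)
      have "xs \<in> ?X1" unfolding mem_Collect_eq s1 s2 using a xs xsV E by simp
      then show False by (rule notE[OF nb(1)])
    qed
    have n2: "\<phi> (ed ?a ?d) \<noteq> \<phi> (ed ?d t)"
    proof
      assume a: "\<phi> (ed ?a ?d) = \<phi> (ed ?d t)"
      have s1: "set (take l (drop l (take (l + h + h) xs))) \<union> set (take h (drop (l + h + h) xs)) = ed ?a ?d"
        unfolding u1 t1 by (rule e_ad[folded part_a_def])
      have s2: "set (take l t) \<union> set (take h (drop l (take (l + h + h) xs))) = ed ?d t"
        unfolding t2 by (rule e_dt)
      have "xs \<in> ?X2" unfolding mem_Collect_eq s1 s2 using a xs xsV E by simp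
      then show False by (rule notE[OF nb(2)])
    qed
    have n3: "\<phi> (ed ?d (rotate1 ?c)) \<noteq> \<phi> (ed ?c ?r)"
    proof
      assume a: "\<phi> (ed ?d (rotate1 ?c)) = \<phi> (ed ?c ?r)"
      have s1: "set (drop 1 (take l xs) @ take 1 (drop (l + h) xs)) \<union> set (take h (drop l xs)) = ed ?d (rotate1 ?c)"
      proof -
        have "take (l + h) (drop 1 xs) = drop 1 (take l xs) @ take h (drop l xs) @ take 1 (drop (l + h) xs)"
        proof -
          have "take l xs = m # M'" using M by (simp add: M_def)
          moreover have "drop (l + h) xs = q # Q' @ ?r @ ?a" unfolding dr by (simp add: Q)
          moreover have "take h (drop l xs) = ?d" by (simp add: part_d_def)
          ultimately show ?thesis unfolding tk1 by simp
        qed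
        then show ?thesis unfolding e_dc[symmetric] by auto
      qed
      have "distinct (take l xs @ drop (l + h) xs)" using xs(3)
        by (auto simp: set_take_disj_set_drop_if_distinct)
      then have "xs \<in> ?X3" unfolding mem_Collect_eq s1 e_cr using a xs xsV E by simp
      then show False by (rule notE[OF nb(3)])
    qed
    have n4: "\<phi> (ed ?d t) \<noteq> \<phi> (ed t ?c)"
    proof
      assume a: "\<phi> (ed ?d t) = \<phi> (ed t ?c)"
      have "xs \<in> ?X4" unfolding mem_Collect_eq e_dt e_tc using a xs xsV E by simp
      then show False by (rule notE[OF nb(4)])
    qed
    have n5: "\<phi> (ed t ?c) \<noteq> \<phi> (ed ?c ?r)"
    proof
      assume a: "\<phi> (ed t ?c) = \<phi> (ed ?c ?r)"
      have s1: "take l (take (l + h) xs) = take l xs" by simp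
      have "xs \<in> ?X5" unfolding mem_Collect_eq s1 e_cr e_tc using a xs xsV E by simp
      then show False by (rule notE[OF nb(5)])
    qed
    show ?thesis unfolding mem_Collect_eq absorber_def absorbs_def
      using xs N E n1 n2 n3 n4 n5 by simp
  qed
  have "?G \<subseteq> ?Y \<union> (?X1 \<union> (?X2 \<union> (?X3 \<union> (?X4 \<union> ?X5))))"
  proof
    fix xs assume "xs \<in> ?G"
    from sub[OF this] show "xs \<in> ?Y \<union> (?X1 \<union> (?X2 \<union> (?X3 \<union> (?X4 \<union> ?X5))))"
      unfolding Un_iff by argo
  qed
  then have "card ?G \<le> card (?Y \<union> (?X1 \<union> (?X2 \<union> (?X3 \<union> (?X4 \<union> ?X5)))))"
    using finY fin by (intro card_mono) auto
  also have "\<dots> \<le> card ?Y + (card ?X1 + (card ?X2 + (card ?X3 + (card ?X4 + card ?X5))))"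
    by (intro order_trans[OF card_Un_le] add_left_mono order_refl)
  finally have "real (card ?G) \<le> real (card ?Y) + (real (card ?X1) + (real (card ?X2) +
      (real (card ?X3) + (real (card ?X4) + real (card ?X5)))))"
    by linarith
  also have "\<dots> \<le> real (card ?Y) + 5 * (fillings * real (card V) ^ (l + h + h))"
    using b1 b2 b3 b4 b5 by (simp add: add_ac)
  finally show ?thesis using cardG by linarith
qed

end

subsection \<open>Cyclic sequences of chunks\<close>

lemma nth_concat_uniform:
  assumes "\<forall>c\<in>set cs. length c = h" "i < length cs" "j < h"
  shows "concat cs ! (i * h + j) = cs ! i ! j"
  using assms
proof (induction cs arbitrary: i)
  case (Cons c cs)
  then show ?case by (cases i) (auto simp: nth_append)
qed simp

lemma length_concat_uniform:
  "\<forall>c\<in>set cs. length c = h \<Longrightarrow> length (concat cs) = length cs * h"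
  by (induction cs) auto

lemma distinct_concat_disjoint:
  assumes "distinct (concat cs)" "i < length cs" "j < length cs" "i \<noteq> j"
  shows "set (cs ! i) \<inter> set (cs ! j) = {}"
  using assms
proof (induction cs arbitrary: i j)
  case (Cons c cs)
  then show ?case by (cases i; cases j) (force dest: nth_mem)+
qed simp

lemma distinct_concat_nth: "distinct (concat cs) \<Longrightarrow> i < length cs \<Longrightarrow> distinct (cs ! i)"
  by (induction cs arbitrary: i) (auto simp: nth_Cons split: nat.splits)

definition olist :: "'b list option \<Rightarrow> 'b list" where
  "olist o1 = (case o1 of None \<Rightarrow> [] | Some t \<Rightarrow> t)"

lemma mset_concat_olist_update:
  "i < length os \<Longrightarrow> os ! i = None \<Longrightarrow>
    mset (concat (map olist (os[i := Some t]))) = mset t + mset (concat (map olist os))"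
proof (induction os arbitrary: i)
  case (Cons x os)
  then show ?case by (cases i) (auto simp: olist_def)
qed simp

text \<open>Greedy assignment: when a member of \<open>ts\<close> is placed, fewer slots are
  occupied than are suitable for it. Counting multisets records that all of \<open>ts\<close> is
  placed, each member once.\<close>

lemma assign_slots:
  assumes "\<forall>t\<in>set ts. length ts \<le> card {i. i < m \<and> P i t}"
  shows "\<exists>os. length os = m \<and> (\<forall>i<m. \<forall>t. os ! i = Some t \<longrightarrow> P i t \<and> t \<in> set ts)
    \<and> mset (concat (map olist os)) = mset (concat ts) \<and> card {i. i < m \<and> os ! i \<noteq> None} \<le> length ts"
  using assms
proof (induction ts)
  case Nil
  show ?case by (rule exI[of _ "replicate m None"]) (auto simp: olist_def)
next
  case (Cons t ts)
  have "\<forall>t\<in>set ts. length ts \<le> card {i. i < m \<and> P i t}" using Cons.prems by fastforce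
  then obtain os where os: "length os = m" "\<forall>i<m. \<forall>t. os ! i = Some t \<longrightarrow> P i t \<and> t \<in> set ts"
    "mset (concat (map olist os)) = mset (concat ts)" "card {i. i < m \<and> os ! i \<noteq> None} \<le> length ts"
    using Cons.IH by auto
  have "\<not> {i. i < m \<and> P i t} \<subseteq> {i. i < m \<and> os ! i \<noteq> None}"
  proof
    assume "{i. i < m \<and> P i t} \<subseteq> {i. i < m \<and> os ! i \<noteq> None}"
    then have "card {i. i < m \<and> P i t} \<le> card {i. i < m \<and> os ! i \<noteq> None}" by (intro card_mono) auto
    moreover have "Suc (length ts) \<le> card {i. i < m \<and> P i t}" using Cons.prems by simp
    ultimately show False using os(4) by linarith
  qed
  then obtain i where i: "i < m" "P i t" "os ! i = None" by auto
  have "{j. j < m \<and> os[i := Some t] ! j \<noteq> None} = insert i {j. j < m \<and> os ! j \<noteq> None}"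
    using i os(1) by (auto simp: nth_list_update)
  then have "card {j. j < m \<and> os[i := Some t] ! j \<noteq> None} \<le> Suc (length ts)"
    using os(4) by (simp add: card_insert_if)
  moreover have "\<forall>j<m. \<forall>t'. os[i := Some t] ! j = Some t' \<longrightarrow> P j t' \<and> t' \<in> set (t # ts)"
    using os(1,2) i by (auto simp: nth_list_update)
  moreover have "mset (concat (map olist (os[i := Some t]))) = mset (concat (t # ts))"
    using mset_concat_olist_update[of i os t] os i by simp
  ultimately show ?case using os(1) by (intro exI[of _ "os[i := Some t]"]) simp
qed

context coloured_graph begin

text \<open>An edge lies within two consecutive chunks and meets the second only in its first
  \<open>l\<close> vertices, so with disjoint chunks only consecutive edges intersect and only their
  colours are compared. The last list enters through its first \<open>l\<close> entries
  alone.\<close>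

fun good :: "'a list list \<Rightarrow> bool" where
  "good (a # b # cs) \<longleftrightarrow> ed a b \<in> E \<and> (cs \<noteq> [] \<longrightarrow> \<phi> (ed a b) \<noteq> \<phi> (ed b (hd cs))) \<and> good (b # cs)"
| "good _ \<longleftrightarrow> True"

text \<open>Every condition in \<open>good\<close> involves at most three consecutive chunks, so a
  window of two shared chunks loses none of them.\<close>

lemma good_split: "good (xs @ a # b # ys) \<longleftrightarrow> good (xs @ [a, b]) \<and> good (a # b # ys)"
proof (induction xs)
  case (Cons x xs)
  show ?case
  proof (cases xs)
    case (Cons y zs)
    then show ?thesis using Cons.IH by (cases zs) auto
  qed auto
qed auto

lemma good_nth:
  assumes "good cs"
  shows "Suc i < length cs \<Longrightarrow> ed (cs ! i) (cs ! Suc i) \<in> E"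
    and "Suc (Suc i) < length cs \<Longrightarrow> \<phi> (ed (cs ! i) (cs ! Suc i)) \<noteq> \<phi> (ed (cs ! Suc i) (cs ! Suc (Suc i)))"
proof -
  have "(Suc i < length cs \<longrightarrow> ed (cs ! i) (cs ! Suc i) \<in> E) \<and>
    (Suc (Suc i) < length cs \<longrightarrow> \<phi> (ed (cs ! i) (cs ! Suc i)) \<noteq> \<phi> (ed (cs ! Suc i) (cs ! Suc (Suc i))))"
    using assms
  proof (induction cs arbitrary: i rule: good.induct)
    case (1 a b cs)
    then show ?case by (cases i) (auto simp: hd_conv_nth)
  qed auto
  then show "Suc i < length cs \<Longrightarrow> ed (cs ! i) (cs ! Suc i) \<in> E"
    "Suc (Suc i) < length cs \<Longrightarrow> \<phi> (ed (cs ! i) (cs ! Suc i)) \<noteq> \<phi> (ed (cs ! Suc i) (cs ! Suc (Suc i)))"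
    by auto
qed

text \<open>Appending the first two chunks turns the wrap-around into conditions on a linear
  sequence: one more chunk gives the closing edge, the second gives its colour comparison with the
  first edge.\<close>

lemma hamilton_cycle_of_good:
  assumes len: "\<forall>c\<in>set cs. length c = h" and m: "3 \<le> length cs"
    and dist: "distinct (concat cs)" and V: "verts cs = V" and good: "good (cs @ take 2 cs)"
  shows "\<exists>C. hamilton_kl_cycle (l + h) l V E C \<and> properly_colored C \<phi>"
proof -
  define m where "m = length cs"
  define n where "n = card V"
  define v where "v = (\<lambda>i. concat cs ! i)"
  define nx where "nx = (\<lambda>i. Suc i mod m)"
  define D where "D = (\<lambda>i. ed (cs ! i) (cs ! nx i))"
  have h0: "0 < h" "l \<le> h" using h g_pos by auto
  have m3: "3 \<le> m" using m by (simp add: m_def)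
  have lc: "length (concat cs) = m * h" unfolding m_def using len by (rule length_concat_uniform)
  have n: "n = m * h" unfolding n_def V[symmetric] using distinct_card[OF dist] lc by (simp del: set_concat)
  have n0: "0 < n" using n m3 h0 by simp
  have nx: "nx i < m" "nx i \<noteq> i" if "i < m" for i
    using that m3 by (auto simp: nx_def mod_Suc)
  have nx2: "nx (nx i) \<noteq> i" if "i < m" for i
    using that m3 by (auto simp: nx_def mod_Suc)
  have nxinj: "i = j" if "nx i = nx j" "i < m" "j < m" for i j
    using that m3 by (auto simp: nx_def mod_Suc split: if_splits)
  have vv: "v (i * h + j) = cs ! i ! j" if "i < m" "j < h" for i j
    unfolding v_def using len that by (intro nth_concat_uniform) (auto simp: m_def)
  have lci: "length (cs ! i) = h" if "i < m" for i using that len by (auto simp: m_def)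
  have disj: "set (cs ! i) \<inter> set (cs ! j) = {}" if "i < m" "j < m" "i \<noteq> j" for i j
    using distinct_concat_disjoint[OF dist] that by (simp add: m_def)
  have dci: "distinct (cs ! i)" if "i < m" for i
    using distinct_concat_nth[OF dist] that by (simp add: m_def)
  have lt: "i * h + j < n" if "i < m" "j < h" for i j
  proof -
    have "i * h + j < i * h + h" using that by simp
    also have "\<dots> = Suc i * h" by simp
    also have "\<dots> \<le> m * h" using that by (intro mult_right_mono) auto
    finally show ?thesis by (simp add: n)
  qed
  have seg: "cyc_segment v n (l + h) (i * h) = D i" if i: "i < m" for i
  proof -
    have 1: "v ((i * h + j) mod n) = cs ! i ! j" if "j < h" for j
      using lt[OF i that] vv[OF i that] by simp
    have 2: "v ((i * h + (h + j)) mod n) = cs ! nx i ! j" if "j < l" for j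
    proof -
      have jh: "j < h" using that h0 by simp
      have "(i * h + (h + j)) mod n = nx i * h + j"
      proof (cases "Suc i = m")
        case True
        then have "n = Suc i * h" by (simp only: n)
        then have "i * h + (h + j) = n + j" by simp
        then have "(i * h + (h + j)) mod n = (n + j) mod n" by (rule arg_cong)
        also have "\<dots> = j mod n" by simp
        also have "\<dots> = j" using lt[of 0 j] m3 jh by simp
        finally show ?thesis using True by (simp add: nx_def)
      next
        case False
        then have "nx i = Suc i" "Suc i < m" using i by (auto simp: nx_def)
        have "(i * h + (h + j)) mod n = (Suc i * h + j) mod n" by (simp add: add_ac)
        also have "\<dots> = Suc i * h + j" using lt[OF \<open>Suc i < m\<close> jh] by (rule mod_less)
        finally show ?thesis using \<open>nx i = Suc i\<close> by simp
      qed
      then show ?thesis using vv[OF nx(1)[OF i] jh] by simp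
    qed
    have "cyc_segment v n (l + h) (i * h) =
      (\<lambda>j. v ((i * h + j) mod n)) ` {..<h} \<union> (\<lambda>j. v ((i * h + (h + j)) mod n)) ` {..<l}"
    proof (intro equalityI subsetI)
      fix x assume "x \<in> cyc_segment v n (l + h) (i * h)"
      then obtain j where j: "j < l + h" "x = v ((i * h + j) mod n)" by (auto simp: cyc_segment_def)
      show "x \<in> (\<lambda>j. v ((i * h + j) mod n)) ` {..<h} \<union> (\<lambda>j. v ((i * h + (h + j)) mod n)) ` {..<l}"
      proof (cases "j < h")
        case False
        then have "x = v ((i * h + (h + (j - h))) mod n)" "j - h < l" using j by auto
        then show ?thesis by blast
      qed (use j in auto)
    next
      fix x assume "x \<in> (\<lambda>j. v ((i * h + j) mod n)) ` {..<h} \<union> (\<lambda>j. v ((i * h + (h + j)) mod n)) ` {..<l}"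
      then show "x \<in> cyc_segment v n (l + h) (i * h)"
      proof (elim UnE)
        assume "x \<in> (\<lambda>j. v ((i * h + j) mod n)) ` {..<h}"
        then show "x \<in> cyc_segment v n (l + h) (i * h)" by (auto simp: cyc_segment_def)
      next
        assume "x \<in> (\<lambda>j. v ((i * h + (h + j)) mod n)) ` {..<l}"
        then obtain j where "j < l" "x = v ((i * h + (h + j)) mod n)" by auto
        then show "x \<in> cyc_segment v n (l + h) (i * h)"
          unfolding cyc_segment_def by (intro CollectI exI[of _ "h + j"]) simp
      qed
    qed
    also have "(\<lambda>j. v ((i * h + j) mod n)) ` {..<h} = (!) (cs ! i) ` {0..<h}"
      using 1 by (intro image_cong) auto
    also have "\<dots> = set (cs ! i)" using nth_image[of h "cs ! i"] lci[OF i] by simp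
    also have "(\<lambda>j. v ((i * h + (h + j)) mod n)) ` {..<l} = (!) (cs ! nx i) ` {0..<l}"
      using 2 by (intro image_cong) auto
    also have "\<dots> = set (take l (cs ! nx i))"
      using nth_image[of l "cs ! nx i"] lci[OF nx(1)[OF i]] h0 by simp
    finally show ?thesis by (simp add: D_def ed_def)
  qed
  have seg_wrap: "cyc_segment v n (l + h) (Suc i * h) = D (nx i)" if i: "i < m" for i
  proof (cases "Suc i = m")
    case True
    have "(Suc i * h + j) mod n = (0 * h + j) mod n" for j by (simp add: True n)
    then have "cyc_segment v n (l + h) (Suc i * h) = cyc_segment v n (l + h) (0 * h)"
      unfolding cyc_segment_def by presburger
    then show ?thesis using seg[of 0] m3 True by (simp add: nx_def)
  next
    case False
    then have "nx i = Suc i" "Suc i < m" using i by (auto simp: nx_def)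
    then show ?thesis using seg[of "Suc i"] by (simp only:)
  qed
  have nthy: "(cs @ take 2 cs) ! i = cs ! (i mod m)" if "i < m + 2" for i
  proof (cases "i < m")
    case False
    then have "i mod m = (i - m) mod m" by (intro le_mod_geq) simp
    also have "\<dots> = i - m" using that m3 by (intro mod_less) linarith
    finally show ?thesis using False that by (simp add: nth_append m_def)
  qed (simp add: nth_append m_def)
  have ly: "length (cs @ take 2 cs) = m + 2" using m3 by (simp add: m_def)
  have DE: "D i \<in> E" if "i < m" for i
    using good_nth(1)[OF good, unfolded ly, of i] that by (simp add: nthy D_def nx_def)
  have Dcol: "\<phi> (D i) \<noteq> \<phi> (D (nx i))" if "i < m" for i
    using good_nth(2)[OF good, unfolded ly, of i] that by (simp add: nthy D_def nx_def mod_Suc_eq)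
  have sub: "set (take l (cs ! j)) \<subseteq> set (cs ! j)" for j by (rule set_take_subset)
  \<comment> \<open>With at least three chunks, \<open>i\<close>, \<open>nx i\<close> and
    \<open>nx (nx i)\<close> are distinct, so consecutive edges share nothing beyond the start of
    the middle chunk.\<close>
  have inter: "D i \<inter> D (nx i) = set (take l (cs ! nx i))" if i: "i < m" for i
  proof -
    note a = nx(1)[OF i] nx(2)[OF i] nx(1)[OF nx(1)[OF i]] nx(2)[OF nx(1)[OF i]] nx2[OF i]
    show ?thesis unfolding D_def ed_def
      using disj[OF i a(1) a(2)[symmetric]] disj[OF i a(3) a(5)[symmetric]] disj[OF a(1) a(3) a(4)[symmetric]]
        sub[of "nx i"] sub[of "nx (nx i)"] by blast
  qed
  have card_inter: "card (D i \<inter> D (nx i)) = l" if i: "i < m" for i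
    unfolding inter[OF i] using dci[OF nx(1)[OF i]] lci[OF nx(1)[OF i]] h0 by (simp add: distinct_card)
  have adj: "j = nx i \<or> i = nx j" if ij: "i < m" "j < m" "i \<noteq> j" "D i \<inter> D j \<noteq> {}" for i j
  proof (rule ccontr)
    assume "\<not> ?thesis"
    then have ne: "i \<noteq> nx j" "nx i \<noteq> j" by auto
    have ne2: "nx i \<noteq> nx j" using nxinj ij by blast
    have "set (cs ! i) \<inter> set (cs ! j) = {}" "set (cs ! i) \<inter> set (cs ! nx j) = {}"
      "set (cs ! nx i) \<inter> set (cs ! j) = {}" "set (cs ! nx i) \<inter> set (cs ! nx j) = {}"
      by (rule disj[OF ij(1,2,3)], rule disj[OF ij(1) nx(1)[OF ij(2)] ne(1)],
        rule disj[OF nx(1)[OF ij(1)] ij(2) ne(2)], rule disj[OF nx(1)[OF ij(1)] nx(1)[OF ij(2)] ne2])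
    then have "D i \<inter> D j = {}" unfolding D_def ed_def using sub[of "nx i"] sub[of "nx j"] by blast
    then show False using ij(4) by contradiction
  qed
  let ?C = "D ` {..<m}"
  have CE: "?C \<subseteq> E" using DE by auto
  have "kl_cycle (l + h) l V ?C"
    unfolding kl_cycle_def Let_def
  proof (intro conjI exI[of _ v])
    show "k_graph (l + h) V ?C" using graph CE by (auto simp: k_graph_def)
    show "l + h - l dvd card V" using n by (simp add: n_def)
    show "bij_betw v {..<card V} V"
      unfolding v_def by (rule bij_betw_nth) (use dist V lc n in \<open>auto simp: n_def\<close>)
    have md: "card V div (l + h - l) = m" using n h0 by (simp add: n_def)
    show "?C = (\<lambda>i. cyc_segment v (card V) (l + h) (i * (l + h - l))) ` {..<card V div (l + h - l)}"
      unfolding md using seg by (simp add: n_def)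
    show "\<forall>i<card V div (l + h - l). card (cyc_segment v (card V) (l + h) (i * (l + h - l)) \<inter>
        cyc_segment v (card V) (l + h) (Suc i * (l + h - l))) = l"
      unfolding md unfolding n_def[symmetric] add_diff_cancel_left'
      by (intro allI impI) (simp only: seg seg_wrap card_inter)
  qed
  moreover have "properly_colored ?C \<phi>"
    unfolding properly_colored_def
  proof (intro ballI impI)
    fix e f assume "e \<in> ?C" "f \<in> ?C" and ef: "e \<noteq> f \<and> e \<inter> f \<noteq> {}"
    then obtain i j where ij: "i < m" "j < m" "e = D i" "f = D j" by auto
    then have "i \<noteq> j" using ef by auto
    then have "j = nx i \<or> i = nx j" using adj ij ef by blast
    then show "\<phi> e \<noteq> \<phi> f" using Dcol ij by metis
  qed
  ultimately show ?thesis using CE by (auto simp: hamilton_kl_cycle_def)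
qed

text \<open>An absorber followed by the connection to whatever comes next: \<open>B\<close> fills
  the \<open>l\<close>-list \<open>part_r xs\<close> up to a full chunk, and \<open>z2\<close> is
  the neighbour of the next block.\<close>

fun block :: "'a list \<times> 'a list \<times> 'a list \<times> 'a list \<Rightarrow> 'a list list" where
  "block (xs, B, z1, z2) = [part_a xs, part_d xs, rotate1 (part_c xs), part_r xs @ B, z1, z2]"

fun block_with :: "'a list \<times> 'a list \<times> 'a list \<times> 'a list \<Rightarrow> 'a list option \<Rightarrow> 'a list list" where
  "block_with q None = block q"
| "block_with (xs, B, z1, z2) (Some t) =
    [part_a xs, part_d xs, t, part_c xs, part_r xs @ B, z1, z2]"

lemma length_part_r: "length xs = l + h + h + h \<Longrightarrow> length (part_r xs) = l"
  unfolding part_r_def using h by simp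

text \<open>Insertion leaves the first edge (\<open>part_a\<close>, \<open>part_d\<close>) and the
  edge of \<open>part_c\<close> and \<open>part_r\<close> unchanged as sets, hence also in colour;
  everything outside the inserted stretch sees only these two.\<close>

lemma good_insert:
  assumes "absorber xs" "absorbs xs t" "good (p @ block (xs, B, z1, z2) @ s)"
  shows "good (p @ block_with (xs, B, z1, z2) (Some t) @ s)"
proof -
  let ?a = "part_a xs" and ?d = "part_d xs" and ?c = "part_c xs" and ?r = "part_r xs"
  have "length ?r = l" using assms(1) length_part_r by (simp add: absorber_def)
  then have e: "ed ?c (?r @ B) = ed ?c ?r" "ed (rotate1 ?c) (?r @ B) = ed ?c ?r"
    by (auto simp: ed_def)
  have "good (p @ ?a # ?d # rotate1 ?c # (?r @ B) # z1 # z2 # s)" using assms(3) by simp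
  then have "good (p @ [?a, ?d])" "good (?a # ?d # rotate1 ?c # (?r @ B) # z1 # z2 # s)"
    using good_split[of p ?a ?d] by blast+
  moreover from this(2) have "good (?a # ?d # t # ?c # (?r @ B) # z1 # z2 # s)"
    using assms(1,2) by (simp add: e absorber_def absorbs_def)
  ultimately have "good (p @ ?a # ?d # t # ?c # (?r @ B) # z1 # z2 # s)"
    using good_split[of p ?a ?d] by blast
  then show ?thesis by simp
qed

lemma good_insert_all:
  assumes "\<forall>(q, ot)\<in>set L. absorber (fst q) \<and> (\<forall>t. ot = Some t \<longrightarrow> absorbs (fst q) t)"
    and "good (p @ concat (map (\<lambda>(q, ot). block q) L) @ s)"
  shows "good (p @ concat (map (\<lambda>(q, ot). block_with q ot) L) @ s)"
  using assms
proof (induction L arbitrary: p)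
  case (Cons x L)
  obtain q ot where x: "x = (q, ot)" by (cases x)
  obtain xs B z1 z2 where q: "q = (xs, B, z1, z2)" by (metis prod.exhaust)
  have ab: "absorber xs" "\<And>t. ot = Some t \<Longrightarrow> absorbs xs t"
    using Cons.prems(1) by (auto simp: x q)
  have "good (p @ block q @ (concat (map (\<lambda>(q, ot). block q) L) @ s))"
    using Cons.prems(2) by (simp add: x)
  then have "good (p @ block_with q ot @ (concat (map (\<lambda>(q, ot). block q) L) @ s))"
    using good_insert[OF ab] by (cases ot) (auto simp: q simp del: block.simps)
  then have "good ((p @ block_with q ot) @ concat (map (\<lambda>(q, ot). block q) L) @ s)" by simp
  from Cons.IH[OF _ this] Cons.prems(1) show ?case by (simp add: x)
qed simp

lemma mset_block_with: "mset (concat (block_with q ot)) = mset (concat (block q)) + mset (olist ot)"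
proof -
  obtain xs B z1 z2 where q: "q = (xs, B, z1, z2)" by (metis prod.exhaust)
  have "mset (rotate1 c) = mset c" for c :: "'a list" by (cases c) auto
  then show ?thesis by (cases ot) (auto simp: q olist_def)
qed

lemma mset_insert_all:
  "mset (concat (concat (map (\<lambda>(q, ot). block_with q ot) L))) =
    mset (concat (concat (map (\<lambda>(q, ot). block q) L))) + mset (concat (map (olist \<circ> snd) L))"
proof (induction L)
  case (Cons x L)
  obtain q ot where x: "x = (q, ot)" by (cases x)
  show ?case using Cons by (simp add: x mset_block_with add_ac)
qed simp

subsection \<open>The absorbing path\<close>

lemma codegree_ge_Diff:
  assumes "codegree_ge L D" "finite X" "real (card X) \<le> d"
  shows "codegree_ge (L - X) (D - d)"
proof -
  have L: "finite L" using assms finV finite_subset by (auto simp: codegree_ge_def)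
  have *: "D - d \<le> real (card {x\<in>L - X. P x})" if "D \<le> real (card {x\<in>L. P x})" for P
  proof -
    have "card {x\<in>L. P x} \<le> card ({x\<in>L - X. P x} \<union> X)" using L assms(2) by (intro card_mono) auto
    also have "\<dots> \<le> card {x\<in>L - X. P x} + card X" by (rule card_Un_le)
    finally show ?thesis using that assms(3) by linarith
  qed
  have "{x\<in>L - X. True} = L - X" by auto
  then have "D - d \<le> real (card (L - X))" using *[of "\<lambda>x. True"] assms(1) by (simp add: codegree_ge_def)
  then show ?thesis using assms(1) * by (auto simp: codegree_ge_def)
qed

lemma codegree_ge_mono: "codegree_ge L D \<Longrightarrow> D' \<le> D \<Longrightarrow> codegree_ge L D'"
  unfolding codegree_ge_def by (meson order_trans)

text \<open>The last list of a path is only the beginning, of length \<open>l\<close>, of a chunk.\<close>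

definition path :: "'a list list \<Rightarrow> bool" where
  "path P \<longleftrightarrow> good P \<and> 2 \<le> length P \<and> distinct (concat P) \<and> verts P \<subseteq> V \<and>
    (\<forall>c\<in>set (butlast P). length c = h) \<and> length (last P) = l"

lemma path_append:
  assumes "path P" "good (bs @ P)" "\<forall>c\<in>set bs. length c = h" "distinct (concat bs)"
    "verts bs \<subseteq> V" "verts bs \<inter> verts P = {}"
  shows "path (bs @ P)"
proof -
  have "P \<noteq> []" using assms(1) by (auto simp: path_def)
  then show ?thesis using assms unfolding path_def by (auto simp: butlast_append)
qed

lemma length_concat_path:
  assumes "path P"
  shows "length (concat P) = (length P - 1) * h + l"
proof -
  have "P \<noteq> []" using assms by (auto simp: path_def)
  then have "concat P = concat (butlast P) @ last P"
    by (metis append_butlast_last_id concat_append concat.simps append_Nil2)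
  moreover have "length (concat (butlast P)) = length (butlast P) * h"
    using assms by (intro length_concat_uniform) (simp add: path_def)
  ultimately show ?thesis using assms by (simp add: path_def)
qed

lemma path_head:
  assumes "path P"
  obtains x y zs where "P = x # y # zs" "length (take l x) = l" "distinct (take l x)"
    "set (take l x) \<subseteq> verts P"
proof -
  obtain x y zs where P: "P = x # y # zs"
    using assms by (cases P; cases "tl P") (auto simp: path_def)
  have "length x = h" "distinct x" using assms by (auto simp: path_def P)
  then show thesis using that[OF P] h by (auto dest: in_set_takeD simp: P)
qed

lemma single_edge_path:
  assumes "codegree_ge V D" "0 < D" "l + h - 1 \<le> card V"
  shows "\<exists>P. path P \<and> length P = 2"
proof -
  obtain S where S: "S \<subseteq> V" "card S = l + h - 1" using assms(3) by (meson obtain_subset_with_card_n)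
  then have "D \<le> real (card {x\<in>V. insert x S \<in> E})" using assms(1) by (simp add: codegree_ge_def)
  then have "{x\<in>V. insert x S \<in> E} \<noteq> {}" using assms(2) by (metis card.empty not_le of_nat_0)
  then obtain x where e: "insert x S \<in> E" by auto
  obtain xs where xs: "set xs = insert x S" "distinct xs"
    using finite_distinct_list[OF edgeD(3)[OF e]] by auto
  have len: "length xs = l + h" using edgeD(2)[OF e] xs distinct_card by fastforce
  have "ed (take h xs) (drop h xs) = set xs"
  proof -
    have "take l (drop h xs) = drop h xs" using len by simp
    then show ?thesis unfolding ed_def by (metis append_take_drop_id set_append)
  qed
  then have "good [take h xs, drop h xs]" using e xs by simp
  then have "path [take h xs, drop h xs]"
    using len xs(2) edgeD(1)[OF e] unfolding path_def by (simp flip: xs(1) set_append)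
  then show ?thesis by (intro exI[of _ "[take h xs, drop h xs]"]) simp
qed

definition chunks :: "'a list set" where
  "chunks = {t. length t = h \<and> distinct t \<and> set t \<subseteq> V}"

lemma chunks_finite: "finite chunks" and chunks_card: "card chunks \<le> card V ^ h"
proof -
  have *: "chunks \<subseteq> {t. set t \<subseteq> V \<and> length t = h}" by (auto simp: chunks_def)
  have f: "finite {t. set t \<subseteq> V \<and> length t = h}" using finV by (rule finite_lists_length_eq)
  show "finite chunks" using * f by (rule finite_subset)
  show "card chunks \<le> card V ^ h"
    using card_mono[OF f *] card_lists_length_eq[OF finV] by simp
qed

text \<open>Weighted double counting: each chunk is absorbed by at least \<alpha> * n^N of at most
  n^N absorbers, so some absorber catches a share \<alpha> of the total weight.\<close>

lemma absorber_exists: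
  fixes w :: "'a list \<Rightarrow> real"
  assumes L: "codegree_ge L D" and N: "N = l + h + h + h" and D: "real (N + h) \<le> D"
    and many: "\<alpha> * real (card V) ^ N \<le> (D - h - N) ^ N - 5 * (fillings * real (card V) ^ (l + h + h))"
    and \<alpha>: "0 < \<alpha>" and w: "\<And>t. 0 < w t" and ne: "chunks \<noteq> {}"
  obtains xs where "length xs = N" "set xs \<subseteq> L" "absorber xs"
    "\<alpha> * (\<Sum>t\<in>chunks. w t) \<le> (\<Sum>t\<in>{t\<in>chunks. absorbs xs t}. w t)"
proof -
  let ?n = "real (card V)"
  have LV: "L \<subseteq> V" using L by (simp add: codegree_ge_def)
  define \<Omega> where "\<Omega> = {xs. length xs = N \<and> set xs \<subseteq> L \<and> absorber xs}"
  have sub\<Omega>: "\<Omega> \<subseteq> {xs. set xs \<subseteq> V \<and> length xs = N}" using LV by (auto simp: \<Omega>_def)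
  have f: "finite {xs. set xs \<subseteq> V \<and> length xs = N}" using finV by (rule finite_lists_length_eq)
  have fin: "finite \<Omega>" using sub\<Omega> f by (rule finite_subset)
  have card\<Omega>: "real (card \<Omega>) \<le> ?n ^ N"
    using card_mono[OF f sub\<Omega>] card_lists_length_eq[OF finV, of N] by (simp flip: of_nat_power)
  have W: "0 < (\<Sum>t\<in>chunks. w t)" using chunks_finite ne w by (intro sum_pos) auto
  have n0: "0 < ?n"
  proof -
    obtain t where t: "length t = h" "set t \<subseteq> V" using ne by (auto simp: chunks_def)
    have "0 < h" using h g_pos by simp
    then have "t \<noteq> []" using t(1) by auto
    then have "V \<noteq> {}" using t(2) by (cases t) auto
    then show ?thesis using finV by (simp add: card_gt_0_iff)
  qed
  have per_t: "\<alpha> * ?n ^ N \<le> real (card {xs\<in>\<Omega>. absorbs xs t})" if t: "t \<in> chunks" for t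
  proof -
    \<comment> \<open>The vertices of \<open>t\<close> are removed first, since the absorbers
      counted for \<open>t\<close> have to avoid it; this is the loss of \<open>h\<close> in the
      codegree.\<close>
    have ct: "codegree_ge (L - set t) (D - h)"
      using t by (intro codegree_ge_Diff[OF L]) (auto simp: chunks_def distinct_card)
    have "\<alpha> * ?n ^ N \<le> (D - h - N) ^ N - 5 * (fillings * ?n ^ (l + h + h))" by (rule many)
    also have "\<dots> \<le> real (card {xs. length xs = N \<and> set xs \<subseteq> L - set t \<and> absorber xs \<and> absorbs xs t})"
      using t D by (intro card_absorbers_ge[OF ct N]) (auto simp: chunks_def)
    also have "\<dots> \<le> real (card {xs\<in>\<Omega>. absorbs xs t})"
      unfolding of_nat_le_iff
    proof (rule card_mono)
      show "finite {xs\<in>\<Omega>. absorbs xs t}" using fin by simp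
    qed (auto simp: \<Omega>_def)
    finally show ?thesis .
  qed
  have swap: "(\<Sum>xs\<in>\<Omega>. \<Sum>t\<in>{t\<in>chunks. absorbs xs t}. w t) = (\<Sum>t\<in>chunks. w t * real (card {xs\<in>\<Omega>. absorbs xs t}))"
  proof -
    have "(\<Sum>xs\<in>\<Omega>. \<Sum>t\<in>{t\<in>chunks. absorbs xs t}. w t) = (\<Sum>xs\<in>\<Omega>. \<Sum>t\<in>chunks. if absorbs xs t then w t else 0)"
      by (rule sum.cong[OF refl]) (rule sum.inter_filter[OF chunks_finite])
    also have "\<dots> = (\<Sum>t\<in>chunks. \<Sum>xs\<in>\<Omega>. if absorbs xs t then w t else 0)" by (rule sum.swap)
    also have "\<dots> = (\<Sum>t\<in>chunks. w t * real (card {xs\<in>\<Omega>. absorbs xs t}))"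
      by (intro sum.cong refl) (simp add: sum.inter_filter[OF fin, symmetric])
    finally show ?thesis .
  qed
  have lower: "(\<Sum>t\<in>chunks. w t) * (\<alpha> * ?n ^ N) \<le> (\<Sum>xs\<in>\<Omega>. \<Sum>t\<in>{t\<in>chunks. absorbs xs t}. w t)"
    unfolding swap sum_distrib_right using per_t w by (intro sum_mono mult_left_mono) (auto intro: less_imp_le)
  have "\<exists>xs\<in>\<Omega>. \<alpha> * (\<Sum>t\<in>chunks. w t) \<le> (\<Sum>t\<in>{t\<in>chunks. absorbs xs t}. w t)"
  proof (rule ccontr)
    assume "\<not> ?thesis"
    then have less: "(\<Sum>t\<in>{t\<in>chunks. absorbs xs t}. w t) < \<alpha> * (\<Sum>t\<in>chunks. w t)" if "xs \<in> \<Omega>" for xs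
      using that by (auto simp: not_le)
    have pos: "0 < (\<Sum>t\<in>chunks. w t) * (\<alpha> * ?n ^ N)" using W \<alpha> n0 by simp
    have "\<Omega> \<noteq> {}" using lower pos by auto
    then have "(\<Sum>xs\<in>\<Omega>. \<Sum>t\<in>{t\<in>chunks. absorbs xs t}. w t) < (\<Sum>xs\<in>\<Omega>. \<alpha> * (\<Sum>t\<in>chunks. w t))"
      using fin less by (intro sum_strict_mono) auto
    also have "\<dots> = real (card \<Omega>) * (\<alpha> * (\<Sum>t\<in>chunks. w t))" by simp
    also have "\<dots> \<le> ?n ^ N * (\<alpha> * (\<Sum>t\<in>chunks. w t))"
      using card\<Omega> W \<alpha> by (intro mult_right_mono) auto
    finally show False using lower by (simp add: mult_ac)
  qed
  then show thesis using that by (auto simp: \<Omega>_def)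
qed

lemma absorber_parts:
  assumes "length xs = l + h + h + h"
  shows "length (part_a xs) = h" "length (part_d xs) = h" "length (part_c xs) = h" "length (part_r xs) = l"
    "mset (part_a xs) + (mset (part_d xs) + (mset (part_c xs) + mset (part_r xs))) = mset xs"
proof -
  show "length (part_a xs) = h" "length (part_d xs) = h" "length (part_r xs) = l"
    unfolding part_a_def part_d_def part_r_def using assms h by auto
  show "length (part_c xs) = h" unfolding part_c_def using assms h by auto
  have "xs = take l xs @ take h (drop l xs) @ take g (drop h (drop l xs)) @
          take l (drop g (drop h (drop l xs))) @ drop l (drop g (drop h (drop l xs)))"
    by (simp only: append_take_drop_id)
  moreover have "drop l (drop g (drop h (drop l xs))) = part_a xs"
    unfolding drop_drop part_a_def by (rule arg_cong[where f = "\<lambda>i. drop i xs"]) (simp add: h)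
  moreover have "take l (drop g (drop h (drop l xs))) = part_r xs"
    unfolding drop_drop part_r_def by (simp add: add_ac)
  ultimately have "mset xs = mset (take l xs) + mset (part_d xs) + mset (take g (drop h (drop l xs))) +
      mset (part_r xs) + mset (part_a xs)"
    unfolding part_d_def by (metis mset_append add.assoc)
  then show "mset (part_a xs) + (mset (part_d xs) + (mset (part_c xs) + mset (part_r xs))) = mset xs"
    unfolding part_c_def drop_drop by (simp add: add_ac)
qed

lemma prepend_absorber:
  fixes w :: "'a list \<Rightarrow> real"
  assumes P: "path P" and L: "codegree_ge (V - verts P) D"
    and N: "N = l + h + h + h" and N': "N' = g + h + h" and D: "real (N + N' + h) \<le> D"
    and many: "\<alpha> * real (card V) ^ N \<le> (D - h - N) ^ N - 5 * (fillings * real (card V) ^ (l + h + h))"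
    and many': "4 * (fillings * real (card V) ^ (g + h)) < (D - N - N') ^ N'"
    and \<alpha>: "0 < \<alpha>" and w: "\<And>t. 0 < w t" and ne: "chunks \<noteq> {}"
  obtains q where "path (block q @ P)" "absorber (fst q)"
    "\<alpha> * (\<Sum>t\<in>chunks. w t) \<le> (\<Sum>t\<in>{t\<in>chunks. absorbs (fst q) t}. w t)"
proof -
  let ?L = "V - verts P"
  obtain x y zs where Pxy: "P = x # y # zs" and x: "length (take l x) = l" "distinct (take l x)"
    "set (take l x) \<subseteq> verts P" using path_head[OF P] .
  obtain xs where xs: "length xs = N" "set xs \<subseteq> ?L" "absorber xs"
    "\<alpha> * (\<Sum>t\<in>chunks. w t) \<le> (\<Sum>t\<in>{t\<in>chunks. absorbs xs t}. w t)"
    by (rule absorber_exists[where w = w, OF L N _ many \<alpha> w ne]) (use D in auto)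
  have lxs: "length xs = l + h + h + h" using xs(1) N by simp
  note parts = absorber_parts[OF lxs]
  have dxs: "distinct xs" using xs(3) by (simp add: absorber_def)
  have mdist: "distinct (part_a xs @ part_d xs @ part_c xs @ part_r xs)"
  proof -
    have "mset (part_a xs @ part_d xs @ part_c xs @ part_r xs) = mset xs" using parts(5) by simp
    then show ?thesis using dxs mset_eq_imp_distinct_iff by blast
  qed
  have mset_xs: "set (part_a xs @ part_d xs @ part_c xs @ part_r xs) = set xs"
    using parts(5) by (intro mset_eq_setD) simp
  have L': "codegree_ge (?L - set xs) (D - N)"
    using xs(1) dxs by (intro codegree_ge_Diff[OF L]) (auto simp: distinct_card)
  have r: "set (part_r xs) \<subseteq> set xs" using mset_xs by auto
  obtain B z1 z2 where B: "length B = g" "length z1 = h" "length z2 = h"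
    "distinct (B @ z1 @ z2)" "set (B @ z1 @ z2) \<subseteq> ?L - set xs"
    "ed (part_r xs @ B) z1 \<in> E" "ed z1 z2 \<in> E" "ed z2 (take l x) \<in> E"
    "\<phi> (ed (part_r xs @ B) z1) \<noteq> \<phi> (ed (part_c xs) (part_r xs))"
    "\<phi> (ed (part_r xs @ B) z1) \<noteq> \<phi> (ed z1 z2)"
    "\<phi> (ed z1 z2) \<noteq> \<phi> (ed z2 (take l x))" "\<phi> (ed z2 (take l x)) \<noteq> \<phi> (ed x y)"
  \<comment> \<open>The colours prescribed at the two ends belong to the last edge of the absorber
    and the first edge of \<open>P\<close>, between which the connection is inserted.\<close>
  proof (rule connect[OF L' N' _ many', of "part_r xs" "take l x" "\<phi> (ed (part_c xs) (part_r xs))" "\<phi> (ed x y)"])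
    show "real N' \<le> D - real N" using D by simp
    show "length (part_r xs) = l" by (rule parts(4))
    show "distinct (part_r xs)" using mdist by simp
    show "set (part_r xs) \<subseteq> V" using r xs(2) by auto
    show "set (part_r xs) \<inter> (?L - set xs) = {}" using r by auto
    show "set (take l x) \<subseteq> V" using x(3) P by (auto simp: path_def)
    show "set (take l x) \<inter> (?L - set xs) = {}" using x(3) by auto
  qed (use x in auto)
  have e: "ed (rotate1 (part_c xs)) (part_r xs @ B) = ed (part_c xs) (part_r xs)"
    "ed z2 (take l x) = ed z2 x" using parts(4) by (auto simp: ed_def)
  let ?q = "(xs, B, z1, z2)"
  have "good P" using P by (simp add: path_def)
  then have good: "good (block ?q @ P)"
    using xs(3) B(6-8,10,11) B(9)[symmetric] B(12) by (simp add: absorber_def e Pxy)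
  have cs: "verts (block ?q) = set xs \<union> set (B @ z1 @ z2)" using mset_xs by auto
  have "path (block ?q @ P)"
  proof (rule path_append[OF P good])
    have "length (part_r xs @ B) = h" using parts(4) B(1) h by (metis length_append)
    then show "\<forall>c\<in>set (block ?q). length c = h" using parts(1-3) B(2,3) by simp
    have "set xs \<inter> set (B @ z1 @ z2) = {}" using B(5) by auto
    then have "set (part_a xs @ part_d xs @ part_c xs @ part_r xs) \<inter> set (B @ z1 @ z2) = {}"
      unfolding mset_xs .
    then show "distinct (concat (block ?q))" using mdist B(4) by auto
    show "verts (block ?q) \<subseteq> V" unfolding cs using xs(2) B(5) by auto
    show "verts (block ?q) \<inter> verts P = {}" unfolding cs using xs(2) B(5) by auto
  qed
  then show thesis using that[of ?q] xs by simp
qed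

definition hits :: "('a list \<times> 'a list \<times> 'a list \<times> 'a list) list \<Rightarrow> 'a list \<Rightarrow> nat" where
  "hits qs t = length (filter (\<lambda>q. absorbs (fst q) t) qs)"

lemma length_block: "length (block q) = 6" by (cases q) simp

text \<open>A new absorber halves the weight of the chunks it absorbs, which carry a share \<alpha>
  of the total, so the total shrinks by the factor 1 - \<alpha> / 2. Once it is below 2^(-m), no
  single chunk can have fewer than m absorbers.\<close>

lemma absorbing_path:
  assumes V: "codegree_ge V D0" and D0: "D + real (6 * h * M + h + l) \<le> D0"
    and N: "N = l + h + h + h" and N': "N' = g + h + h" and D: "real (N + N' + h) \<le> D"
    and many: "\<alpha> * real (card V) ^ N \<le> (D - h - N) ^ N - 5 * (fillings * real (card V) ^ (l + h + h))"
    and many': "4 * (fillings * real (card V) ^ (g + h)) < (D - N - N') ^ N'"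
    and \<alpha>: "0 < \<alpha>"
    and P0: "path P0" "length P0 = 2"
  shows "\<exists>qs. length qs = M \<and> path (concat (map block qs) @ P0) \<and> (\<forall>q\<in>set qs. absorber (fst q)) \<and>
    (\<Sum>t\<in>chunks. (1 / 2) ^ hits qs t) \<le> real (card V) ^ h * (1 - \<alpha> / 2) ^ M"
  using D0
proof (induction M)
  case 0
  have "real (card chunks) \<le> real (card V) ^ h"
    using chunks_card by (simp flip: of_nat_power)
  then show ?case using P0 by (auto simp: hits_def)
next
  case (Suc M)
  have "D + real (6 * h * M + h + l) \<le> D0" using Suc.prems by simp
  then obtain qs where qs: "length qs = M" "path (concat (map block qs) @ P0)" "\<forall>q\<in>set qs. absorber (fst q)"
    "(\<Sum>t\<in>chunks. (1 / 2) ^ hits qs t) \<le> real (card V) ^ h * (1 - \<alpha> / 2) ^ M"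
    using Suc.IH by auto
  let ?P = "concat (map block qs) @ P0"
  have "length (concat (map block qs)) = 6 * M"
    using length_concat_uniform[of "map block qs" 6] qs(1) by (simp add: length_block)
  then have "length ?P = 6 * M + 2" using P0 by simp
  \<comment> \<open>Six chunks per block, plus the one full chunk and the final
    \<open>l\<close>-list of \<open>P0\<close>. The codegree lost to this many vertices is reserved
    in \<open>D0\<close>.\<close>
  then have len: "length (concat ?P) = (6 * M + 1) * h + l" using length_concat_path[OF qs(2)] by simp
  have "card (verts ?P) \<le> 6 * h * M + h + l"
    using card_length[of "concat ?P"] unfolding len by (simp add: algebra_simps del: concat_append set_concat)
  then have "real (card (verts ?P)) \<le> real (6 * h * M + h + l)" by (simp only: of_nat_le_iff)
  then have L: "codegree_ge (V - verts ?P) (D0 - real (6 * h * M + h + l))"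
    by (intro codegree_ge_Diff[OF V]) auto
  have L: "codegree_ge (V - verts ?P) D"
    by (rule codegree_ge_mono[OF L]) (use Suc.prems in simp)
  have ne: "chunks \<noteq> {}"
  proof -
    have "hd P0 \<in> chunks" using P0 by (cases P0; cases "tl P0") (auto simp: chunks_def path_def)
    then show ?thesis by blast
  qed
  obtain q where q: "path (block q @ ?P)" "absorber (fst q)"
    "\<alpha> * (\<Sum>t\<in>chunks. (1 / 2) ^ hits qs t) \<le> (\<Sum>t\<in>{t\<in>chunks. absorbs (fst q) t}. (1 / 2) ^ hits qs t)"
    by (rule prepend_absorber[where w = "\<lambda>t. (1 / 2) ^ hits qs t", OF qs(2) L N N' D many many' \<alpha> _ ne]) simp_all
  have "(\<Sum>t\<in>chunks. (1 / 2) ^ hits (q # qs) t) =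
    (\<Sum>t\<in>chunks. (1 / 2) ^ hits qs t - (if absorbs (fst q) t then (1 / 2) ^ hits qs t / 2 else 0 :: real))"
    by (intro sum.cong refl) (simp add: hits_def)
  also have "\<dots> = (\<Sum>t\<in>chunks. (1 / 2) ^ hits qs t) - (\<Sum>t\<in>{t\<in>chunks. absorbs (fst q) t}. (1 / 2) ^ hits qs t) / 2"
    by (simp add: sum_subtractf sum.inter_filter[OF chunks_finite, symmetric] sum_divide_distrib)
  also have "\<dots> \<le> (1 - \<alpha> / 2) * (\<Sum>t\<in>chunks. (1 / 2) ^ hits qs t)"
    using q(3) by (simp add: algebra_simps)
  finally have le: "(\<Sum>t\<in>chunks. (1 / 2) ^ hits (q # qs) t) \<le> (1 - \<alpha> / 2) * (\<Sum>t\<in>chunks. (1 / 2) ^ hits qs t)" .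
  have pos: "0 < (\<Sum>t\<in>chunks. (1 / 2 :: real) ^ hits qs t)"
    using chunks_finite ne by (intro sum_pos) auto
  have "0 \<le> (\<Sum>t\<in>chunks. (1 / 2 :: real) ^ hits (q # qs) t)" by (intro sum_nonneg) auto
  \<comment> \<open>The sign is read off from the inequality itself: a nonnegative sum is at most
    this factor times a positive one.\<close>
  with le pos have "0 \<le> 1 - \<alpha> / 2" by (smt (verit) mult_neg_pos)
  then have "(1 - \<alpha> / 2) * (\<Sum>t\<in>chunks. (1 / 2) ^ hits qs t) \<le> (1 - \<alpha> / 2) * (real (card V) ^ h * (1 - \<alpha> / 2) ^ M)"
    using qs(4) by (rule mult_left_mono[rotated])
  with le have "(\<Sum>t\<in>chunks. (1 / 2) ^ hits (q # qs) t) \<le> real (card V) ^ h * (1 - \<alpha> / 2) ^ Suc M"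
    by (simp add: mult_ac)
  then show ?case using q qs by (intro exI[of _ "q # qs"]) auto
qed

end

subsection \<open>Pairs of edges of small weight\<close>

lemma exists_lowest_subset:
  fixes y :: "'a \<Rightarrow> real"
  assumes "finite L" "a \<le> card L" "0 < a"
  shows "\<exists>A w. A \<subseteq> L \<and> card A = a \<and> (\<forall>x\<in>A. y x \<le> w) \<and> (\<forall>v\<in>L - A. w \<le> y v) \<and> w \<in> y ` A"
  using assms(2,3)
proof (induction a)
  case (Suc a)
  \<comment> \<open>The induction runs on the separation alone; for an empty \<open>A\<close> the
    threshold is the minimum over \<open>L\<close>, which need not be a value on \<open>A\<close>.
    Adding a minimal outside vertex makes the new threshold a value on the new set.\<close>
  have "\<exists>A w. A \<subseteq> L \<and> card A = a \<and> (\<forall>x\<in>A. y x \<le> w) \<and> (\<forall>v\<in>L - A. w \<le> y v)"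
  proof (cases "a = 0")
    case True
    show ?thesis
    proof (cases "L = {}")
      case False
      then show ?thesis using True assms(1)
        by (intro exI[of _ "{}"] exI[of _ "Min (y ` L)"]) auto
    qed (use True in auto)
  qed (use Suc in auto)
  then obtain A w where A: "A \<subseteq> L" "card A = a" "\<forall>x\<in>A. y x \<le> w" "\<forall>v\<in>L - A. w \<le> y v" by blast
  have fA: "finite A" using A(1) assms(1) finite_subset by blast
  have ne: "L - A \<noteq> {}" using Suc.prems(1) A(2) card_mono[OF fA, of L] by auto
  obtain u where u: "u \<in> L - A" "\<forall>v\<in>L - A. y u \<le> y v"
  proof -
    have "Min (y ` (L - A)) \<in> y ` (L - A)" using ne assms(1) by (intro Min_in) auto
    then obtain u where "u \<in> L - A" "y u = Min (y ` (L - A))" by auto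
    then show thesis using that[of u] assms(1) by auto
  qed
  have "w \<le> y u" using A(4) u(1) by blast
  then have "\<forall>x\<in>insert u A. y x \<le> y u" using A(3) by force
  then show ?case using A(1,2) u fA by (intro exI[of _ "insert u A"] exI[of _ "y u"]) auto
qed simp

lemma sum_list_le_length:
  fixes y :: "'a \<Rightarrow> real"
  shows "(\<And>x. x \<in> set xs \<Longrightarrow> y x \<le> w) \<Longrightarrow> sum_list (map y xs) \<le> real (length xs) * w"
  by (induction xs) (force simp: algebra_simps)+

text \<open>\<open>T\<close> is chosen such that one vertex of weight \<open>T\<close> and \<open>2 * h - 1\<close> vertices of weight \<open>w\<close> exceed the
  average weight of \<open>2 * h\<close> vertices by a factor \<open>1 + \<epsilon>\<close>.\<close>

lemma light_neighbours:
  fixes y :: "'a \<Rightarrow> real" and h :: nat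
  assumes L: "finite L" and y: "\<And>v. 0 \<le> y v" and Y: "sum y L = \<mu> * real (card L)" and \<mu>: "0 < \<mu>"
    and h: "0 < h" and U: "U \<subseteq> L" "(1 / (2 * real h) + \<gamma>) * real (card L) \<le> real (card U)"
    and A: "A \<subseteq> L" "real (card A) \<le> \<delta> * real (card L)" "\<And>v. v \<in> L - A \<Longrightarrow> w \<le> y v" and w: "0 \<le> w"
    and \<delta>: "0 \<le> \<delta>" "2 * \<delta> < \<epsilon>" "\<epsilon> \<le> 1" and N: "0 < card L"
    and T: "T + (2 * real h - 1) * w = 2 * real h * \<mu> * (1 + \<epsilon>)"
  shows "\<gamma> * real (card L) \<le> real (card {u\<in>U. y u \<le> T})" and "w \<le> 2 * \<mu>"
proof -
  let ?N = "real (card L)" and ?H = "{u\<in>U. T < y u}"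
  have fU: "finite U" using U(1) L finite_subset by blast
  have fA: "finite A" using A(1) L finite_subset by blast
  have N0: "0 < ?N" using N by simp
  \<comment> \<open>At least (1 - \<delta>) * |L| vertices lie outside \<open>A\<close> and weigh at
    least \<open>w\<close> each, while all of \<open>L\<close> weighs \<mu> * |L|.\<close>
  have wle: "(1 - \<delta>) * w \<le> \<mu>"
  proof -
    have "(1 - \<delta>) * ?N * w \<le> real (card (L - A)) * w"
    proof (rule mult_right_mono[OF _ w])
      have "real (card (L - A)) = ?N - real (card A)"
        using card_Diff_subset[OF fA A(1)] card_mono[OF L A(1)] by (simp add: of_nat_diff)
      then show "(1 - \<delta>) * ?N \<le> real (card (L - A))" using A(2) by (simp add: algebra_simps)
    qed
    also have "\<dots> \<le> sum y (L - A)" using sum_bounded_below[of "L - A" w y] A(3) by simp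
    also have "\<dots> \<le> sum y L" using L y by (intro sum_mono2) auto
    finally have "((1 - \<delta>) * w) * ?N \<le> \<mu> * ?N" by (simp add: Y mult_ac)
    then show ?thesis using N0 by simp
  qed
  have w2: "w \<le> 2 * \<mu>"
  proof -
    have "(1 / 2) * w \<le> (1 - \<delta>) * w" using \<delta> w by (intro mult_right_mono) auto
    then show ?thesis using wle by simp
  qed
  then show "w \<le> 2 * \<mu>" .
  have \<delta>e: "1 < (1 - \<delta>) * (1 + \<epsilon>)"
  proof -
    have "\<delta> * \<epsilon> \<le> \<delta> * 1" using \<delta> by (intro mult_left_mono) auto
    then show ?thesis using \<delta> by (simp add: algebra_simps)
  qed
  have Tw: "w \<le> T"
  proof (rule ccontr)
    assume "\<not> ?thesis"
    then have "2 * real h * \<mu> * (1 + \<epsilon>) < 2 * real h * w" using T by (simp add: algebra_simps)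
    then have "2 * real h * (\<mu> * (1 + \<epsilon>)) < 2 * real h * w" by (simp add: mult_ac)
    then have "\<mu> * (1 + \<epsilon>) < w" using h by simp
    then have "(1 - \<delta>) * (\<mu> * (1 + \<epsilon>)) < (1 - \<delta>) * w" using \<delta> by (intro mult_strict_left_mono) auto
    moreover have "\<mu> * 1 < \<mu> * ((1 - \<delta>) * (1 + \<epsilon>))" using \<mu> \<delta>e by (intro mult_strict_left_mono)
    ultimately show False using wle by (simp add: mult_ac)
  qed
  \<comment> \<open>The density \<open>1 / (2 * h)\<close> enters here. If that many vertices
    weighed more than \<open>T\<close>, then together with weight \<open>w\<close> on the rest
    outside \<open>A\<close> the total, scaled by 2 * h / |L|, would be at least T + (2 * h - 1) * w
    - 2 * h * \<delta> * w, which exceeds 2 * h * \<mu> because \<delta> * w \<le> 2 * \<delta> *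
    \<mu> < \<epsilon> * \<mu>.\<close>
  have H: "real (card ?H) < 1 / (2 * real h) * ?N"
  proof (rule ccontr)
    assume "\<not> ?thesis"
    then have H: "?N \<le> 2 * real h * real (card ?H)" using h by (simp add: field_simps)
    have "real (card ?H) * T + real (card (L - A - ?H)) * w \<le> sum y ?H + sum y (L - A - ?H)"
      using sum_bounded_below[of ?H T y] sum_bounded_below[of "L - A - ?H" w y] A(3)
      by (intro add_mono) auto
    also have "\<dots> = sum y (?H \<union> (L - A - ?H))" using fU L by (subst sum.union_disjoint) auto
    also have "\<dots> \<le> sum y L" using L y U by (intro sum_mono2) auto
    finally have 1: "real (card ?H) * T + real (card (L - A - ?H)) * w \<le> \<mu> * ?N" by (simp add: Y)
    have "card L \<le> card ((L - A - ?H) \<union> (A \<union> ?H))" using L fA fU by (intro card_mono) auto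
    also have "\<dots> \<le> card (L - A - ?H) + (card A + card ?H)"
      by (rule order_trans[OF card_Un_le add_left_mono[OF card_Un_le]])
    finally have "(1 - \<delta>) * ?N - real (card ?H) \<le> real (card (L - A - ?H))"
      using A(2) by (simp add: algebra_simps)
    from mult_right_mono[OF this w] 1
    have "real (card ?H) * (T - w) + (1 - \<delta>) * ?N * w \<le> \<mu> * ?N" by (simp add: algebra_simps)
    then have "2 * real h * real (card ?H) * (T - w) + 2 * real h * ((1 - \<delta>) * ?N * w) \<le> 2 * real h * (\<mu> * ?N)"
      using h by (simp add: mult.assoc flip: distrib_left)
    moreover have "?N * (T - w) \<le> 2 * real h * real (card ?H) * (T - w)"
      using H Tw by (intro mult_right_mono) auto
    ultimately have "?N * (T - w) + 2 * real h * ((1 - \<delta>) * ?N * w) \<le> 2 * real h * (\<mu> * ?N)" by linarith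
    then have "?N * ((T - w) + 2 * real h * ((1 - \<delta>) * w)) \<le> ?N * (2 * real h * \<mu>)"
      by (simp add: algebra_simps)
    then have "(T - w) + 2 * real h * ((1 - \<delta>) * w) \<le> 2 * real h * \<mu>" using N0 by simp
    moreover have "(T - w) + 2 * real h * ((1 - \<delta>) * w) = 2 * real h * \<mu> * (1 + \<epsilon>) - 2 * real h * (\<delta> * w)"
      using T by (simp add: algebra_simps)
    ultimately have "2 * real h * (\<mu> * \<epsilon>) \<le> 2 * real h * (\<delta> * w)" by (simp add: algebra_simps)
    then have 2: "\<mu> * \<epsilon> \<le> \<delta> * w" using h by simp
    have "\<delta> * w \<le> \<delta> * (2 * \<mu>)" using w2 \<delta> by (intro mult_left_mono) auto
    also have "\<dots> < \<epsilon> * \<mu>" using \<delta> \<mu> by simp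
    finally show False using 2 by (simp add: mult.commute)
  qed
  have "card U \<le> card ({u\<in>U. y u \<le> T} \<union> ?H)" using fU by (intro card_mono) auto
  also have "\<dots> \<le> card {u\<in>U. y u \<le> T} + card ?H" by (rule card_Un_le)
  finally show "\<gamma> * real (card L) \<le> real (card {u\<in>U. y u \<le> T})" using U(2) H by (simp add: algebra_simps)
qed

text \<open>Union bound over the \<open>h\<close> positions at which the list may meet
  \<open>U\<close>.\<close>

lemma card_lists_meeting_le:
  assumes "finite V" "U \<subseteq> V" "0 < h"
  shows "real (card {m. length m = h \<and> set m \<subseteq> V \<and> set m \<inter> U \<noteq> {}})
    \<le> real h * real (card U) * real (card V) ^ (h - 1)"
proof -
  let ?B = "\<lambda>i. {xs. length xs = i + 1 + (h - 1 - i) \<and> set xs \<subseteq> V \<and>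
      (\<lambda>u m w. set m \<subseteq> U) (take i xs) (take 1 (drop i xs)) (drop (i + 1) xs)}"
  have fU: "finite U" using assms finite_subset by blast
  have fin: "finite (?B i)" for i
    by (rule finite_subset[OF _ finite_lists_length_eq[OF assms(1), of "i + 1 + (h - 1 - i)"]]) auto
  have B: "real (card (?B i)) \<le> real (card U) * real (card V) ^ (h - 1)" if "i < h" for i
  proof -
    have "real (card {m. length m = 1 \<and> set m \<subseteq> V \<and> set m \<subseteq> U}) \<le> real (card U)"
    proof -
      have "card {m. length m = 1 \<and> set m \<subseteq> V \<and> set m \<subseteq> U} \<le> card ((\<lambda>x. [x]) ` U)"
        using fU by (intro card_mono) (auto simp: length_Suc_conv)
      also have "\<dots> \<le> card U" using fU by (rule card_image_le)
      finally show ?thesis by simp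
    qed
    from card_lists_middle_le[OF assms(1), where P = "\<lambda>u m w. set m \<subseteq> U" and a = i and b = "h - 1 - i" and h = 1, OF this]
    have "real (card (?B i)) \<le> real (card U) * real (card V) ^ (i + (h - 1 - i))" .
    then show ?thesis using that by simp
  qed
  have "{m. length m = h \<and> set m \<subseteq> V \<and> set m \<inter> U \<noteq> {}} \<subseteq> (\<Union>i<h. ?B i)"
  proof
    fix m assume "m \<in> {m. length m = h \<and> set m \<subseteq> V \<and> set m \<inter> U \<noteq> {}}"
    then have m: "length m = h" "set m \<subseteq> V" "set m \<inter> U \<noteq> {}" by auto
    then obtain i where i: "i < h" "m ! i \<in> U" by (auto simp: in_set_conv_nth)
    then have "take 1 (drop i m) = [m ! i]" using m(1) by (simp add: take_Suc hd_drop_conv_nth)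
    then have "m \<in> ?B i" using m i by simp
    then show "m \<in> (\<Union>i<h. ?B i)" using i by blast
  qed
  then have "card {m. length m = h \<and> set m \<subseteq> V \<and> set m \<inter> U \<noteq> {}} \<le> card (\<Union>i<h. ?B i)"
  proof (rule card_mono[rotated])
    show "finite (\<Union>i<h. ?B i)" by (rule finite_UN_I) (simp, rule fin)
  qed
  also have "\<dots> \<le> (\<Sum>i<h. card (?B i))" by (rule card_UN_le) simp
  also have "real \<dots> \<le> (\<Sum>i<h. real (card U) * real (card V) ^ (h - 1))"
    unfolding of_nat_sum using B by (intro sum_mono) auto
  finally show ?thesis by simp
qed

section \<open>Walks along pairs of edges and the extension of a path by boundedly many
  chunks\<close>

context coloured_graph begin

lemma prepend_chunk:
  assumes P: "path P" and d: "length d = h" "distinct d" "set d \<subseteq> V" "set d \<inter> verts P = {}"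
    and e: "ed d (hd P) \<in> E" "\<phi> (ed d (hd P)) \<noteq> \<phi> (ed (hd P) (hd (tl P)))"
  shows "path (d # P)"
proof -
  obtain x y zs where Pxy: "P = x # y # zs" by (rule path_head[OF P])
  have "good P" using P by (simp add: path_def)
  then have "good ([d] @ P)" using e by (simp add: Pxy)
  then show ?thesis using path_append[OF P, of "[d]"] d by simp
qed

text \<open>\<open>G\<close> consists of edges with an ordering; \<open>take l\<close> and
  \<open>drop h\<close> are their two ends, both of length \<open>l\<close>. The condition is a
  minimum degree in the bipartite graph that joins the two ends of every ordered edge.\<close>

definition fans :: "'a set \<Rightarrow> 'a list set \<Rightarrow> real \<Rightarrow> bool" where
  "fans L G \<theta> \<longleftrightarrow> (\<forall>f\<in>G. length f = l + h \<and> set f \<subseteq> L \<and> set f \<in> E \<and>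
    \<theta> \<le> real (card {f'\<in>G. take l f' = take l f}) \<and> \<theta> \<le> real (card {f'\<in>G. drop h f' = drop h f}))"

lemma fansD:
  assumes "fans L G \<theta>" "f \<in> G"
  shows "length f = l + h" "set f \<subseteq> L" "set f \<in> E" "distinct f"
proof -
  show 1: "length f = l + h" "set f \<subseteq> L" "set f \<in> E" using assms by (auto simp: fans_def)
  show "distinct f" using edgeD(2)[OF 1(3)] 1(1) by (metis card_distinct)
qed

text \<open>\<open>p\<close> stands for one of the two ends and \<open>m\<close> for the remaining
  \<open>h\<close> entries, so that both directions of the walk are covered. Among the \<theta>
  edges with the given end, few have colour \<open>j\<close> and few meet \<open>U\<close>.\<close>

lemma choose_fan_edge:
  assumes G: "fans L G \<theta>" and L: "L \<subseteq> V" and f0: "f0 \<in> G" and U: "U \<subseteq> V"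
    and \<theta>: "\<theta> \<le> real (card {f\<in>G. p f = p f0})"
      "fillings + real h * real (card U) * real (card V) ^ (h - 1) < \<theta>"
    and split: "\<And>f. set f = set (p f) \<union> set (m f)" "\<And>f f'. p f = p f' \<Longrightarrow> m f = m f' \<Longrightarrow> f = f'"
    and len: "\<And>f. f \<in> G \<Longrightarrow> length (m f) = h" "card (set (p f0)) = l"
  shows "\<exists>f\<in>G. p f = p f0 \<and> set (m f) \<inter> U = {} \<and> \<phi> (set f) \<noteq> j"
proof (rule ccontr)
  let ?F = "{f\<in>G. p f = p f0}" and ?S = "set (p f0)"
  let ?X = "{m. length m = h \<and> set m \<subseteq> V \<and> ?S \<union> set m \<in> E \<and> \<phi> (?S \<union> set m) = j}"
  let ?Y = "{m. length m = h \<and> set m \<subseteq> V \<and> set m \<inter> U \<noteq> {}}"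
  assume neg: "\<not> ?thesis"
  have S: "?S \<subseteq> V" using fansD(2)[OF G f0] split(1)[of f0] L by auto
  have fin: "finite {xs. length xs = h \<and> set xs \<subseteq> V \<and> P xs}" for P
    by (rule finite_subset[OF _ finite_lists_length_eq[OF finV, of h]]) auto
  have "m ` ?F \<subseteq> ?X \<union> ?Y"
  proof (rule image_subsetI)
    fix f assume f: "f \<in> ?F"
    then have sf: "set f = ?S \<union> set (m f)" using split(1)[of f] by simp
    have "set (m f) \<inter> U \<noteq> {} \<or> \<phi> (set f) = j" using neg f by blast
    then show "m f \<in> ?X \<union> ?Y"
      using f sf len(1)[of f] fansD(2,3)[OF G, of f] L by auto
  qed
  then have "card (m ` ?F) \<le> card (?X \<union> ?Y)" using fin by (intro card_mono) auto
  also have "\<dots> \<le> card ?X + card ?Y" by (rule card_Un_le)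
  also have "card (m ` ?F) = card ?F"
  proof (rule card_image, rule inj_onI)
    fix f f' assume "f \<in> ?F" "f' \<in> ?F" and e: "m f = m f'"
    then have "p f = p f'" by simp
    then show "f = f'" using e by (rule split(2))
  qed
  finally have "real (card ?F) \<le> real (card ?X) + real (card ?Y)" by simp
  also have "\<dots> \<le> fillings + real h * real (card U) * real (card V) ^ (h - 1)"
  proof (intro add_mono card_fillings_le[OF S len(2)] card_lists_meeting_le[OF finV U])
    show "0 < h" using h g_pos by simp
  qed
  finally show False using \<theta> by linarith
qed

text \<open>The edge \<open>f\<close> is entered at its end \<open>take l\<close> and left at
  \<open>drop h\<close>; \<open>f'\<close> is traversed the other way. The pair therefore shares the
  end containing the last vertex, the only one that may lie outside the light set, and the new head
  again starts with the \<open>take l\<close> end of a member of \<open>G\<close>.\<close>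

lemma walk_pair:
  assumes G: "fans L G \<theta>" and L: "L \<subseteq> V" and P: "path (bs @ P)" "verts P \<inter> L = {}" "verts bs \<subseteq> L"
    and \<theta>: "\<theta> > fillings + real h * real (h * (length bs + 1)) * real (card V) ^ (h - 1)"
    and lb: "\<forall>d\<in>set bs. length d = h" and ne: "bs \<noteq> []"
    and f0: "f0 \<in> G" "take l (hd bs) = take l f0"
  shows "\<exists>f f'. f \<in> G \<and> f' \<in> G \<and> path ((take h f' # (drop h f @ take g (drop l f)) # bs) @ P)"
proof -
  note Gf = fansD[OF G]
  obtain b bs' where bs: "bs = b # bs'" using ne by (cases bs) auto
  have used: "card (verts bs) \<le> h * length bs"
    using card_length[of "concat bs"] length_concat_uniform[OF lb] by (simp add: mult.commute del: set_concat)
  have mono: "real h * real u * real (card V) ^ (h - 1) \<le> real h * real v * real (card V) ^ (h - 1)"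
    if "u \<le> v" for u v :: nat
    using that by (intro mult_mono) auto
  let ?U = "verts bs" and ?j = "\<phi> (ed (hd (bs @ P)) (hd (tl (bs @ P))))"
  have UV: "?U \<subseteq> V" using P(3) L by auto
  have \<theta>1: "fillings + real h * real (card ?U) * real (card V) ^ (h - 1) < \<theta>"
  proof -
    have "card ?U \<le> h * (length bs + 1)" using used by (simp add: distrib_left del: set_concat)
    then show ?thesis using mono[of "card ?U" "h * (length bs + 1)"] \<theta> by linarith
  qed
  have "\<exists>f\<in>G. take l f = take l f0 \<and> set (drop l f) \<inter> ?U = {} \<and> \<phi> (set f) \<noteq> ?j"
  proof (rule choose_fan_edge[OF G L f0(1) UV _ \<theta>1])
    show "\<theta> \<le> real (card {f\<in>G. take l f = take l f0})" using G f0 by (auto simp: fans_def)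
    show "set f = set (take l f) \<union> set (drop l f)" for f :: "'a list"
      by (metis append_take_drop_id set_append)
    show "f = f'" if "take l f = take l f'" "drop l f = drop l f'" for f f' :: "'a list"
      using that by (metis append_take_drop_id)
    show "length (drop l f) = h" if "f \<in> G" for f using Gf(1)[OF that] by simp
    show "card (set (take l f0)) = l" using Gf(1,4)[OF f0(1)] by (simp add: distinct_card)
  qed
  then obtain f where f: "f \<in> G" "take l f = take l f0" "set (drop l f) \<inter> ?U = {}" "\<phi> (set f) \<noteq> ?j" by auto
  \<comment> \<open>The new vertices of \<open>f\<close> are listed with the end
    \<open>drop h f\<close> in front, because the next edge to the left uses the first
    \<open>l\<close> vertices of this chunk.\<close>
  define d where "d = drop h f @ take g (drop l f)"
  have dl: "drop l f = take g (drop l f) @ drop h f"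
  proof -
    have "drop l f = take g (drop l f) @ drop g (drop l f)" by (rule append_take_drop_id[symmetric])
    also have "drop g (drop l f) = drop h f" unfolding drop_drop by (rule arg_cong[where f = "\<lambda>i. drop i f"]) (simp add: h)
    finally show ?thesis .
  qed
  have set_d: "set d = set (drop l f)" by (subst dl) (auto simp: d_def)
  have ms: "mset d = mset (drop l f)" by (subst dl) (simp add: d_def)
  have len_d: "length d = h" using mset_eq_length[OF ms] Gf(1)[OF f(1)] by simp
  have dist_d: "distinct d" using Gf(4)[OF f(1)] ms by (metis distinct_drop mset_eq_imp_distinct_iff)
  have d_sub: "set d \<subseteq> L" unfolding set_d using Gf(2)[OF f(1)] set_drop_subset[of l f] by blast
  have "set f = set (drop l f) \<union> set (take l f)" by (metis Un_commute append_take_drop_id set_append)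
  then have ed_d: "ed d (hd (bs @ P)) = set f" using f0(2) f(2) by (simp add: ed_def bs set_d)
  have path_d: "path (d # bs @ P)"
    using f(3,4) P(2) d_sub L Gf(3)[OF f(1)]
    by (intro prepend_chunk[OF P(1) len_d dist_d]) (auto simp: ed_d set_d)
  let ?U' = "verts (d # bs)"
  have UV': "?U' \<subseteq> V" using UV d_sub L by auto
  have \<theta>2: "fillings + real h * real (card ?U') * real (card V) ^ (h - 1) < \<theta>"
  proof -
    have "card ?U' \<le> length (concat (d # bs))" by (rule card_length)
    also have "\<dots> = h * (length bs + 1)" using length_concat_uniform[OF lb] len_d by (simp add: algebra_simps)
    finally show ?thesis using mono[of "card ?U'" "h * (length bs + 1)"] \<theta> by linarith
  qed
  have "\<exists>f'\<in>G. drop h f' = drop h f \<and> set (take h f') \<inter> ?U' = {} \<and> \<phi> (set f') \<noteq> \<phi> (ed d (hd (bs @ P)))"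
  proof (rule choose_fan_edge[OF G L f(1) UV' _ \<theta>2])
    show "\<theta> \<le> real (card {f'\<in>G. drop h f' = drop h f})" using G f by (auto simp: fans_def)
    show "set f = set (drop h f) \<union> set (take h f)" for f :: "'a list"
      by (metis Un_commute append_take_drop_id set_append)
    show "f = f'" if "drop h f = drop h f'" "take h f = take h f'" for f f' :: "'a list"
      using that by (metis append_take_drop_id)
    show "length (take h f) = h" if "f \<in> G" for f using Gf(1)[OF that] by simp
    show "card (set (drop h f)) = l" using Gf(1,4)[OF f(1)] by (simp add: distinct_card)
  qed
  then obtain f' where f': "f' \<in> G" "drop h f' = drop h f" "set (take h f') \<inter> ?U' = {}"
    "\<phi> (set f') \<noteq> \<phi> (ed d (hd (bs @ P)))" by auto
  have "take l d = drop h f" unfolding d_def using Gf(1)[OF f(1)] by simp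
  moreover have "set f' = set (take h f') \<union> set (drop h f')" by (metis append_take_drop_id set_append)
  ultimately have "ed (take h f') (hd (d # bs @ P)) = set f'" using f'(2) by (simp add: ed_def)
  moreover have "set (take h f') \<subseteq> L" using Gf(2)[OF f'(1)] set_take_subset[of h f'] by blast
  ultimately have "path (take h f' # d # bs @ P)"
    using f'(3,4) P(2) L Gf(1,3,4)[OF f'(1)]
    by (intro prepend_chunk[OF path_d]) auto
  then show ?thesis using f(1) f'(1) by (auto simp: d_def)
qed


text \<open>Since \<open>P\<close> avoids \<open>L\<close>, only the chunks placed inside
  \<open>L\<close> have to be avoided. The demand on \<theta> thus depends on the bounded
  \<open>length bs + 2 * t\<close> and not on the length of the path.\<close>

lemma walk_pairs:
  fixes y :: "'a \<Rightarrow> real"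
  assumes G: "fans L G \<theta>" and L: "L \<subseteq> V" and P: "path (bs @ P)" "verts P \<inter> L = {}" "verts bs \<subseteq> L"
    and \<theta>: "\<theta> > fillings + real h * real (h * (length bs + 2 * t)) * real (card V) ^ (h - 1)"
    and lb: "\<forall>d\<in>set bs. length d = h" and ne: "bs \<noteq> []"
    and f0: "f0 \<in> G" "take l (hd bs) = take l f0"
    and W: "\<And>f f'. f \<in> G \<Longrightarrow> f' \<in> G \<Longrightarrow> sum_list (map y (drop l f)) + sum_list (map y (take h f')) \<le> W"
  shows "\<exists>bs'. path ((bs' @ bs) @ P) \<and> length bs' = 2 * t \<and> (\<forall>d\<in>set bs'. length d = h) \<and>
    verts bs' \<subseteq> L \<and> sum_list (map y (concat bs')) \<le> real t * W \<and>
    (\<exists>f\<in>G. take l (hd (bs' @ bs)) = take l f)"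
  using \<theta>
proof (induction t)
  case 0
  show ?case using P f0 by (intro exI[of _ "[]"]) auto
next
  case (Suc t)
  have mono: "real h * real (h * u) * real (card V) ^ (h - 1) \<le> real h * real (h * v) * real (card V) ^ (h - 1)"
    if "u \<le> v" for u v :: nat
  proof -
    have "real (h * u) \<le> real (h * v)" using that by (simp only: of_nat_le_iff mult_le_mono2)
    then show ?thesis by (intro mult_right_mono mult_left_mono) auto
  qed
  have "fillings + real h * real (h * (length bs + 2 * t)) * real (card V) ^ (h - 1) < \<theta>"
  proof -
    have "length bs + 2 * t \<le> length bs + 2 * Suc t" by simp
    from mono[OF this] show ?thesis using Suc.prems by linarith
  qed
  then obtain bs' f where bs': "path ((bs' @ bs) @ P)" "length bs' = 2 * t" "\<forall>d\<in>set bs'. length d = h"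
    "verts bs' \<subseteq> L" "sum_list (map y (concat bs')) \<le> real t * W" "f \<in> G" "take l (hd (bs' @ bs)) = take l f"
    using Suc.IH by blast
  have \<theta>': "fillings + real h * real (h * (length (bs' @ bs) + 1)) * real (card V) ^ (h - 1) < \<theta>"
  proof -
    have "length (bs' @ bs) + 1 \<le> length bs + 2 * Suc t" using bs'(2) by simp
    from mono[OF this] show ?thesis using Suc.prems by linarith
  qed
  have lb': "\<forall>d\<in>set (bs' @ bs). length d = h" "verts (bs' @ bs) \<subseteq> L" "bs' @ bs \<noteq> []"
    using bs'(3,4) lb P(3) ne by auto
  obtain f1 f2 where f: "f1 \<in> G" "f2 \<in> G"
    "path ((take h f2 # (drop h f1 @ take g (drop l f1)) # (bs' @ bs)) @ P)"
    using walk_pair[OF G L bs'(1) P(2) lb'(2) \<theta>' lb'(1,3) bs'(6,7)] by blast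
  let ?d = "drop h f1 @ take g (drop l f1)"
  note Gf = fansD[OF G]
  have "drop l f1 = take g (drop l f1) @ drop h f1"
  proof -
    have "drop l f1 = take g (drop l f1) @ drop g (drop l f1)" by (rule append_take_drop_id[symmetric])
    also have "drop g (drop l f1) = drop h f1" unfolding drop_drop
      by (rule arg_cong[where f = "\<lambda>i. drop i f1"]) (simp add: h)
    finally show ?thesis .
  qed
  then have ms: "mset ?d = mset (drop l f1)" by (metis mset_append union_commute)
  have sub: "set ?d \<subseteq> L" "set (take h f2) \<subseteq> L"
    using Gf(2)[OF f(1)] set_drop_subset[of l f1] mset_eq_setD[OF ms]
      Gf(2)[OF f(2)] set_take_subset[of h f2] by blast+
  have len: "length ?d = h" "length (take h f2) = h"
    using mset_eq_length[OF ms] Gf(1)[OF f(1)] Gf(1)[OF f(2)] by simp_all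
  let ?bs = "take h f2 # ?d # bs'"
  show ?case
  proof (intro exI[of _ ?bs] conjI)
    show "path ((?bs @ bs) @ P)" using f(3) by simp
    show "length ?bs = 2 * Suc t" using bs'(2) by simp
    show "\<forall>d\<in>set ?bs. length d = h" using bs'(3) len by auto
    show "verts ?bs \<subseteq> L"
      unfolding concat.simps set_append[of "take h f2"] set_append[of ?d] using sub bs'(4) by blast
    have "sum_list (map y ?d) = sum_list (map y (drop l f1))"
      using ms by (metis mset_map sum_mset_sum_list)
    moreover have "sum_list (map y (concat ?bs)) =
        sum_list (map y (take h f2)) + (sum_list (map y ?d) + sum_list (map y (concat bs')))"
      by (simp only: concat.simps map_append sum_list_append)
    moreover have "real (Suc t) * W = W + real t * W" by (simp add: distrib_right)
    ultimately show "sum_list (map y (concat ?bs)) \<le> real (Suc t) * W"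
      using bs'(5) W[OF f(1,2)] by linarith
    have "take l (take h f2) = take l f2" using h by simp
    then show "\<exists>f\<in>G. take l (hd (?bs @ bs)) = take l f" using f(2) by auto
  qed
qed

lemma card_distinct_lists_ge:
  assumes "finite A" "m \<le> card A"
  shows "(real (card A) - real m) ^ m \<le> real (card {p. length p = m \<and> set p \<subseteq> A \<and> distinct p})"
proof (rule card_lists_sequential_choice[OF assms(1)])
  fix p :: "'b list" assume p: "length p < m" "set p \<subseteq> A" "distinct p"
  have "{x\<in>A. distinct (p @ [x])} = A - set p" using p by auto
  moreover have "card (A - set p) = card A - length p"
    using p assms(1) by (simp add: card_Diff_subset distinct_card)
  ultimately show "real (card A) - real m \<le> real (card {x\<in>A. distinct (p @ [x])})"
    using p assms(2) by simp
qed (use assms in auto)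

text \<open>The family consists of ordered (k - 1)-subsets of \<open>A\<close> followed by a light
  neighbour. Each of its two end maps has at most |L|^l values, so
  \<open>large_fibres_subset\<close> applies once the family has more than 2 * \<theta> * |L|^l
  members.\<close>

lemma exists_fans:
  fixes y :: "'a \<Rightarrow> real"
  assumes L: "L \<subseteq> V" and A: "A \<subseteq> L" "l + h \<le> card A" and \<psi>: "0 \<le> \<psi>"
    "\<And>S. S \<subseteq> A \<Longrightarrow> card S = l + h - 1 \<Longrightarrow> \<psi> \<le> real (card {u\<in>L. insert u S \<in> E \<and> y u \<le> T})"
    and \<theta>: "0 \<le> \<theta>" "2 * \<theta> * real (card L) ^ l < (real (card A) - real (l + h)) ^ (l + h - 1) * \<psi>"
  shows "\<exists>G. G \<noteq> {} \<and> fans L G \<theta> \<and> (\<forall>f\<in>G. set (butlast f) \<subseteq> A \<and> y (last f) \<le> T)"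
proof -
  let ?m = "l + h - 1"
  have fL: "finite L" using L finV finite_subset by blast
  have fA: "finite A" using A(1) fL finite_subset by blast
  define R where "R = {p. length p = ?m \<and> set p \<subseteq> A \<and> distinct p}"
  define X where "X = (\<lambda>p. {u\<in>L. insert u (set p) \<in> E \<and> y u \<le> T})"
  define F where "F = (\<lambda>(p, u). p @ [u]) ` (SIGMA p:R. X p)"
  have fR: "finite R" unfolding R_def
    by (rule finite_subset[OF _ finite_lists_length_eq[OF fA, of ?m]]) auto
  have fX: "finite (X p)" for p using fL by (simp add: X_def)
  have fF: "finite F" using fR fX by (auto simp: F_def)
  have m1: "?m + 1 = l + h" "1 \<le> ?m" using l_pos g_pos h by auto
  have "(real (card A) - real (l + h)) ^ ?m * \<psi> \<le> (real (card A) - real ?m) ^ ?m * \<psi>"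
    using A(2) m1 \<psi>(1) by (intro mult_right_mono power_mono) auto
  also have "\<dots> \<le> real (card R) * \<psi>"
    using card_distinct_lists_ge[OF fA, of ?m] A(2) \<psi>(1) unfolding R_def by (intro mult_right_mono) auto
  also have "\<dots> \<le> (\<Sum>p\<in>R. real (card (X p)))"
  proof -
    have "\<psi> \<le> real (card (X p))" if "p \<in> R" for p
      using that \<psi>(2)[of "set p"] by (simp add: X_def R_def distinct_card)
    then show ?thesis using sum_bounded_below[of R \<psi> "\<lambda>p. real (card (X p))"] by simp
  qed
  also have "\<dots> = real (card (SIGMA p:R. X p))" using fR fX by (subst card_SigmaI) auto
  also have "card (SIGMA p:R. X p) = card F"
    unfolding F_def by (rule card_image[symmetric]) (auto simp: inj_on_def)
  finally have cF: "2 * \<theta> * real (card L) ^ l < real (card F)" using \<theta>(2) by linarith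
  have Fprops: "length f = l + h \<and> set f \<subseteq> L \<and> set f \<in> E \<and> set (butlast f) \<subseteq> A \<and> y (last f) \<le> T"
    if "f \<in> F" for f
    using that m1 A(1) by (auto simp: F_def R_def X_def)
  have fl: "finite {xs. set xs \<subseteq> L \<and> length xs = l}" using fL by (rule finite_lists_length_eq)
  have "card (r ` F) \<le> card L ^ l" if "r ` F \<subseteq> {xs. set xs \<subseteq> L \<and> length xs = l}" for r :: "'a list \<Rightarrow> 'a list"
    using card_mono[OF fl that] card_lists_length_eq[OF fL] by simp
  moreover have "take l ` F \<subseteq> {xs. set xs \<subseteq> L \<and> length xs = l}" using Fprops by (auto dest: in_set_takeD)
  moreover have "drop h ` F \<subseteq> {xs. set xs \<subseteq> L \<and> length xs = l}" using Fprops by (auto dest: in_set_dropD)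
  ultimately have "card (take l ` F) \<le> card L ^ l" "card (drop h ` F) \<le> card L ^ l" by auto
  then have "real (card (take l ` F)) + real (card (drop h ` F)) \<le> 2 * real (card L) ^ l"
    by (simp flip: of_nat_power of_nat_add)
  then have "\<theta> * (real (card (take l ` F)) + real (card (drop h ` F))) \<le> \<theta> * (2 * real (card L) ^ l)"
    using \<theta>(1) by (intro mult_left_mono)
  then have "\<theta> * (real (card (take l ` F)) + real (card (drop h ` F))) < real (card F)"
    using cF by (simp add: mult_ac)
  from large_fibres_subset[OF fF \<theta>(1) this]
  obtain G where G: "G \<subseteq> F" "G \<noteq> {}" "\<forall>x\<in>G. \<theta> \<le> real (card {f\<in>G. take l f = take l x})"
    "\<forall>x\<in>G. \<theta> \<le> real (card {f\<in>G. drop h f = drop h x})" by auto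
  then have "fans L G \<theta>" using Fprops unfolding fans_def by blast
  then show ?thesis using G(1,2) Fprops by blast
qed

text \<open>A start in \<open>G\<close> is first connected to \<open>P\<close> by three chunks, then
  \<open>t\<close> pairs are walked. The pairs have nearly average weight; the connection may cost
  \<open>K\<close> times the average per vertex, which a large \<open>t\<close> makes
  negligible.\<close>

lemma extend_path:
  fixes y :: "'a \<Rightarrow> real"
  assumes P: "path P" and Ldef: "L = V - verts P"
    and cod: "codegree_ge L ((1 / (2 * real h) + \<gamma>) * real (card L))"
    and y: "\<And>v. 0 \<le> y v" and Y: "sum y L = \<mu> * real (card L)" and \<mu>: "0 < \<mu>" and \<gamma>: "0 < \<gamma>"
    and \<epsilon>: "0 < \<epsilon>" "\<epsilon> \<le> 1" and \<delta>: "0 \<le> \<delta>" "2 * \<delta> < \<epsilon>"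
    and a: "l + h \<le> a" "real a \<le> \<delta> * real (card L)"
    and K: "2 \<le> K" and D: "D = (1 / (2 * real h) + \<gamma>) * real (card L) - (real (card L) / K + real l)"
    and N: "N = g + h + h" "real N \<le> D"
    and many: "4 * (fillings * real (card V) ^ (g + h)) < (D - N) ^ N"
    and \<theta>: "0 \<le> \<theta>" "2 * \<theta> * real (card L) ^ l < (real a - real (l + h)) ^ (l + h - 1) * (\<gamma> * real (card L))"
      "\<theta> > fillings + real h * real (h * (3 + 2 * t)) * real (card V) ^ (h - 1)"
  shows "\<exists>bs. path (bs @ P) \<and> length bs = 2 * t + 3 \<and> (\<forall>d\<in>set bs. length d = h) \<and> verts bs \<subseteq> L \<and>
    sum_list (map y (concat bs)) \<le> (real t * (2 * real h * (1 + \<epsilon>)) + 3 * real h * K) * \<mu>"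
proof -
  have LV: "L \<subseteq> V" using Ldef by auto
  then have fL: "finite L" using finV finite_subset by blast
  have h0: "0 < h" using h g_pos by simp
  have aN: "a \<le> card L"
  proof -
    have "\<delta> * real (card L) \<le> 1 * real (card L)" using \<delta> \<epsilon> by (intro mult_right_mono) auto
    then show ?thesis using a(2) by simp
  qed
  obtain A w where A: "A \<subseteq> L" "card A = a" "\<forall>x\<in>A. y x \<le> w" "\<forall>v\<in>L - A. w \<le> y v" "w \<in> y ` A"
    using exists_lowest_subset[OF fL aN, of y] a(1) l_pos by auto
  have w0: "0 \<le> w" using A(5) y by auto
  have N0: "0 < card L" using aN a(1) l_pos by linarith
  define T where "T = 2 * real h * \<mu> * (1 + \<epsilon>) - (2 * real h - 1) * w"
  have Teq: "T + (2 * real h - 1) * w = 2 * real h * \<mu> * (1 + \<epsilon>)" by (simp add: T_def)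
  have light: "\<gamma> * real (card L) \<le> real (card {u\<in>L. insert u S \<in> E \<and> y u \<le> T})" "w \<le> 2 * \<mu>"
    if S: "S \<subseteq> A" "card S = l + h - 1" for S
  proof -
    let ?U = "{u\<in>L. insert u S \<in> E}"
    have 1: "(1 / (2 * real h) + \<gamma>) * real (card L) \<le> real (card ?U)"
      using cod S A(1) LV unfolding codegree_ge_def by blast
    have 2: "{u\<in>?U. y u \<le> T} = {u\<in>L. insert u S \<in> E \<and> y u \<le> T}" by auto
    have 3: "?U \<subseteq> L" by auto
    have 4: "real (card A) \<le> \<delta> * real (card L)" using A(2) a(2) by simp
    note ln = light_neighbours[where y = y, OF fL y Y \<mu> h0 3 1 A(1) 4 _ w0 \<delta>(1,2) \<epsilon>(2) N0 Teq]
    show "\<gamma> * real (card L) \<le> real (card {u\<in>L. insert u S \<in> E \<and> y u \<le> T})"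
      using ln(1) A(4) unfolding 2 by blast
    show "w \<le> 2 * \<mu>" using ln(2) A(4) by blast
  qed
  have w2: "w \<le> 2 * \<mu>"
  proof -
    obtain S where "S \<subseteq> A" "card S = l + h - 1"
      using A(2) a(1) by (metis diff_le_self le_trans obtain_subset_with_card_n)
    then show ?thesis by (rule light(2))
  qed
  obtain G where G: "G \<noteq> {}" "fans L G \<theta>" "\<forall>f\<in>G. set (butlast f) \<subseteq> A \<and> y (last f) \<le> T"
    using exists_fans[OF LV A(1), of "\<gamma> * real (card L)" y T \<theta>] light(1) A(2) a(1) \<gamma> \<theta> by auto
  note Gf = fansD[OF G(2)]
  have bl: "f = butlast f @ [last f]" "length (butlast f) = l + h - 1" if "f \<in> G" for f
    using Gf(1)[OF that] l_pos by (cases f rule: rev_cases; simp)+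
  have take_h: "set (take h f) \<subseteq> A" if "f \<in> G" for f
  proof -
    have "take h f = take h (butlast f)"
      using Gf(1)[OF that] l_pos by (intro take_butlast[symmetric]) simp
    then show ?thesis using G(3) that set_take_subset[of h "butlast f"] by auto
  qed
  have drop_l: "sum_list (map y (drop l f)) \<le> (real h - 1) * w + T" if "f \<in> G" for f
  proof -
    have "l < length f" using Gf(1)[OF that] h0 by simp
    then have "drop l f = drop l (butlast f) @ [last f]"
      by (metis append_butlast_last_id drop_butlast drop_eq_Nil last_drop not_le)
    moreover have "sum_list (map y (drop l (butlast f))) \<le> real (length (drop l (butlast f))) * w"
      using G(3) that A(3) by (intro sum_list_le_length) (auto dest: in_set_dropD)
    moreover have "real (length (drop l (butlast f))) = real h - 1"
      using bl(2)[OF that] h0 by (simp add: of_nat_diff)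
    ultimately show ?thesis using G(3) that by auto
  qed
  have W: "sum_list (map y (drop l f)) + sum_list (map y (take h f')) \<le> 2 * real h * \<mu> * (1 + \<epsilon>)"
    if "f \<in> G" "f' \<in> G" for f f'
  proof -
    have "sum_list (map y (take h f')) \<le> real (length (take h f')) * w"
      using take_h[OF that(2)] A(3) by (intro sum_list_le_length) auto
    then have "sum_list (map y (take h f')) \<le> real h * w" using Gf(1)[OF that(2)] by simp
    then show ?thesis using drop_l[OF that(1)] Teq by (simp add: algebra_simps)
  qed
  obtain f0 where f0: "f0 \<in> G" using G(1) by blast
  let ?r = "take l f0"
  have r: "length ?r = l" "distinct ?r" "set ?r \<subseteq> L" "set ?r \<subseteq> A"
  proof -
    show "length ?r = l" "distinct ?r" using Gf(1,4)[OF f0] by simp_all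
    show "set ?r \<subseteq> A" using take_h[OF f0] set_take_subset_set_take[of l h f0] h by auto
    then show "set ?r \<subseteq> L" using A(1) by blast
  qed
  obtain x z zs where Pxy: "P = x # z # zs" and x: "length (take l x) = l" "distinct (take l x)"
    "set (take l x) \<subseteq> verts P" using path_head[OF P] .
  \<comment> \<open>By Markov's inequality at most |L| / K vertices are heavier than
    \<open>K\<close> times the average; the connection avoids them.\<close>
  let ?H = "{v\<in>L. K * \<mu> < y v}"
  have cH: "real (card ?H) \<le> real (card L) / K"
  proof -
    have "real (card ?H) * (K * \<mu>) \<le> sum y ?H" using sum_bounded_below[of ?H "K * \<mu>" y] by auto
    also have "\<dots> \<le> sum y L" using fL y by (intro sum_mono2) auto
    finally have "real (card ?H) * K * \<mu> \<le> real (card L) * \<mu>" by (simp add: Y mult_ac)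
    then have "real (card ?H) * K \<le> real (card L)" using \<mu> by simp
    then show ?thesis using K by (simp add: field_simps)
  qed
  have "real (card (?H \<union> set ?r)) \<le> real (card L) / K + real l"
    using card_Un_le[of ?H "set ?r"] cH card_length[of ?r] r(1) by linarith
  then have L': "codegree_ge (L - (?H \<union> set ?r)) D"
    unfolding D using fL by (intro codegree_ge_Diff[OF cod]) auto
  obtain B z1 z2 where B: "length B = g" "length z1 = h" "length z2 = h"
    "distinct (B @ z1 @ z2)" "set (B @ z1 @ z2) \<subseteq> L - (?H \<union> set ?r)"
    "ed (?r @ B) z1 \<in> E" "ed z1 z2 \<in> E" "ed z2 (take l x) \<in> E"
    "\<phi> (ed (?r @ B) z1) \<noteq> \<phi> (ed z1 z2)"
    "\<phi> (ed z1 z2) \<noteq> \<phi> (ed z2 (take l x))" "\<phi> (ed z2 (take l x)) \<noteq> \<phi> (ed x z)"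
  \<comment> \<open>No edge precedes \<open>?r\<close> yet, so \<open>\<phi> {}\<close> serves as an
    arbitrary colour at this end. The walk compares its first edge with the connection when that
    edge is chosen.\<close>
  proof (rule connect[OF L' N(1) N(2) many, of ?r "take l x" "\<phi> {}" "\<phi> (ed x z)"])
    show "length ?r = l" "distinct ?r" by (rule r)+
    show "set ?r \<subseteq> V" using r(3) LV by auto
    show "set (take l x) \<subseteq> V" using x(3) P by (auto simp: path_def)
    show "set (take l x) \<inter> (L - (?H \<union> set ?r)) = {}" using x(3) Ldef by auto
  qed (use x in auto)
  have e: "ed z2 (take l x) = ed z2 x" by (simp add: ed_def)
  let ?bs = "[?r @ B, z1, z2]"
  have lrB: "length (?r @ B) = h" using r(1) B(1) h by (metis length_append)
  have bsL: "verts ?bs \<subseteq> L" using r(3) B(5) by auto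
  have "good P" using P by (simp add: path_def)
  then have good: "good (?bs @ P)" using B(6-11) by (simp add: e Pxy)
  have path0: "path (?bs @ P)"
  proof (rule path_append[OF P good])
    show "\<forall>d\<in>set ?bs. length d = h" using lrB B(2,3) by simp
    show "distinct (concat ?bs)" using r(2) B(4,5) by auto
    show "verts ?bs \<subseteq> V" using bsL LV by blast
    show "verts ?bs \<inter> verts P = {}" using bsL Ldef by blast
  qed
  have disj: "verts P \<inter> L = {}" using Ldef by blast
  have \<theta>3: "fillings + real h * real (h * (length ?bs + 2 * t)) * real (card V) ^ (h - 1) < \<theta>"
  proof -
    have "length ?bs + 2 * t = 3 + 2 * t" by simp
    then show ?thesis using \<theta>(3) by (simp only:)
  qed
  have hd: "take l (hd ?bs) = take l f0" using r(1) by simp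
  obtain bs' where bs': "path ((bs' @ ?bs) @ P)" "length bs' = 2 * t" "\<forall>d\<in>set bs'. length d = h"
    "verts bs' \<subseteq> L" "sum_list (map y (concat bs')) \<le> real t * (2 * real h * \<mu> * (1 + \<epsilon>))"
    using walk_pairs[where y = y, OF G(2) LV path0 disj bsL \<theta>3 _ _ f0 hd W] lrB B(2,3) by auto
  have small: "y v \<le> K * \<mu>" if "v \<in> verts ?bs" for v
  proof (cases "v \<in> set ?r")
    case True
    then have "y v \<le> w" using r(4) A(3) by blast
    also have "\<dots> \<le> K * \<mu>" using w2 K \<mu> mult_right_mono[of 2 K \<mu>] by linarith
    finally show ?thesis .
  next
    case False
    then have "v \<in> set (B @ z1 @ z2)" using that by auto
    then have "v \<in> L - (?H \<union> set ?r)" using B(5) by blast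
    then show ?thesis by auto
  qed
  have "sum_list (map y (concat ?bs)) \<le> real (length (concat ?bs)) * (K * \<mu>)"
    using small by (rule sum_list_le_length)
  also have "length (concat ?bs) = 3 * h" using lrB B(2,3) by simp
  finally have "sum_list (map y (concat (bs' @ ?bs))) \<le> real t * (2 * real h * \<mu> * (1 + \<epsilon>)) + real (3 * h) * (K * \<mu>)"
    using bs'(5) by (simp del: concat.simps)
  then have "sum_list (map y (concat (bs' @ ?bs))) \<le> (real t * (2 * real h * (1 + \<epsilon>)) + 3 * real h * K) * \<mu>"
    by (simp add: algebra_simps del: concat.simps concat_append)
  moreover have "verts (bs' @ ?bs) \<subseteq> L" using bs'(4) bsL by auto
  moreover have "\<forall>d\<in>set (bs' @ ?bs). length d = h" using bs'(3) lrB B(2,3) by auto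
  ultimately show ?thesis using bs'(1,2) by (intro exI[of _ "bs' @ ?bs"]) simp
qed

subsection \<open>The potential\<close>

definition ridges :: "'a set set" where "ridges = {S. S \<subseteq> V \<and> card S = l + h - 1}"

definition dens :: "'a set \<Rightarrow> 'a set \<Rightarrow> real" where
  "dens L S = real (card {x\<in>L. insert x S \<in> E}) / real (card L)"

text \<open>A soft minimum: every summand is a lower bound, and up to the factor
  \<open>card ridges\<close> the largest one is an upper bound. A value below exp (- \<eta> * s)
  forces density above \<open>s\<close> at every ridge.\<close>

definition potential :: "real \<Rightarrow> 'a set \<Rightarrow> real" where
  "potential \<eta> L = (\<Sum>S\<in>ridges. exp (- \<eta> * dens L S))"

text \<open>Up to a positive factor, the first-order effect on the potential of deleting \<open>v\<close> from \<open>L\<close>.\<close>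

definition load :: "real \<Rightarrow> 'a set \<Rightarrow> 'a \<Rightarrow> real" where
  "load \<eta> L v = (\<Sum>S\<in>ridges. if insert v S \<in> E then exp (- \<eta> * dens L S) else 0)"

lemma ridges_finite: "finite ridges"
  unfolding ridges_def by (rule finite_subset[of _ "Pow V"]) (auto simp: finV)

lemma card_ridges: "card ridges \<le> card V ^ (l + h - 1)"
proof -
  let ?X = "{xs. set xs \<subseteq> V \<and> length xs = l + h - 1}"
  have fX: "finite ?X" using finV by (rule finite_lists_length_eq)
  have "ridges \<subseteq> set ` ?X"
  proof
    fix S assume S: "S \<in> ridges"
    then have "finite S" using finV finite_subset by (auto simp: ridges_def)
    then obtain xs where "set xs = S" "distinct xs" using finite_distinct_list by blast
    then show "S \<in> set ` ?X" using S by (intro image_eqI[of _ _ xs]) (auto simp: ridges_def distinct_card)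
  qed
  then have "card ridges \<le> card (set ` ?X)" using fX by (intro card_mono) auto
  also have "\<dots> \<le> card ?X" using fX by (rule card_image_le)
  finally show ?thesis using card_lists_length_eq[OF finV] by simp
qed

lemma sum_load:
  assumes "finite T"
  shows "sum (load \<eta> L) T = (\<Sum>S\<in>ridges. exp (- \<eta> * dens L S) * real (card {x\<in>T. insert x S \<in> E}))"
proof -
  have "sum (load \<eta> L) T = (\<Sum>S\<in>ridges. \<Sum>v\<in>T. if insert v S \<in> E then exp (- \<eta> * dens L S) else 0)"
    unfolding load_def by (rule sum.swap)
  also have "\<dots> = (\<Sum>S\<in>ridges. exp (- \<eta> * dens L S) * real (card {x\<in>T. insert x S \<in> E}))"
    by (intro sum.cong refl) (simp add: sum.inter_filter[OF assms, symmetric])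
  finally show ?thesis .
qed

lemma dens_nonneg: "0 \<le> dens L S" by (simp add: dens_def)

lemma dens_le_1: "finite L \<Longrightarrow> dens L S \<le> 1"
  using card_mono[of L "{x\<in>L. insert x S \<in> E}"] by (auto simp: dens_def divide_le_eq_1)

text \<open>Deleting \<open>T\<close> multiplies the summand of \<open>S\<close> by exp (z S) with
  |z S| \<le> \<beta>. The first-order terms add up to a multiple of (load of \<open>T\<close>) -
  \<open>b\<close> * (average load), which the hypothesis on the load bounds by \<epsilon> * \<beta>
  times the potential; the quadratic remainder costs \<beta>^2.\<close>

lemma potential_step:
  assumes L: "finite L" and T: "T \<subseteq> L" "card T = b" "b < card L" and \<eta>: "0 \<le> \<eta>" and \<epsilon>: "0 \<le> \<epsilon>"
    and \<beta>: "\<beta> = \<eta> * real b / (real (card L) - real b)" "\<beta> \<le> 1"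
    and load: "sum (load \<eta> L) T \<le> (1 + \<epsilon>) * real b * (sum (load \<eta> L) L / real (card L))"
  shows "potential \<eta> (L - T) \<le> potential \<eta> L * (1 + \<epsilon> * \<beta> + \<beta>\<^sup>2)"
proof -
  let ?N = "real (card L)" and ?b = "real b"
  have fT: "finite T" using T(1) L finite_subset by blast
  have Nb: "0 < ?N - ?b" using T by simp
  have N0: "0 < ?N" using T by simp
  have \<beta>0: "0 \<le> \<beta>" unfolding \<beta> using \<eta> Nb by simp
  define x where "x = (\<lambda>S. real (card {v\<in>T. insert v S \<in> E}))"
  define w where "w = (\<lambda>S. exp (- \<eta> * dens L S))"
  \<comment> \<open>The increase of the exponent: |T| deleted vertices with \<open>x S\<close>
    neighbours of \<open>S\<close> among them lower the density by (x S - b * dens L S) / (|L| -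
    b).\<close>
  define z where "z = (\<lambda>S. \<eta> * (x S - ?b * dens L S) / (?N - ?b))"
  have dens': "dens (L - T) S = dens L S + (?b * dens L S - x S) / (?N - ?b)" for S
  proof -
    have "{v\<in>L - T. insert v S \<in> E} = {v\<in>L. insert v S \<in> E} - {v\<in>T. insert v S \<in> E}" by auto
    then have "card {v\<in>L - T. insert v S \<in> E} = card {v\<in>L. insert v S \<in> E} - card {v\<in>T. insert v S \<in> E}"
      using T(1) fT by (simp add: card_Diff_subset subset_iff)
    moreover have "card {v\<in>T. insert v S \<in> E} \<le> card {v\<in>L. insert v S \<in> E}"
      using T(1) L by (intro card_mono) auto
    ultimately have 1: "real (card {v\<in>L - T. insert v S \<in> E}) = real (card {v\<in>L. insert v S \<in> E}) - x S"
      by (simp add: x_def of_nat_diff)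
    have 2: "real (card (L - T)) = ?N - ?b"
      using T card_Diff_subset[OF fT T(1)] by (simp add: of_nat_diff)
    have 3: "real (card {v\<in>L. insert v S \<in> E}) = ?N * dens L S" using N0 by (simp add: dens_def)
    have "dens (L - T) S = (?N * dens L S - x S) / (?N - ?b)"
      unfolding dens_def[of "L - T"] 1 2 3 ..
    also have "?N * dens L S - x S = (?N - ?b) * dens L S + (?b * dens L S - x S)" by (simp add: algebra_simps)
    also have "\<dots> / (?N - ?b) = dens L S + (?b * dens L S - x S) / (?N - ?b)"
      using Nb by (simp add: add_divide_distrib)
    finally show ?thesis .
  qed
  have zb: "\<bar>z S\<bar> \<le> \<beta>" for S
  proof -
    have "x S \<le> ?b" unfolding x_def using T(2) fT by (simp only: of_nat_le_iff) (metis (no_types, lifting) card_mono mem_Collect_eq subsetI)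
    moreover have "0 \<le> x S" by (simp add: x_def)
    moreover have "?b * dens L S \<le> ?b * 1" using dens_le_1[OF L] by (intro mult_left_mono) auto
    moreover have "0 \<le> ?b * dens L S" using dens_nonneg by simp
    ultimately have "\<bar>x S - ?b * dens L S\<bar> \<le> ?b" by linarith
    then have "\<eta> * \<bar>x S - ?b * dens L S\<bar> / (?N - ?b) \<le> \<eta> * ?b / (?N - ?b)"
      using \<eta> Nb by (intro divide_right_mono mult_left_mono) auto
    then show ?thesis using \<eta> Nb by (simp add: z_def \<beta> abs_mult)
  qed
  have ez: "exp (- \<eta> * dens (L - T) S) \<le> w S * (1 + z S + \<beta>\<^sup>2)" for S
  proof -
    have "- \<eta> * dens (L - T) S = - \<eta> * dens L S + z S"
      unfolding dens' z_def by (simp add: algebra_simps diff_divide_distrib)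
    then have "exp (- \<eta> * dens (L - T) S) = w S * exp (z S)" by (simp only: w_def exp_add)
    also have "exp (z S) \<le> 1 + z S + (z S)\<^sup>2" using zb[of S] \<beta>(2) by (intro exp_le_quadratic) auto
    also have "(z S)\<^sup>2 \<le> \<beta>\<^sup>2" using zb[of S] by (metis abs_ge_zero power2_abs power_mono)
    finally show ?thesis by (simp add: w_def)
  qed
  have "potential \<eta> (L - T) \<le> (\<Sum>S\<in>ridges. w S * (1 + z S + \<beta>\<^sup>2))"
    unfolding potential_def by (intro sum_mono ez)
  also have "\<dots> = potential \<eta> L * (1 + \<beta>\<^sup>2) + (\<Sum>S\<in>ridges. w S * z S)"
    by (simp add: potential_def w_def sum.distrib sum_distrib_left sum_distrib_right algebra_simps)
  also have "(\<Sum>S\<in>ridges. w S * z S) \<le> \<epsilon> * \<beta> * potential \<eta> L"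
  proof -
    let ?D = "\<Sum>S\<in>ridges. w S * dens L S"
    have lT: "sum (load \<eta> L) T = (\<Sum>S\<in>ridges. w S * x S)" using sum_load[OF fT] by (simp add: w_def x_def)
    have lL: "sum (load \<eta> L) L / ?N = ?D"
      unfolding sum_load[OF L] by (simp add: w_def dens_def sum_divide_distrib)
    have "(\<Sum>S\<in>ridges. w S * z S) = \<eta> / (?N - ?b) * ((\<Sum>S\<in>ridges. w S * x S) - ?b * ?D)"
      unfolding sum_distrib_left sum_subtractf[symmetric]
      by (intro sum.cong refl) (simp add: z_def algebra_simps diff_divide_distrib)
    also have "\<dots> \<le> \<eta> / (?N - ?b) * (\<epsilon> * ?b * ?D)"
      using load \<eta> Nb unfolding lT lL by (intro mult_left_mono) (simp_all add: algebra_simps)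
    also have "\<dots> = \<epsilon> * \<beta> * ?D" by (simp add: \<beta>)
    also have "\<dots> \<le> \<epsilon> * \<beta> * potential \<eta> L"
    proof (rule mult_left_mono)
      show "?D \<le> potential \<eta> L" unfolding potential_def w_def
        using dens_le_1[OF L] by (intro sum_mono) simp
    qed (use \<epsilon> \<beta>0 in simp)
    finally show ?thesis .
  qed
  finally show ?thesis by (simp add: algebra_simps)
qed

lemma codegree_of_potential:
  assumes "L \<subseteq> V" "potential \<eta> L < exp (- \<eta> * s)" "0 < \<eta>" "s \<le> 1" "0 < card L"
  shows "codegree_ge L (s * real (card L))"
  unfolding codegree_ge_def
proof (intro conjI allI impI)
  show "L \<subseteq> V" by (rule assms)
  show "s * real (card L) \<le> real (card L)" using assms(4) mult_right_mono[of s 1 "real (card L)"] by simp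
  fix S assume S: "S \<subseteq> V" "card S = l + h - 1"
  then have "exp (- \<eta> * dens L S) \<le> potential \<eta> L"
    unfolding potential_def using ridges_finite by (intro member_le_sum) (auto simp: ridges_def)
  then have "exp (- \<eta> * dens L S) < exp (- \<eta> * s)" using assms(2) by linarith
  then have "s < dens L S" using assms(3) by simp
  then show "s * real (card L) \<le> real (card {x\<in>L. insert x S \<in> E})"
    using assms(5) by (simp add: dens_def field_simps)
qed

text \<open>The initial value of the potential; the number of ridges enters as a power of n, which
  becomes harmless when \<eta> is linear in n.\<close>

lemma codegree_potential:
  assumes "codegree_ge L (s * real (card L))" "0 \<le> \<eta>" "0 < card L"
  shows "potential \<eta> L \<le> real (card V) ^ (l + h - 1) * exp (- \<eta> * s)"
proof -
  have "exp (- \<eta> * dens L S) \<le> exp (- \<eta> * s)" if "S \<in> ridges" for S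
  proof -
    have "s * real (card L) \<le> real (card {x\<in>L. insert x S \<in> E})"
      using assms(1) that by (auto simp: codegree_ge_def ridges_def)
    then have "s \<le> dens L S" using assms(3) by (simp add: dens_def field_simps)
    then show ?thesis using assms(2) by (simp add: mult_left_mono)
  qed
  then have "potential \<eta> L \<le> real (card ridges) * exp (- \<eta> * s)"
    unfolding potential_def by (rule sum_bounded_above)
  also have "\<dots> \<le> real (card V) ^ (l + h - 1) * exp (- \<eta> * s)"
    using card_ridges by (intro mult_right_mono) (simp_all flip: of_nat_power)
  finally show ?thesis .
qed

text \<open>The numerical hypotheses of \<open>extend_path\<close> when \<open>N\<close> vertices
  are left: \<open>a\<close> is the size of the light set, \<theta> the degree in the fans,
  \<open>D\<close> the codegree outside the heavy vertices and the start of the walk.\<close>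

definition extendable :: "real \<Rightarrow> real \<Rightarrow> real \<Rightarrow> real \<Rightarrow> nat \<Rightarrow> nat \<Rightarrow> bool" where
  "extendable \<gamma> \<delta> s K t N \<longleftrightarrow> (\<exists>a \<theta> D. l + h \<le> a \<and> real a \<le> \<delta> * real N \<and>
      D = s * real N - (real N / K + real l) \<and> real (g + h + h) \<le> D \<and>
      4 * (fillings * real (card V) ^ (g + h)) < (D - real (g + h + h)) ^ (g + h + h) \<and>
      0 \<le> \<theta> \<and> 2 * \<theta> * real N ^ l < (real a - real (l + h)) ^ (l + h - 1) * (\<gamma> * real N) \<and>
      \<theta> > fillings + real h * real (h * (3 + 2 * t)) * real (card V) ^ (h - 1))"

text \<open>The codegree condition is not carried along directly: each round multiplies the
  potential by at most 1 + \<epsilon> * \<beta> + \<beta>^2, and as long as it stays below exp (-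
  \<eta> * s), \<open>codegree_of_potential\<close> restores the condition required by the next
  round.\<close>

lemma long_path:
  assumes P: "path P" and L0: "L0 = V - verts P"
    and params: "0 < \<gamma>" "0 < \<epsilon>'" "\<epsilon>' \<le> 1" "0 \<le> \<delta>" "2 * \<delta> < \<epsilon>'" "2 \<le> K" "0 < \<epsilon>" "0 < \<eta>"
    and s: "s = 1 / (2 * real h) + \<gamma>" "s \<le> 1"
    and b: "b = h * (2 * t + 3)" "real t * (2 * real h * (1 + \<epsilon>')) + 3 * real h * K \<le> (1 + \<epsilon>) * real b"
    and \<beta>: "\<beta> = \<eta> * real b / (real Nmin - real b)" "\<beta> \<le> 1" "b < Nmin"
    and pot: "potential \<eta> L0 * (1 + \<epsilon> * \<beta> + \<beta>\<^sup>2) ^ I < exp (- \<eta> * s)"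
    and size: "Nmin + I * b \<le> card L0"
    and num: "\<And>N. Nmin \<le> N \<Longrightarrow> N \<le> card V \<Longrightarrow> extendable \<gamma> \<delta> s K t N"
  shows "\<exists>bs. path (bs @ P) \<and> length bs = I * (2 * t + 3) \<and> (\<forall>d\<in>set bs. length d = h) \<and>
    verts bs \<subseteq> L0 \<and> codegree_ge (L0 - verts bs) (s * real (card (L0 - verts bs)))"
proof -
  have L0V: "L0 \<subseteq> V" using L0 by auto
  have fL0: "finite L0" using L0V finV finite_subset by blast
  let ?q = "1 + \<epsilon> * \<beta> + \<beta>\<^sup>2"
  have \<beta>0: "0 \<le> \<beta>" unfolding \<beta> using params \<beta>(3) by simp
  have q1: "1 \<le> ?q" using \<beta>0 params by simp
  have pot0: "0 \<le> potential \<eta> L" for L unfolding potential_def by (intro sum_nonneg) simp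
  have "\<exists>bs. path (bs @ P) \<and> length bs = i * (2 * t + 3) \<and> (\<forall>d\<in>set bs. length d = h) \<and>
    verts bs \<subseteq> L0 \<and> card (L0 - verts bs) = card L0 - i * b \<and>
    potential \<eta> (L0 - verts bs) \<le> potential \<eta> L0 * ?q ^ i" if "i \<le> I" for i
    using that
  proof (induction i)
    case 0
    show ?case using P by (intro exI[of _ "[]"]) simp
  next
    case (Suc i)
    then obtain bs where bs: "path (bs @ P)" "length bs = i * (2 * t + 3)" "\<forall>d\<in>set bs. length d = h"
      "verts bs \<subseteq> L0" "card (L0 - verts bs) = card L0 - i * b"
      "potential \<eta> (L0 - verts bs) \<le> potential \<eta> L0 * ?q ^ i" by auto
    define L where "L = L0 - verts bs"
    have fL: "finite L" using fL0 by (simp add: L_def)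
    have LV: "L \<subseteq> V" using L0V by (auto simp: L_def)
    have Leq: "L = V - verts (bs @ P)" by (auto simp: L_def L0)
    have "i * b + b \<le> I * b" using Suc.prems by (metis add.commute mult_Suc mult_le_mono1)
    then have cL: "Nmin \<le> card L" "card L \<le> card V"
      using size bs(5) card_mono[OF finV LV] by (simp_all add: L_def)
    have cL0: "0 < card L" "b < card L" using cL \<beta>(3) by simp_all
    have "potential \<eta> L0 * ?q ^ i \<le> potential \<eta> L0 * ?q ^ I"
      using Suc.prems q1 pot0 by (intro mult_left_mono power_increasing) auto
    then have potL: "potential \<eta> L < exp (- \<eta> * s)" using bs(6) pot by (simp add: L_def)
    have cod: "codegree_ge L (s * real (card L))"
      by (rule codegree_of_potential[OF LV potL params(8) s(2) cL0(1)])
    obtain a \<theta> D where num: "l + h \<le> a" "real a \<le> \<delta> * real (card L)"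
      "D = s * real (card L) - (real (card L) / K + real l)" "real (g + h + h) \<le> D"
      "4 * (fillings * real (card V) ^ (g + h)) < (D - real (g + h + h)) ^ (g + h + h)"
      "0 \<le> \<theta>" "2 * \<theta> * real (card L) ^ l < (real a - real (l + h)) ^ (l + h - 1) * (\<gamma> * real (card L))"
      "\<theta> > fillings + real h * real (h * (3 + 2 * t)) * real (card V) ^ (h - 1)"
      using num[OF cL] unfolding extendable_def by blast
    define \<mu> where "\<mu> = sum (load \<eta> L) L / real (card L)"
    have load0: "0 \<le> load \<eta> L v" for v unfolding load_def by (intro sum_nonneg) simp
    have \<mu>pos: "0 < \<mu>"
    proof -
      have "ridges \<noteq> {}"
      proof -
        have "l + h - 1 \<le> card V" using num(1,2) cL params card_mono[OF finV LV]
        proof -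
          have "real a \<le> 1 * real (card L)" using num(2) params
            by (intro order_trans[OF num(2)] mult_right_mono) auto
          then show ?thesis using num(1) cL(2) by simp
        qed
        then obtain S where "S \<subseteq> V" "card S = l + h - 1" by (meson obtain_subset_with_card_n)
        then show ?thesis by (auto simp: ridges_def)
      qed
      moreover have "0 < exp (- \<eta> * dens L S) * real (card {x\<in>L. insert x S \<in> E})" if "S \<in> ridges" for S
      proof -
        have "s * real (card L) \<le> real (card {x\<in>L. insert x S \<in> E})"
          using cod that by (auto simp: codegree_ge_def ridges_def)
        moreover have "0 < s" using s(1) params(1) by (simp add: add_nonneg_pos)
        then have "0 < s * real (card L)" using cL0(1) by simp
        ultimately have "0 < real (card {x\<in>L. insert x S \<in> E})" by linarith
        then show ?thesis by simp
      qed
      ultimately have "0 < sum (load \<eta> L) L"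
        unfolding sum_load[OF fL] using ridges_finite by (intro sum_pos) auto
      then show ?thesis using cL0(1) by (simp add: \<mu>_def)
    qed
    have \<mu>eq: "sum (load \<eta> L) L = \<mu> * real (card L)" using cL0(1) by (simp add: \<mu>_def)
    obtain cs where cs: "path (cs @ bs @ P)" "length cs = 2 * t + 3" "\<forall>d\<in>set cs. length d = h"
      "verts cs \<subseteq> L"
      "sum_list (map (load \<eta> L) (concat cs)) \<le> (real t * (2 * real h * (1 + \<epsilon>')) + 3 * real h * K) * \<mu>"
      using extend_path[OF bs(1) Leq cod[unfolded s(1)] load0 \<mu>eq \<mu>pos params(1-5) num(1,2) params(6)
          num(3)[unfolded s(1)] refl num(4-8)] by blast
    have dcs: "distinct (concat cs)" using cs(1) by (simp add: path_def)
    have ccs: "card (verts cs) = b"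
      using distinct_card[OF dcs] length_concat_uniform[OF cs(3)] cs(2) b(1) by (simp add: mult.commute del: set_concat)
    have "sum (load \<eta> L) (verts cs) = sum_list (map (load \<eta> L) (concat cs))"
      using dcs by (rule sum_list_distinct_conv_sum_set[symmetric])
    also have "\<dots> \<le> (1 + \<epsilon>) * real b * \<mu>"
      using cs(5) mult_right_mono[OF b(2), of \<mu>] \<mu>pos by linarith
    finally have ld: "sum (load \<eta> L) (verts cs) \<le> (1 + \<epsilon>) * real b * (sum (load \<eta> L) L / real (card L))"
      by (simp add: \<mu>_def)
    let ?\<beta> = "\<eta> * real b / (real (card L) - real b)"
    \<comment> \<open>The factor belonging to the smallest admissible remainder dominates those of
      all earlier rounds.\<close>
    have \<beta>le: "?\<beta> \<le> \<beta>" unfolding \<beta>(1) using cL cL0 \<beta>(3) params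
      by (intro divide_left_mono mult_pos_pos) (auto simp: mult_nonneg_nonneg)
    have \<beta>0': "0 \<le> ?\<beta>" using params cL0 by simp
    have "potential \<eta> (L - verts cs) \<le> potential \<eta> L * (1 + \<epsilon> * ?\<beta> + ?\<beta>\<^sup>2)"
      by (rule potential_step[OF fL cs(4) ccs cL0(2) _ _ refl _ ld]) (use params \<beta>le \<beta>(2) in auto)
    also have "\<dots> \<le> potential \<eta> L * ?q"
      using \<beta>le \<beta>0' params pot0 by (intro mult_left_mono add_mono power_mono) auto
    also have "\<dots> \<le> potential \<eta> L0 * ?q ^ i * ?q"
      using bs(6) q1 unfolding L_def by (intro mult_right_mono) auto
    finally have p: "potential \<eta> (L - verts cs) \<le> potential \<eta> L0 * ?q ^ Suc i" by (simp add: mult_ac)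
    have Ld: "L0 - verts (cs @ bs) = L - verts cs" by (auto simp: L_def)
    show ?case
    proof (intro exI[of _ "cs @ bs"] conjI)
      show "path ((cs @ bs) @ P)" using cs(1) by simp
      show "length (cs @ bs) = Suc i * (2 * t + 3)" using cs(2) bs(2) by simp
      show "\<forall>d\<in>set (cs @ bs). length d = h" using cs(3) bs(3) by auto
      show "verts (cs @ bs) \<subseteq> L0" using cs(4) bs(4) by (auto simp: L_def)
      show "card (L0 - verts (cs @ bs)) = card L0 - Suc i * b"
      proof -
        have "card L = card L0 - i * b" using bs(5) by (simp only: L_def)
        then show ?thesis unfolding Ld using card_Diff_subset[OF _ cs(4)] ccs by simp
      qed
      show "potential \<eta> (L0 - verts (cs @ bs)) \<le> potential \<eta> L0 * ?q ^ Suc i"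
        unfolding Ld by (rule p)
    qed
  qed
  from this[of I] obtain bs where bs: "path (bs @ P)" "length bs = I * (2 * t + 3)" "\<forall>d\<in>set bs. length d = h"
      "verts bs \<subseteq> L0" "card (L0 - verts bs) = card L0 - I * b"
      "potential \<eta> (L0 - verts bs) \<le> potential \<eta> L0 * ?q ^ I" by auto
  have "codegree_ge (L0 - verts bs) (s * real (card (L0 - verts bs)))"
  proof (rule codegree_of_potential[OF _ _ params(8) s(2)])
    show "L0 - verts bs \<subseteq> V" using L0V by auto
    show "potential \<eta> (L0 - verts bs) < exp (- \<eta> * s)" using bs(6) pot by linarith
    show "0 < card (L0 - verts bs)" using bs(5) size \<beta>(3) by simp
  qed
  then show ?thesis using bs by blast
qed

end

section \<open>Closing the path to a cycle, absorbing the leftover, and assembling the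
  argument\<close>

lemma split_into_chunks:
  "length ws = m * h \<Longrightarrow> \<exists>ts. concat ts = ws \<and> length ts = m \<and> (\<forall>t\<in>set ts. length t = h)"
proof (induction m arbitrary: ws)
  case (Suc m)
  then have "length (drop h ws) = m * h" by simp
  from Suc.IH[OF this] obtain ts where "concat ts = drop h ws" "length ts = m" "\<forall>t\<in>set ts. length t = h" by blast
  then show ?case using Suc.prems by (intro exI[of _ "take h ws # ts"]) auto
qed auto

context coloured_graph begin

lemma good_last_cong:
  assumes "take l b = take l b'"
  shows "good (xs @ [a, b]) \<longleftrightarrow> good (xs @ [a, b'])"
proof (cases xs rule: rev_cases)
  case Nil
  then show ?thesis using assms by (simp add: ed_def)
next
  case (snoc ys c)
  have "good (ys @ c # a # [d]) \<longleftrightarrow> good (ys @ [c, a]) \<and> good (c # a # [d])" for d by (rule good_split)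
  then show ?thesis using assms snoc by (simp add: ed_def)
qed

text \<open>The connection is built before absorption, so its vertices and edges are settled when
  the leftover is distributed. Insertion happens only inside the blocks and leaves the closed
  sequence intact elsewhere.\<close>

lemma close_path:
  assumes qs: "path (bs @ concat (map block qs) @ P0)" "length P0 = 2" "\<forall>q\<in>set qs. absorber (fst q)"
    and bs: "2 \<le> length bs" and hn: "h dvd card V"
    and L: "L = V - verts (bs @ concat (map block qs) @ P0)" "codegree_ge L D"
    and N: "N = g + h + h" "real N \<le> D"
    and many: "4 * (fillings * real (card V) ^ (g + h)) < (D - N) ^ N"
    and hits: "\<And>t. t \<in> chunks \<Longrightarrow> m \<le> hits qs t" and small: "card L \<le> h * m"
  shows "\<exists>C. hamilton_kl_cycle (l + h) l V E C \<and> properly_colored C \<phi>"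
proof -
  let ?pre = "bs @ concat (map block qs)"
  have h0: "0 < h" using h g_pos by simp
  obtain p0 r where P0: "P0 = [p0, r]" using qs(2) by (cases P0; cases "tl P0") auto
  obtain x y bs' where bsxy: "bs = x # y # bs'" using bs by (cases bs; cases "tl bs") auto
  have path: "good (?pre @ [p0, r])" "distinct (concat (?pre @ [p0, r]))" "verts (?pre @ [p0, r]) \<subseteq> V"
    "\<forall>d\<in>set (?pre @ [p0]). length d = h" "length r = l"
    using qs(1) unfolding path_def P0 by (auto simp: butlast_append)
  have x: "length x = h" "distinct x" "set x \<subseteq> V" "set x \<inter> L = {}"
    using path by (auto simp: bsxy L(1) P0)
  have r: "length r = l" "distinct r" "set r \<subseteq> V" "set r \<inter> L = {}"
    using path by (auto simp: L(1) P0)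
  obtain B z1 z2 where B: "length B = g" "length z1 = h" "length z2 = h"
    "distinct (B @ z1 @ z2)" "set (B @ z1 @ z2) \<subseteq> L"
    "ed (r @ B) z1 \<in> E" "ed z1 z2 \<in> E" "ed z2 (take l x) \<in> E"
    "\<phi> (ed (r @ B) z1) \<noteq> \<phi> (ed p0 r)" "\<phi> (ed (r @ B) z1) \<noteq> \<phi> (ed z1 z2)"
    "\<phi> (ed z1 z2) \<noteq> \<phi> (ed z2 (take l x))" "\<phi> (ed z2 (take l x)) \<noteq> \<phi> (ed x y)"
  proof (rule connect[OF L(2) N(1) N(2) many r, of "take l x" "\<phi> (ed p0 r)" "\<phi> (ed x y)"])
    show "length (take l x) = l" "distinct (take l x)" "set (take l x) \<subseteq> V" "set (take l x) \<inter> L = {}"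
      using x h set_take_subset[of l x] by auto
  qed
  let ?end = "[p0, r @ B, z1, z2]"
  let ?cs = "?pre @ ?end"
  have e: "ed z2 (take l x) = ed z2 x" "ed p0 (r @ B) = ed p0 r" using r(1) by (auto simp: ed_def)
  have gxy: "ed x y \<in> E" using path(1) by (simp add: bsxy)
  have ger: "ed p0 r \<in> E" using path(1) good_split[of ?pre p0 r "[]"] by auto
  \<comment> \<open>Filling the final \<open>l\<close>-list up to a chunk does not change the last
    edge.\<close>
  have "good (?pre @ [p0, r @ B])" using path(1) good_last_cong[of "r @ B" r ?pre p0] r(1) by simp
  moreover have "good (p0 # (r @ B) # [z1, z2, x, y])"
    using B(6-8,10,11,12) B(9)[symmetric] ger gxy by (simp add: e)
  ultimately have "good (?pre @ p0 # (r @ B) # [z1, z2, x, y])"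
    using good_split[of ?pre p0 "r @ B" "[z1, z2, x, y]"] by blast
  then have good: "good (bs @ concat (map block qs) @ (?end @ [x, y]))" by simp
  have disj: "verts (?pre @ [p0, r]) \<inter> set (B @ z1 @ z2) = {}" using B(5) unfolding L(1) P0 by auto
  have concat_cs: "concat ?cs = concat (?pre @ [p0, r]) @ B @ z1 @ z2" by simp
  have dcs: "distinct (concat ?cs)" unfolding concat_cs using path(2) B(4) disj distinct_append by blast
  have scs: "verts ?cs = V - (L - set (B @ z1 @ z2))"
  proof -
    have LX: "L = V - verts (?pre @ [p0, r])" using L(1) P0 by simp
    show ?thesis unfolding concat_cs set_append[of "concat (?pre @ [p0, r])" "B @ z1 @ z2"]
      using B(5) path(3) unfolding LX by blast
  qed
  have len_rB: "length (r @ B) = h" using r(1) B(1) h by (metis length_append)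
  have lcs: "\<forall>d\<in>set ?cs. length d = h" using path(4) len_rB B(2,3) by auto
  define W where "W = L - set (B @ z1 @ z2)"
  have LV: "L \<subseteq> V" using L(1) by auto
  have finW: "finite W" using LV finV finite_subset unfolding W_def by blast
  have WV: "W \<subseteq> V" using LV by (auto simp: W_def)
  have VW: "verts ?cs = V - W" using scs by (simp only: W_def)
  have cV: "card V = card W + length ?cs * h"
  proof -
    have "card (V - W) = length ?cs * h"
      unfolding VW[symmetric] distinct_card[OF dcs] by (rule length_concat_uniform[OF lcs])
    then show ?thesis using card_Diff_subset[OF finW WV] card_mono[OF finV WV] by simp
  qed
  \<comment> \<open>The closed sequence consists of full chunks and \<open>h\<close> divides n; this
    is where the divisibility hypothesis makes the leftover a union of chunks.\<close>
  have "h dvd card W" using hn unfolding cV by (metis dvd_add_left_iff dvd_triv_right)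
  then obtain k where k: "card W = k * h" by (metis dvd_def mult.commute)
  obtain ws where ws: "set ws = W" "distinct ws" using finite_distinct_list[OF finW] by blast
  have "length ws = k * h" using k ws distinct_card[OF ws(2)] by simp
  from split_into_chunks[OF this] obtain ts where ts: "concat ts = ws" "length ts = k" "\<forall>t\<in>set ts. length t = h"
    by blast
  have km: "k \<le> m"
  proof -
    have "card W \<le> card L" unfolding W_def using LV finV finite_subset by (intro card_mono) auto
    then have "k * h \<le> m * h" using small unfolding k by (simp only: mult.commute)
    then show ?thesis using h0 mult_le_cancel2[of k h m] by blast
  qed
  have "\<forall>t\<in>set ts. length ts \<le> card {i. i < length qs \<and> absorbs (fst (qs ! i)) t}"
  proof
    fix t assume t: "t \<in> set ts"
    obtain i where "i < length ts" "t = ts ! i" using t by (metis in_set_conv_nth)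
    then have "distinct t" using distinct_concat_nth[of ts i] ts(1) ws(2) by simp
    moreover have "set t \<subseteq> V" using t ts(1) ws(1) WV by (metis UN_upper dual_order.trans set_concat)
    ultimately have "t \<in> chunks" using ts(3) t by (simp add: chunks_def)
    then have "m \<le> hits qs t" by (rule hits)
    then show "length ts \<le> card {i. i < length qs \<and> absorbs (fst (qs ! i)) t}"
      using ts(2) km unfolding hits_def by (simp add: length_filter_conv_card)
  qed
  from assign_slots[OF this] obtain os where os: "length os = length qs"
    "\<forall>i<length qs. \<forall>t. os ! i = Some t \<longrightarrow> absorbs (fst (qs ! i)) t \<and> t \<in> set ts"
    "mset (concat (map olist os)) = mset (concat ts)" by blast
  let ?Z = "zip qs os"
  have "map (\<lambda>(q, ot). block q) ?Z = map block (map fst ?Z)" by auto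
  then have blockZ: "map (\<lambda>(q, ot). block q) ?Z = map block qs" using os(1) by (simp only: map_fst_zip)
  have "map (olist \<circ> snd) ?Z = map olist (map snd ?Z)" by simp
  then have snZ: "map (olist \<circ> snd) ?Z = map olist os" using os(1) by (simp only: map_snd_zip)
  have Z: "absorber (fst q) \<and> (\<forall>t. ot = Some t \<longrightarrow> absorbs (fst q) t \<and> t \<in> set ts) \<and> q \<in> set qs"
    if qo: "(q, ot) \<in> set ?Z" for q ot
  proof -
    obtain i where i: "i < length qs" "q = qs ! i" "ot = os ! i"
      using qo by (auto simp: set_zip)
    then show ?thesis using qs(3) os(2) by auto
  qed
  let ?mid = "concat (map (\<lambda>(q, ot). block_with q ot) ?Z)"
  let ?fs = "bs @ ?mid @ ?end"
  have "good (bs @ ?mid @ (?end @ [x, y]))"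
  proof (rule good_insert_all)
    show "\<forall>(q, ot)\<in>set ?Z. absorber (fst q) \<and> (\<forall>t. ot = Some t \<longrightarrow> absorbs (fst q) t)" using Z by blast
    show "good (bs @ concat (map (\<lambda>(q, ot). block q) ?Z) @ (?end @ [x, y]))" unfolding blockZ by (rule good)
  qed
  \<comment> \<open>The sequence still begins with the chunks \<open>x\<close> and \<open>y\<close>
    of \<open>bs\<close>, which were appended as the wrap-around.\<close>
  then have gf: "good (?fs @ take 2 ?fs)" by (simp add: bsxy)
  have "mset (concat ?mid) = mset (concat (concat (map block qs))) + mset ws"
    using mset_insert_all[of ?Z] unfolding blockZ snZ os(3) ts(1) .
  then have "mset (concat ?fs) = mset (concat ?cs @ ws)" by (simp add: add_ac)
  moreover have dall: "distinct (concat ?cs @ ws)" using dcs ws VW distinct_append[of "concat ?cs" ws] by blast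
  moreover have "set (concat ?cs @ ws) = V" unfolding set_append VW ws(1) using WV by blast
  ultimately have fs: "distinct (concat ?fs)" "verts ?fs = V"
    using mset_eq_imp_distinct_iff mset_eq_setD by blast+
  have lmid: "length d = h" if d: "d \<in> set ?mid" for d
  proof -
    obtain q ot where q: "(q, ot) \<in> set ?Z" "d \<in> set (block_with q ot)" using d by auto
    have lq: "\<forall>d\<in>set (block q). length d = h" using lcs Z[OF q(1)] by auto
    have "absorber (fst q)" using Z[OF q(1)] by blast
    then have "length (part_c (fst q)) = h" by (intro absorber_parts) (simp add: absorber_def)
    moreover have "length t = h" if "ot = Some t" for t using Z[OF q(1)] ts(3) that by blast
    ultimately show ?thesis using q(2) lq by (cases q; cases ot) auto
  qed
  have lf: "\<forall>d\<in>set ?fs. length d = h"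
  proof
    fix d assume "d \<in> set ?fs"
    then have "d \<in> set ?mid \<or> d \<in> set ?cs" unfolding set_append by blast
    then show "length d = h" using lmid lcs by blast
  qed
  have "3 \<le> length ?fs" unfolding length_append by simp
  then show ?thesis by (rule hamilton_cycle_of_good[OF lf _ fs gf])
qed

text \<open>All numerical requirements are collected as hypotheses. \<open>s0\<close> is the density
  guaranteed outside the absorbing path and \<open>s\<close> the one kept to the end; the difference
  pays for the growth of the potential.\<close>

lemma hamilton_cycle_exists:
  assumes hn: "h dvd card V" and D0: "codegree_ge V D0"
    and N: "N = l + h + h + h" and N': "N' = g + h + h"
    and ab: "D + real (6 * h * M + h + l) \<le> D0" "real (N + N' + h) \<le> D" "0 < \<alpha>"
      "\<alpha> * real (card V) ^ N \<le> (D - h - N) ^ N - 5 * (fillings * real (card V) ^ (l + h + h))"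
      "4 * (fillings * real (card V) ^ (g + h)) < (D - N - N') ^ N'"
    and hit: "real (card V) ^ h * (1 - \<alpha> / 2) ^ M < (1 / 2) ^ m" "Nmin + b \<le> h * m"
    and params: "0 < \<gamma>" "0 < \<epsilon>'" "\<epsilon>' \<le> 1" "0 \<le> \<delta>" "2 * \<delta> < \<epsilon>'" "2 \<le> K" "0 < \<epsilon>" "0 < \<eta>"
    and s: "s = 1 / (2 * real h) + \<gamma>" "s \<le> 1"
    and b: "b = h * (2 * t + 3)" "real t * (2 * real h * (1 + \<epsilon>')) + 3 * real h * K \<le> (1 + \<epsilon>) * real b"
    and \<beta>: "\<beta> = \<eta> * real b / (real Nmin - real b)" "\<beta> \<le> 1" "b < Nmin"
    and s0: "0 \<le> s0" "s0 * real (card V) + real (6 * h * M + h + l) \<le> D0"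
    and pot: "real (card V) ^ (l + h - 1) * exp (- \<eta> * s0) * (1 + \<epsilon> * \<beta> + \<beta>\<^sup>2) ^ (card V div b) < exp (- \<eta> * s)"
    and size: "Nmin + b + (6 * h * M + h + l) \<le> card V"
    and num: "\<And>N. Nmin \<le> N \<Longrightarrow> N \<le> card V \<Longrightarrow> extendable \<gamma> \<delta> s K t N"
    and close: "real N' \<le> s * real Nmin" "4 * (fillings * real (card V) ^ (g + h)) < (s * real Nmin - N') ^ N'"
  shows "\<exists>C. hamilton_kl_cycle (l + h) l V E C \<and> properly_colored C \<phi>"
proof -
  have h0: "0 < h" using h g_pos by simp
  have b0: "0 < b" using b(1) h0 by simp
  have Dpos: "0 < D" using ab(2) N l_pos by simp
  have "0 \<le> real (6 * h * M + h + l)" by (rule of_nat_0_le_iff)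
  then have "0 < D0" using Dpos ab(1) by linarith
  moreover have "l + h - 1 \<le> card V" using size by linarith
  ultimately obtain P0 where P0: "path P0" "length P0 = 2"
    using single_edge_path[OF D0] by blast
  obtain qs where qs: "length qs = M" "path (concat (map block qs) @ P0)" "\<forall>q\<in>set qs. absorber (fst q)"
    "(\<Sum>t\<in>chunks. (1 / 2) ^ hits qs t) \<le> real (card V) ^ h * (1 - \<alpha> / 2) ^ M"
    using absorbing_path[OF D0 ab(1) N N' ab(2,4,5,3) P0] by blast
  have hits: "m \<le> hits qs t" if t: "t \<in> chunks" for t
  proof -
    have "(1 / 2 :: real) ^ hits qs t \<le> (\<Sum>t\<in>chunks. (1 / 2) ^ hits qs t)"
      using chunks_finite t by (intro member_le_sum) auto
    \<comment> \<open>A single summand is at most the whole sum, which is below 2^(-m).\<close>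
    then have "(1 / 2 :: real) ^ hits qs t < (1 / 2) ^ m" using qs(4) hit(1) by linarith
    then show ?thesis by (simp add: power_strict_decreasing_iff)
  qed
  let ?P = "concat (map block qs) @ P0"
  let ?U = "6 * h * M + h + l"
  define L0 where "L0 = V - verts ?P"
  have "length (concat (map block qs)) = 6 * M"
    using length_concat_uniform[of "map block qs" 6] qs(1) by (simp add: length_block)
  then have "length ?P = 6 * M + 2" using P0 by simp
  then have "length (concat ?P) = (6 * M + 1) * h + l" using length_concat_path[OF qs(2)] by simp
  then have U: "card (verts ?P) \<le> ?U"
    using card_length[of "concat ?P"] by (simp add: algebra_simps del: concat_append set_concat)
  have PV: "verts ?P \<subseteq> V" using qs(2) by (simp add: path_def)
  have cL0: "card V - ?U \<le> card L0" unfolding L0_def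
    using card_Diff_subset[OF finite_subset[OF PV finV] PV] U by linarith
  have fL0: "finite L0" using finV by (simp add: L0_def)
  have L0V: "L0 \<subseteq> V" by (auto simp: L0_def)
  have cL0V: "card L0 \<le> card V" by (rule card_mono[OF finV L0V])
  have L0pos: "0 < card L0" using cL0 size b0 by linarith
  have cod0: "codegree_ge L0 (D0 - real ?U)"
    unfolding L0_def using U by (intro codegree_ge_Diff[OF D0]) (simp_all only: of_nat_le_iff finite_set)
  have "s0 * real (card L0) \<le> s0 * real (card V)" using s0(1) cL0V by (intro mult_left_mono) auto
  then have "s0 * real (card L0) \<le> D0 - real ?U" using s0(2) by linarith
  then have "codegree_ge L0 (s0 * real (card L0))" by (rule codegree_ge_mono[OF cod0])
  then have pot0: "potential \<eta> L0 \<le> real (card V) ^ (l + h - 1) * exp (- \<eta> * s0)"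
    using params(8) L0pos by (intro codegree_potential) auto
  \<comment> \<open>As many rounds as possible while \<open>Nmin\<close> vertices remain, so fewer
    than \<open>Nmin + b\<close> are left, which is within the capacity \<open>h * m\<close> of the
    absorbers.\<close>
  define I where "I = (card L0 - Nmin) div b"
  have NL: "Nmin + b \<le> card L0" using cL0 size by linarith
  have I1: "1 \<le> I" unfolding I_def using NL b0 by (simp add: less_eq_div_iff_mult_less_eq)
  have "I * b \<le> card L0 - Nmin" unfolding I_def by (rule div_times_less_eq_dividend)
  then have sizeI: "Nmin + I * b \<le> card L0" using NL by linarith
  have Iup: "card L0 - I * b < Nmin + b"
  proof -
    have "card L0 - Nmin < I * b + b" unfolding I_def using b0 by (metis add.commute dividend_less_div_times mult.commute)
    then show ?thesis using NL b0 by linarith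
  qed
  have Ib: "I \<le> card V div b" unfolding I_def using cL0V by (intro div_le_mono) simp
  have \<beta>0: "0 \<le> \<beta>" unfolding \<beta>(1) using params \<beta>(3) by simp
  have "(1 + \<epsilon> * \<beta> + \<beta>\<^sup>2) ^ I \<le> (1 + \<epsilon> * \<beta> + \<beta>\<^sup>2) ^ (card V div b)"
    using \<beta>0 params by (intro power_increasing Ib) simp
  then have "potential \<eta> L0 * (1 + \<epsilon> * \<beta> + \<beta>\<^sup>2) ^ I \<le>
      real (card V) ^ (l + h - 1) * exp (- \<eta> * s0) * (1 + \<epsilon> * \<beta> + \<beta>\<^sup>2) ^ (card V div b)"
    using pot0 \<beta>0 params by (intro mult_mono) auto
  then have potI: "potential \<eta> L0 * (1 + \<epsilon> * \<beta> + \<beta>\<^sup>2) ^ I < exp (- \<eta> * s)" using pot by linarith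
  obtain bs where bs: "path (bs @ ?P)" "length bs = I * (2 * t + 3)" "\<forall>d\<in>set bs. length d = h"
    "verts bs \<subseteq> L0" "codegree_ge (L0 - verts bs) (s * real (card (L0 - verts bs)))"
    using long_path[OF qs(2) L0_def params s b \<beta> potI sizeI num] by blast
  define L where "L = L0 - verts bs"
  have Leq: "L = V - verts (bs @ ?P)" by (auto simp: L_def L0_def)
  have dbs: "distinct (concat bs)" using bs(1) by (simp add: path_def)
  have "card (verts bs) = I * b"
    using distinct_card[OF dbs] length_concat_uniform[OF bs(3)] bs(2) b(1) by (simp add: mult_ac del: set_concat)
  then have cL: "card L = card L0 - I * b" unfolding L_def using card_Diff_subset[OF _ bs(4)] by simp
  have Lmin: "Nmin \<le> card L" using cL sizeI by linarith
  have "0 \<le> s" using s params by simp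
  then have "s * real Nmin \<le> s * real (card L)" using Lmin by (intro mult_left_mono) auto
  then have cod: "codegree_ge L (s * real Nmin)"
    using codegree_ge_mono[OF bs(5)] by (simp add: L_def)
  have "1 * (2 * t + 3) \<le> length bs" unfolding bs(2) by (rule mult_le_mono1[OF I1])
  then have lb: "2 \<le> length bs" by simp
  have small: "card L \<le> h * m" using cL Iup hit(2) by linarith
  show ?thesis
    by (rule close_path[OF bs(1) P0(2) qs(3) lb hn Leq cod N' close(1,2) hits small])
qed

subsection \<open>Choice of the constants\<close>

text \<open>\<mu> * n blocks of 6 * h vertices occupy \<gamma> / 8 * n vertices. \<omega> is chosen
  such that \<alpha> * \<mu> / 2 = 4 * \<omega>, so \<mu> * n absorbers suffice for \<omega> * n
  hits per chunk. \<alpha> keeps half of the frames; the condition on \<open>c\<close> gives the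
  other half to colour clashes. \<epsilon> and \<kappa> are matched to give \<beta> \<le>
  \<epsilon>, and \<theta> is about the proportion of ordered edges that \<open>exists_fans\<close>
  provides.\<close>

lemma hamilton_cycle_large:
  fixes x \<sigma> \<gamma> \<alpha> \<mu> \<omega> \<epsilon> \<kappa> \<theta> :: real and t b :: nat
  assumes hn: "h dvd card V" and x: "x = real (card V)" "1 \<le> x"
    and \<sigma>: "\<sigma> = 1 / (2 * real h)" and \<gamma>: "0 < \<gamma>" "\<gamma> \<le> 1 / 2" and cod: "codegree_ge V ((\<sigma> + \<gamma>) * x)"
    and \<alpha>: "\<alpha> = (\<sigma> / 2) ^ (l + h + h + h) / 2" and \<mu>: "\<mu> = \<gamma> / (48 * real h)" and \<omega>: "\<omega> = \<alpha> * \<mu> / 8"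
    and \<epsilon>: "\<epsilon> = \<gamma> * \<omega> / 32" and t: "12 * real h \<le> \<epsilon> * real t" and b: "b = h * (2 * t + 3)"
    and \<kappa>: "\<kappa> = \<gamma> * \<omega>\<^sup>2 / (64 * real b)"
    and \<theta>: "\<theta> = (\<epsilon> * \<omega> / 32) ^ (l + h - 1) * (\<gamma> * \<omega> / 16)"
    and c: "10 * (real h ^ h * c) \<le> (\<sigma> / 2) ^ (l + h + h + h)"
      "8 * (real h ^ h * c) \<le> (\<sigma> * \<omega> / 8) ^ (g + h + h)" "2 * (real h ^ h * c) \<le> \<theta>"
    and large: "real (h + l) \<le> \<gamma> / 8 * x" "real (2 * (l + h + h + h) + 2 * (g + h + h) + 2 * h) \<le> \<sigma> * x"
      "real h * ln x + 1 < 3 * \<omega> * x" "real (2 * b + 2) \<le> \<omega> * x"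
      "real (l + h) * ln x < \<kappa> * \<gamma> / 8 * x" "real b \<le> 1 / 8 * x"
      "real (l + (g + h + h)) \<le> \<sigma> * \<omega> / 8 * x" "real (l + h + 1) \<le> \<epsilon> * \<omega> / 32 * x"
      "real (h * h * (3 + 2 * t)) < \<theta> / 2 * x"
  shows "\<exists>C. hamilton_kl_cycle (l + h) l V E C \<and> properly_colored C \<phi>"
proof -
  let ?N = "l + h + h + h" and ?N' = "g + h + h"
  have h2: "2 \<le> h" using h l_pos g_pos by simp
  have \<sigma>0: "0 < \<sigma>" "\<sigma> \<le> 1 / 4" using h2 by (auto simp: \<sigma> field_simps)
  have \<alpha>0: "0 < \<alpha>" "\<alpha> \<le> 1 / 2"
  proof -
    show "0 < \<alpha>" using \<sigma>0 by (simp add: \<alpha>)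
    have "(\<sigma> / 2) ^ ?N \<le> 1" using \<sigma>0 by (intro power_le_one) auto
    then show "\<alpha> \<le> 1 / 2" by (simp add: \<alpha>)
  qed
  have \<mu>0: "0 < \<mu>" "\<mu> \<le> 1" using \<gamma> h2 by (auto simp: \<mu> field_simps)
  have \<omega>0: "0 < \<omega>" "\<omega> \<le> 1 / 8"
  proof -
    show "0 < \<omega>" using \<alpha>0 \<mu>0 by (simp add: \<omega>)
    have "\<alpha> * \<mu> \<le> 1 * 1" using \<alpha>0 \<mu>0 by (intro mult_mono) auto
    then show "\<omega> \<le> 1 / 8" by (simp add: \<omega>)
  qed
  have \<epsilon>0: "0 < \<epsilon>" "\<epsilon> \<le> 1"
  proof -
    show "0 < \<epsilon>" using \<gamma> \<omega>0 by (simp add: \<epsilon>)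
    have "\<gamma> * \<omega> \<le> 1 * 1" using \<gamma> \<omega>0 by (intro mult_mono) auto
    then show "\<epsilon> \<le> 1" by (simp add: \<epsilon>)
  qed
  have b0: "0 < b" using b h2 by simp
  have \<kappa>0: "0 < \<kappa>" using \<gamma> \<omega>0 b0 by (simp add: \<kappa>)
  have x0: "0 < x" using x by simp
  have fill: "fillings = real h ^ h * c * x ^ h" by (simp add: fillings_def x)
  have conn: "4 * (fillings * x ^ (g + h)) < X ^ ?N'" if X: "\<sigma> * \<omega> / 8 * x \<le> X" for X
  proof -
    have q: "0 < (\<sigma> * \<omega> / 8 * x) ^ ?N'" using \<sigma>0 \<omega>0 x0 by simp
    have "4 * (fillings * x ^ (g + h)) = 4 * (real h ^ h * c) * x ^ ?N'"
      by (simp add: fill power_add mult_ac)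
    also have "\<dots> \<le> (\<sigma> * \<omega> / 8) ^ ?N' / 2 * x ^ ?N'"
      using c(2) x0 by (intro mult_right_mono) auto
    also have "\<dots> = (\<sigma> * \<omega> / 8 * x) ^ ?N' / 2" unfolding power_mult_distrib[of _ x] by simp
    also have "\<dots> < (\<sigma> * \<omega> / 8 * x) ^ ?N'" using q by simp
    also have "\<dots> \<le> X ^ ?N'" using X \<sigma>0 \<omega>0 x0 by (intro power_mono) auto
    finally show ?thesis .
  qed
  have \<sigma>\<omega>: "\<sigma> * \<omega> \<le> \<sigma> / 8" using mult_left_mono[OF \<omega>0(2), of \<sigma>] \<sigma>0 by simp
  define M where "M = nat \<lfloor>\<mu> * x\<rfloor>"
  define m where "m = nat \<lfloor>\<omega> * x\<rfloor>"
  have M: "real M \<le> \<mu> * x" "\<mu> * x - 1 < real M"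
    unfolding M_def using \<mu>0 x0 by (auto simp: of_nat_nat)
  have m: "real m \<le> \<omega> * x" "\<omega> * x - 1 < real m"
    unfolding m_def using \<omega>0 x0 by (auto simp: of_nat_nat)
  have mb: "\<omega> * x / 2 \<le> real m - real b" "\<omega> * x / 2 \<le> real m" using m(2) large(4) by simp_all
  have \<omega>x: "0 < \<omega> * x" using \<omega>0 x0 by simp
  have bm: "b < m" using mb(1) \<omega>x by linarith
  \<comment> \<open>Half of the bound is for the blocks, by the choice of \<mu>, and half for the
    two lists of the initial edge.\<close>
  have U: "real (6 * h * M + h + l) \<le> \<gamma> / 4 * x"
  proof -
    have "6 * real h * real M \<le> 6 * real h * (\<mu> * x)" using M by (intro mult_left_mono) auto
    also have "\<dots> = \<gamma> / 8 * x" using h2 by (simp add: \<mu>)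
    finally show ?thesis using large(1) by simp
  qed
  define \<beta> where "\<beta> = \<kappa> * x * real b / (real m - real b)"
  have \<beta>: "0 \<le> \<beta>" "\<beta> \<le> \<epsilon>"
  proof -
    show "0 \<le> \<beta>" unfolding \<beta>_def using \<kappa>0 x0 bm by simp
    have "\<beta> \<le> \<kappa> * x * real b / (\<omega> * x / 2)"
      unfolding \<beta>_def using mb(1) \<omega>x \<kappa>0 x0 by (intro divide_left_mono mult_pos_pos) auto
    \<comment> \<open>This equation determines \<kappa>: 2 * \<kappa> * b / \<omega> = \<gamma> *
      \<omega> / 32.\<close>
    also have "\<dots> = \<epsilon>" using x0 \<omega>0 b0 by (simp add: \<kappa> \<epsilon> field_simps power2_eq_square)
    finally show "\<beta> \<le> \<epsilon>" .
  qed
  have Dx: "\<sigma> / 2 * x \<le> \<sigma> * x - real h - real ?N" "\<sigma> / 2 * x \<le> \<sigma> * x - real ?N - real ?N'"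
    "real (?N + ?N' + h) \<le> \<sigma> * x"
    using large(2) by simp_all
  show ?thesis
  \<comment> \<open>Budget of the excess density \<gamma>: one quarter for the absorbing path, one
    quarter for the potential, and \<gamma> / 2 remains for light neighbours. With K = 4 * h the
    heavy vertices take half of the density \<sigma> from a connection.\<close>
  proof (rule hamilton_cycle_exists[OF hn cod refl refl, where D = "\<sigma> * x" and M = M and \<alpha> = \<alpha> and m = m
        and Nmin = m and b = b and \<gamma> = "\<gamma> / 2" and \<epsilon>' = "\<epsilon> / 2" and \<delta> = "\<epsilon> / 8" and K = "4 * real h"
        and \<epsilon> = \<epsilon> and \<eta> = "\<kappa> * x" and s = "\<sigma> + \<gamma> / 2" and t = t and \<beta> = \<beta> and ?s0.0 = "\<sigma> + 3 / 4 * \<gamma>"])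
    have "0 < \<gamma> * x" using \<gamma> x0 by simp
    then show "\<sigma> * x + real (6 * h * M + h + l) \<le> (\<sigma> + \<gamma>) * x" using U by (simp add: algebra_simps)
    show "real (?N + ?N' + h) \<le> \<sigma> * x" by (rule Dx)
    show "0 < \<alpha>" by (rule \<alpha>0)
    show "\<alpha> * real (card V) ^ ?N \<le> (\<sigma> * x - real h - real ?N) ^ ?N - 5 * (fillings * real (card V) ^ (l + h + h))"
    proof -
      have "(\<sigma> / 2 * x) ^ ?N \<le> (\<sigma> * x - real h - real ?N) ^ ?N"
        using Dx(1) \<sigma>0 x0 by (intro power_mono) auto
      moreover have "(\<sigma> / 2 * x) ^ ?N = (\<sigma> / 2) ^ ?N * x ^ ?N" by (rule power_mult_distrib)
      moreover have "5 * (fillings * x ^ (l + h + h)) = 5 * (real h ^ h * c) * x ^ ?N"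
        by (simp add: fill power_add mult_ac)
      moreover have "5 * (real h ^ h * c) * x ^ ?N \<le> (\<sigma> / 2) ^ ?N / 2 * x ^ ?N"
        using c(1) x0 by (intro mult_right_mono) auto
      ultimately show ?thesis unfolding x(1)[symmetric] \<alpha> by simp
    qed
    show "4 * (fillings * real (card V) ^ (g + h)) < (\<sigma> * x - real ?N - real ?N') ^ ?N'"
      unfolding x(1)[symmetric]
    proof (rule conn)
      have "\<sigma> * \<omega> / 8 * x \<le> \<sigma> / 2 * x" using \<sigma>\<omega> \<sigma>0 x0 by (intro mult_right_mono) auto
      then show "\<sigma> * \<omega> / 8 * x \<le> \<sigma> * x - real ?N - real ?N'" using Dx(2) by linarith
    qed
    show "real (card V) ^ h * (1 - \<alpha> / 2) ^ M < (1 / 2) ^ m"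
      unfolding x(1)[symmetric]
    proof -
      have "(1 - \<alpha> / 2) ^ M \<le> exp (- (\<alpha> / 2)) ^ M"
        using exp_ge_add_one_self[of "- (\<alpha> / 2)"] \<alpha>0 by (intro power_mono) auto
      also have "\<dots> = exp (- (\<alpha> / 2) * real M)" by (simp add: exp_of_nat_mult[symmetric] mult.commute)
      finally have 1: "(1 - \<alpha> / 2) ^ M \<le> exp (- (\<alpha> / 2) * real M)" .
      have 2: "x ^ h = exp (real h * ln x)" using x0 by (simp add: exp_of_nat_mult)
      have "x ^ h * (1 - \<alpha> / 2) ^ M \<le> exp (real h * ln x) * exp (- (\<alpha> / 2) * real M)"
        unfolding 2 using 1 by (intro mult_left_mono) auto
      also have "\<dots> = exp (real h * ln x - (\<alpha> / 2) * real M)" by (simp add: mult_exp_exp)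
      also have "\<dots> < exp (- real m)"
      proof -
        have "(\<alpha> / 2) * (\<mu> * x - 1) \<le> (\<alpha> / 2) * real M" using M(2) \<alpha>0 by (intro mult_left_mono) auto
        moreover have "(\<alpha> / 2) * (\<mu> * x - 1) = 4 * \<omega> * x - \<alpha> / 2" by (simp add: \<omega> field_simps)
        ultimately have "real h * ln x - (\<alpha> / 2) * real M < - real m"
          using large(3) m(1) \<alpha>0(2) by linarith
        then show ?thesis by (simp only: exp_less_cancel_iff)
      qed
      also have "exp (- real m) = exp (- 1) ^ m" by (simp add: exp_of_nat_mult[symmetric])
      also have "\<dots> \<le> (1 / 2) ^ m"
      proof (rule power_mono)
        have "2 \<le> exp (1::real)" using exp_ge_add_one_self[of 1] by simp
        then show "exp (- 1 :: real) \<le> 1 / 2" by (simp add: exp_minus field_simps)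
      qed simp
      finally show "x ^ h * (1 - \<alpha> / 2) ^ M < (1 / 2) ^ m" .
    qed
    \<comment> \<open>One number \<open>m\<close> serves both as the hits per chunk and as the
      minimal remainder, since \<open>h\<close> is at least 2 and \<open>b < m\<close>.\<close>
    show "m + b \<le> h * m"
    proof -
      have "2 * m \<le> h * m" using h2 by simp
      then show ?thesis using bm by linarith
    qed
    show "0 < \<gamma> / 2" "0 < \<epsilon> / 2" "\<epsilon> / 2 \<le> 1" "0 \<le> \<epsilon> / 8" "2 * (\<epsilon> / 8) < \<epsilon> / 2" "2 \<le> 4 * real h" "0 < \<epsilon>"
      "0 < \<kappa> * x" using \<gamma> \<epsilon>0 h2 \<kappa>0 x0 by simp_all
    show "\<sigma> + \<gamma> / 2 = 1 / (2 * real h) + \<gamma> / 2" by (simp add: \<sigma>)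
    show "\<sigma> + \<gamma> / 2 \<le> 1" using \<sigma>0 \<gamma> by simp
    show "b = h * (2 * t + 3)" by (rule b)
    \<comment> \<open>The pairs spend only half of \<epsilon>; the other half,
      \<open>h * \<epsilon> * t\<close>, pays for the connection, and this is why \<open>t\<close>
      has to be at least 12 * h / \<epsilon>.\<close>
    show "real t * (2 * real h * (1 + \<epsilon> / 2)) + 3 * real h * (4 * real h) \<le> (1 + \<epsilon>) * real b"
    proof -
      have "real h * (12 * real h) \<le> real h * (\<epsilon> * real t)" using t by (intro mult_left_mono) auto
      moreover have "0 \<le> 3 * real h * (1 + \<epsilon>)" using \<epsilon>0 by simp
      moreover have "(1 + \<epsilon>) * real b = real t * (2 * real h * (1 + \<epsilon> / 2)) + real h * (\<epsilon> * real t) + 3 * real h * (1 + \<epsilon>)"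
        by (simp add: b algebra_simps)
      ultimately show ?thesis by linarith
    qed
    show "\<beta> = \<kappa> * x * real b / (real m - real b)" by (rule \<beta>_def)
    show "\<beta> \<le> 1" using \<beta> \<epsilon>0 by simp
    show "b < m" by (rule bm)
    show "0 \<le> \<sigma> + 3 / 4 * \<gamma>" using \<sigma>0 \<gamma> by simp
    show "(\<sigma> + 3 / 4 * \<gamma>) * real (card V) + real (6 * h * M + h + l) \<le> (\<sigma> + \<gamma>) * x"
      using U unfolding x(1)[symmetric] by (simp add: algebra_simps)
    show "real (card V) ^ (l + h - 1) * exp (- (\<kappa> * x) * (\<sigma> + 3 / 4 * \<gamma>)) * (1 + \<epsilon> * \<beta> + \<beta>\<^sup>2) ^ (card V div b)
        < exp (- (\<kappa> * x) * (\<sigma> + \<gamma> / 2))"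
      unfolding x(1)[symmetric]
    proof -
      let ?y = "\<epsilon> * \<beta> + \<beta>\<^sup>2" and ?j = "card V div b"
      have y: "0 \<le> ?y" "?y \<le> 2 * \<epsilon>\<^sup>2"
      proof -
        show "0 \<le> ?y" using \<beta> \<epsilon>0 by simp
        have "\<epsilon> * \<beta> \<le> \<epsilon> * \<epsilon>" "\<beta>\<^sup>2 \<le> \<epsilon>\<^sup>2" using \<beta> \<epsilon>0 by (auto intro!: mult_left_mono power_mono)
        then show "?y \<le> 2 * \<epsilon>\<^sup>2" by (simp add: power2_eq_square)
      qed
      have "real ?j \<le> x / real b" unfolding x(1) by (rule of_nat_div_le_of_nat)
      then have "real ?j * ?y \<le> x / real b * (2 * \<epsilon>\<^sup>2)" using y x0 b0 by (intro mult_mono) auto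
      \<comment> \<open>All rounds together cost half of the available exponent \<kappa> * \<gamma>
        / 4 * x; the other half absorbs the power of n from the number of ridges.\<close>
      also have "\<dots> = \<kappa> * \<gamma> / 8 * x" using b0 by (simp add: \<kappa> \<epsilon> field_simps power2_eq_square)
      finally have jy: "real ?j * ?y \<le> \<kappa> * \<gamma> / 8 * x" .
      have "(1 + ?y) ^ ?j \<le> exp ?y ^ ?j" using y exp_ge_add_one_self[of ?y] by (intro power_mono) auto
      also have "\<dots> = exp (real ?j * ?y)" by (simp add: exp_of_nat_mult)
      also have "\<dots> \<le> exp (\<kappa> * \<gamma> / 8 * x)" using jy by simp
      finally have 1: "(1 + \<epsilon> * \<beta> + \<beta>\<^sup>2) ^ ?j \<le> exp (\<kappa> * \<gamma> / 8 * x)" by (simp add: add.assoc)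
      have "x ^ (l + h - 1) \<le> x ^ (l + h)" using x(2) by (intro power_increasing) auto
      also have "\<dots> = exp (real (l + h) * ln x)" using x0 by (simp only: exp_of_nat_mult exp_ln)
      also have "\<dots> < exp (\<kappa> * \<gamma> / 8 * x)" using large(5) by (simp only: exp_less_cancel_iff)
      finally have 2: "x ^ (l + h - 1) < exp (\<kappa> * \<gamma> / 8 * x)" .
      have "x ^ (l + h - 1) * exp (- (\<kappa> * x) * (\<sigma> + 3 / 4 * \<gamma>)) * (1 + \<epsilon> * \<beta> + \<beta>\<^sup>2) ^ ?j
        \<le> x ^ (l + h - 1) * exp (- (\<kappa> * x) * (\<sigma> + 3 / 4 * \<gamma>)) * exp (\<kappa> * \<gamma> / 8 * x)"
        using 1 x0 by (intro mult_left_mono) auto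
      also have "\<dots> < exp (\<kappa> * \<gamma> / 8 * x) * exp (- (\<kappa> * x) * (\<sigma> + 3 / 4 * \<gamma>)) * exp (\<kappa> * \<gamma> / 8 * x)"
        using 2 by simp
      also have "\<dots> = exp (\<kappa> * \<gamma> / 8 * x + - (\<kappa> * x) * (\<sigma> + 3 / 4 * \<gamma>) + \<kappa> * \<gamma> / 8 * x)"
        by (simp only: exp_add)
      also have "\<kappa> * \<gamma> / 8 * x + - (\<kappa> * x) * (\<sigma> + 3 / 4 * \<gamma>) + \<kappa> * \<gamma> / 8 * x = - (\<kappa> * x) * (\<sigma> + \<gamma> / 2)"
        by (simp add: algebra_simps)
      finally show "x ^ (l + h - 1) * exp (- (\<kappa> * x) * (\<sigma> + 3 / 4 * \<gamma>)) * (1 + \<epsilon> * \<beta> + \<beta>\<^sup>2) ^ ?j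
        < exp (- (\<kappa> * x) * (\<sigma> + \<gamma> / 2))" .
    qed
    show "m + b + (6 * h * M + h + l) \<le> card V"
    proof -
      have "\<omega> * x \<le> 1 / 8 * x" using \<omega>0 x0 by (intro mult_right_mono) auto
      moreover have "\<gamma> / 4 * x \<le> 1 / 8 * x" using \<gamma> x0 by (intro mult_right_mono) auto
      ultimately have "real m + real b + real (6 * h * M + h + l) \<le> x" using m(1) large(6) U x0 by linarith
      then have "real (m + b + (6 * h * M + h + l)) \<le> real (card V)" by (simp add: x(1))
      then show ?thesis by (simp only: of_nat_le_iff)
    qed
    show "real ?N' \<le> (\<sigma> + \<gamma> / 2) * real m"
      and "4 * (fillings * real (card V) ^ (g + h)) < ((\<sigma> + \<gamma> / 2) * real m - real ?N') ^ ?N'"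
    proof -
      have "\<sigma> * (\<omega> * x / 2) \<le> (\<sigma> + \<gamma> / 2) * real m" using mb(2) \<sigma>0 \<gamma> \<omega>x by (intro mult_mono) auto
      moreover have "0 < \<sigma> * \<omega> / 8 * x" using \<sigma>0 \<omega>0 x0 by simp
      moreover have "\<sigma> * (\<omega> * x / 2) = 4 * (\<sigma> * \<omega> / 8 * x)" by simp
      moreover have "real ?N' \<le> \<sigma> * \<omega> / 8 * x" using large(7) by simp
      ultimately have 1: "\<sigma> * \<omega> / 8 * x \<le> (\<sigma> + \<gamma> / 2) * real m - real ?N'" "real ?N' \<le> (\<sigma> + \<gamma> / 2) * real m"
        by linarith+
      show "real ?N' \<le> (\<sigma> + \<gamma> / 2) * real m" by (rule 1)
      show "4 * (fillings * real (card V) ^ (g + h)) < ((\<sigma> + \<gamma> / 2) * real m - real ?N') ^ ?N'"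
        unfolding x(1)[symmetric] by (rule conn[OF 1(1)])
    qed
    fix n assume n: "m \<le> n" "n \<le> card V"
    have nx: "\<omega> * x / 2 \<le> real n" "real n \<le> x" using n mb(2) by (auto simp: x(1))
    define a where "a = nat \<lfloor>\<epsilon> / 8 * real n\<rfloor>"
    have a: "real a \<le> \<epsilon> / 8 * real n" "\<epsilon> / 8 * real n - 1 < real a"
    proof -
      show "real a \<le> \<epsilon> / 8 * real n" unfolding a_def using \<epsilon>0 by (intro of_nat_floor) simp
      have "\<epsilon> / 8 * real n < real_of_int (\<lfloor>\<epsilon> / 8 * real n\<rfloor> + 1)"
        using floor_correct[of "\<epsilon> / 8 * real n"] by simp
      also have "real_of_int (\<lfloor>\<epsilon> / 8 * real n\<rfloor> + 1) \<le> real a + 1"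
        unfolding a_def by (simp add: of_nat_nat)
      finally show "\<epsilon> / 8 * real n - 1 < real a" by simp
    qed
    have "\<epsilon> / 8 * (\<omega> * x / 2) \<le> \<epsilon> / 8 * real n" using nx \<epsilon>0 by (intro mult_left_mono) auto
    then have a2: "\<epsilon> * \<omega> / 32 * x \<le> real a - real (l + h)" using a(2) large(8) by simp
    have pos: "0 < \<epsilon> * \<omega> / 32 * x" using \<epsilon>0 \<omega>0 x0 by simp
    define D where "D = (\<sigma> + \<gamma> / 2) * real n - (real n / (4 * real h) + real l)"
    have D: "\<sigma> * \<omega> / 8 * x \<le> D - real ?N'"
    proof -
      have "real n / (4 * real h) = \<sigma> / 2 * real n" by (simp add: \<sigma>)
      moreover have "0 \<le> \<gamma> / 2 * real n" using \<gamma> by simp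
      moreover have "\<sigma> / 2 * (\<omega> * x / 2) \<le> \<sigma> / 2 * real n" using nx \<sigma>0 by (intro mult_left_mono) auto
      moreover have "\<sigma> / 2 * (\<omega> * x / 2) = 2 * (\<sigma> * \<omega> / 8 * x)" by simp
      ultimately show ?thesis using large(7) unfolding D_def by (simp add: algebra_simps)
    qed
    have pos2: "0 < \<sigma> * \<omega> / 8 * x" using \<sigma>0 \<omega>0 x0 by simp
    have \<theta>0: "0 < \<theta>" using \<epsilon>0 \<omega>0 \<gamma> by (simp add: \<theta>)
    show "extendable (\<gamma> / 2) (\<epsilon> / 8) (\<sigma> + \<gamma> / 2) (4 * real h) t n"
      unfolding extendable_def x(1)[symmetric]
    \<comment> \<open>\<theta> is scaled by x^h because a fan fixes \<open>l\<close> of the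
      \<open>l + h\<close> vertices of an edge. Rounding and the vertices already used are covered
      by the drop from \<epsilon> * \<omega> / 16 to \<epsilon> * \<omega> / 32 in
      \<open>a2\<close>.\<close>
    proof (rule exI[of _ a], rule exI[of _ "\<theta> * x ^ h"], rule exI[of _ D], intro conjI)
      have "real (l + h) \<le> real a" using a2 pos by linarith
      then show "l + h \<le> a" by (simp only: of_nat_le_iff)
      show "real a \<le> \<epsilon> / 8 * real n" by (rule a)
      show "D = (\<sigma> + \<gamma> / 2) * real n - (real n / (4 * real h) + real l)" by (rule D_def)
      show "real ?N' \<le> D" using D pos2 by linarith
      show "4 * (fillings * x ^ (g + h)) < (D - real ?N') ^ ?N'" by (rule conn[OF D])
      show "0 \<le> \<theta> * x ^ h" using \<theta>0 x0 by simp
      show "2 * (\<theta> * x ^ h) * real n ^ l < (real a - real (l + h)) ^ (l + h - 1) * (\<gamma> / 2 * real n)"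
      proof -
        have e: "l + h = Suc (l + h - 1)" using h2 by simp
        have "2 * (\<theta> * x ^ h) * real n ^ l \<le> 2 * (\<theta> * x ^ h) * x ^ l"
          using nx \<theta>0 x0 by (intro mult_left_mono power_mono) auto
        also have "\<dots> = 2 * \<theta> * x ^ (l + h)" by (simp add: power_add mult_ac)
        also have "x ^ (l + h) = x ^ (l + h - 1) * x" by (subst e) simp
        also have "2 * \<theta> * (x ^ (l + h - 1) * x) = (\<epsilon> * \<omega> / 32 * x) ^ (l + h - 1) * (\<gamma> * \<omega> / 8 * x)"
          unfolding \<theta> power_mult_distrib[of _ x] by simp
        also have "\<dots> < (\<epsilon> * \<omega> / 32 * x) ^ (l + h - 1) * (\<gamma> / 2 * (\<omega> * x / 2))"
          using pos \<gamma> \<omega>x by (intro mult_strict_left_mono) (auto intro: zero_less_power)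
        also have "\<dots> \<le> (real a - real (l + h)) ^ (l + h - 1) * (\<gamma> / 2 * real n)"
          using a2 pos nx \<gamma> \<omega>x by (intro mult_mono power_mono mult_left_mono) auto
        finally show ?thesis .
      qed
      show "\<theta> * x ^ h > fillings + real h * real (h * (3 + 2 * t)) * x ^ (h - 1)"
      proof -
        have e: "h = Suc (h - 1)" using h2 by simp
        have "fillings \<le> \<theta> / 2 * x ^ h" unfolding fill using c(3) x0 by (intro mult_right_mono) auto
        moreover have "real h * real (h * (3 + 2 * t)) * x ^ (h - 1) < \<theta> / 2 * x * x ^ (h - 1)"
          using large(9) x0 by (intro mult_strict_right_mono) (simp_all add: algebra_simps)
        moreover have "x ^ h = x * x ^ (h - 1)" by (subst e) simp
        ultimately show ?thesis by simp
      qed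
    qed
  qed
qed

end

section \<open>Thresholds for n and the passage from degrees of the hypergraph to the locale\<close>

lemma eventually_log_less_linear:
  fixes A B C :: real
  assumes "0 < B"
  shows "\<forall>\<^sub>F n in sequentially. A * ln (real n) + C < B * real n"
proof -
  have "((\<lambda>n. A * (ln (real n) / real n) + C * (1 / real n)) \<longlongrightarrow> A * 0 + C * 0) sequentially"
    by (intro tendsto_intros filterlim_compose[OF ln_x_over_x_tendsto_0 filterlim_real_sequentially] lim_1_over_n)
  then have "\<forall>\<^sub>F n in sequentially. A * (ln (real n) / real n) + C * (1 / real n) < B"
    using assms by (intro order_tendstoD(2)) auto
  then show ?thesis using eventually_gt_at_top[of 0]
    by eventually_elim (simp add: field_simps)
qed

text \<open>The edges through a (k - 1)-set correspond to its neighbours; uniformity keeps a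
  neighbour from lying in the set itself.\<close>

lemma card_edges_through:
  assumes "k_graph k V E" "S \<subseteq> V" "card S = k - 1" "1 \<le> k"
  shows "hdeg E S = card {x\<in>V. insert x S \<in> E}"
proof -
  have finS: "finite S" using assms(1,2) finite_subset by (auto simp: k_graph_def)
  have *: "x \<notin> S" if "insert x S \<in> E" for x
  proof
    assume "x \<in> S"
    then have "card S = k" using that assms(1) by (simp add: k_graph_def insert_absorb)
    then show False using assms(3,4) by linarith
  qed
  have "bij_betw (\<lambda>x. insert x S) {x\<in>V. insert x S \<in> E} {e\<in>E. S \<subseteq> e}"
  proof (rule bij_betw_imageI)
    show "inj_on (\<lambda>x. insert x S) {x\<in>V. insert x S \<in> E}" using * by (auto simp: inj_on_def)
    show "(\<lambda>x. insert x S) ` {x\<in>V. insert x S \<in> E} = {e\<in>E. S \<subseteq> e}"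
    proof (intro equalityI subsetI)
      fix e assume "e \<in> {e\<in>E. S \<subseteq> e}"
      then have e: "e \<in> E" "S \<subseteq> e" by auto
      then have "e \<subseteq> V" "card e = k" using assms(1) by (auto simp: k_graph_def)
      then have "card (e - S) = 1" using e(2) finS assms(3,4) by (simp add: card_Diff_subset)
      then obtain x where x: "e - S = {x}" by (auto simp: card_1_singleton_iff)
      then have "e = insert x S" using e(2) by auto
      then show "e \<in> (\<lambda>x. insert x S) ` {x\<in>V. insert x S \<in> E}" using e \<open>e \<subseteq> V\<close> by auto
    qed auto
  qed
  then show ?thesis unfolding hdeg_def by (simp add: bij_betw_same_card)
qed

lemma hdeg_bounds:
  assumes "finite V" "S \<subseteq> V" "card S = s"
  shows "min_hdeg s V E \<le> hdeg E S" "hdeg E S \<le> max_hdeg s V E"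
proof -
  have "{hdeg E S | S. S \<subseteq> V \<and> card S = s} \<subseteq> hdeg E ` Pow V" by auto
  then have "finite {hdeg E S | S. S \<subseteq> V \<and> card S = s}" using assms(1) finite_subset by blast
  then show "min_hdeg s V E \<le> hdeg E S" "hdeg E S \<le> max_hdeg s V E"
    unfolding min_hdeg_def max_hdeg_def using assms(2,3) by (auto intro!: Min_le Max_ge)
qed

theorem theorem1p3:
  fixes k l :: nat and \<gamma> :: real
  assumes "k \<ge> 3" and "1 \<le> l" and "real l < real k / 2" and "\<gamma> > 0"
  shows "\<exists>c::real. c > 0 \<and> (\<exists>n0::nat. n0 > 0 \<and>
    (\<forall>(V :: 'a set) (E :: 'a set set) (\<phi> :: 'a set \<Rightarrow> nat) (n :: nat).
       k_graph k V E \<and> card V = n \<and> (k - l) dvd n \<and> n \<ge> n0 \<and>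
       real (min_hdeg (k - 1) V E) \<ge> (1 / (2 * real (k - l)) + \<gamma>) * real n \<and>
       (\<forall>i. real (max_hdeg l V (color_class E \<phi> i)) \<le> c * real n ^ (k - l))
       \<longrightarrow> (\<exists>C. hamilton_kl_cycle k l V E C \<and> properly_colored C \<phi>)))"
proof -
  define h g where "h = k - l" and "g = k - 2 * l"
  have kl: "2 * l < k" using assms(3) by linarith
  then have hg: "k = l + h" "h = l + g" "1 \<le> g" "1 \<le> l" using assms(2) by (auto simp: h_def g_def)
  \<comment> \<open>Lowering \<gamma> weakens the degree condition; the cap keeps the densities
    \<sigma> + \<gamma>1 below 1, as \<open>codegree_ge\<close> requires, and bounds the absorbing
    path.\<close>
  define \<gamma>1 where "\<gamma>1 = min \<gamma> (1 / 2)"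
  have \<gamma>1: "0 < \<gamma>1" "\<gamma>1 \<le> 1 / 2" "\<gamma>1 \<le> \<gamma>" using assms(4) by (auto simp: \<gamma>1_def)
  have h0: "0 < real h" using hg by simp
  define \<sigma> where "\<sigma> = 1 / (2 * real h)"
  define \<alpha> where "\<alpha> = (\<sigma> / 2) ^ (l + h + h + h) / 2"
  define \<mu> where "\<mu> = \<gamma>1 / (48 * real h)"
  define \<omega> where "\<omega> = \<alpha> * \<mu> / 8"
  define \<epsilon> where "\<epsilon> = \<gamma>1 * \<omega> / 32"
  define t where "t = nat \<lceil>12 * real h / \<epsilon>\<rceil>"
  define b where "b = h * (2 * t + 3)"
  define \<kappa> where "\<kappa> = \<gamma>1 * \<omega>\<^sup>2 / (64 * real b)"
  define \<theta> where "\<theta> = (\<epsilon> * \<omega> / 32) ^ (l + h - 1) * (\<gamma>1 * \<omega> / 16)"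
  have \<sigma>0: "0 < \<sigma>" using h0 by (simp add: \<sigma>_def)
  have \<alpha>0: "0 < \<alpha>" using \<sigma>0 by (simp add: \<alpha>_def)
  have \<omega>0: "0 < \<omega>" using \<alpha>0 \<gamma>1 h0 by (simp add: \<omega>_def \<mu>_def)
  have \<epsilon>0: "0 < \<epsilon>" using \<gamma>1 \<omega>0 by (simp add: \<epsilon>_def)
  have b0: "0 < real b" using h0 by (simp add: b_def)
  have \<kappa>0: "0 < \<kappa>" using \<gamma>1 \<omega>0 b0 by (simp add: \<kappa>_def)
  have \<theta>0: "0 < \<theta>" using \<epsilon>0 \<omega>0 \<gamma>1 by (simp add: \<theta>_def)
  have t: "12 * real h \<le> \<epsilon> * real t"
  proof -
    have "12 * real h / \<epsilon> \<le> real t" unfolding t_def by (rule real_nat_ceiling_ge)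
    then show ?thesis using \<epsilon>0 by (simp add: field_simps)
  qed
  \<comment> \<open>The three bounds on \<open>c\<close> come from the clashes in absorbers, in
    connections and in fans; the division by h^h undoes the factor in
    \<open>fillings\<close>.\<close>
  define u where "u = Min {(\<sigma> / 2) ^ (l + h + h + h) / 10, (\<sigma> * \<omega> / 8) ^ (g + h + h) / 8, \<theta> / 2}"
  define c where "c = u / real h ^ h"
  have u0: "0 < u" unfolding u_def using \<sigma>0 \<omega>0 \<theta>0 by simp
  have hc: "real h ^ h * c = u" using h0 by (simp add: c_def)
  have c0: "0 < c" using u0 h0 by (simp add: c_def)
  have c: "10 * (real h ^ h * c) \<le> (\<sigma> / 2) ^ (l + h + h + h)"
    "8 * (real h ^ h * c) \<le> (\<sigma> * \<omega> / 8) ^ (g + h + h)" "2 * (real h ^ h * c) \<le> \<theta>"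
    unfolding hc u_def by (auto simp: min_def)
  note ev = eventually_log_less_linear
  define large where "large = (\<lambda>n::nat. 1 \<le> real n \<and> real (h + l) \<le> \<gamma>1 / 8 * real n \<and>
      real (2 * (l + h + h + h) + 2 * (g + h + h) + 2 * h) \<le> \<sigma> * real n \<and>
      real h * ln (real n) + 1 < 3 * \<omega> * real n \<and> real (2 * b + 2) \<le> \<omega> * real n \<and>
      real (l + h) * ln (real n) < \<kappa> * \<gamma>1 / 8 * real n \<and> real b \<le> 1 / 8 * real n \<and>
      real (l + (g + h + h)) \<le> \<sigma> * \<omega> / 8 * real n \<and> real (l + h + 1) \<le> \<epsilon> * \<omega> / 32 * real n \<and>
      real (h * h * (3 + 2 * t)) < \<theta> / 2 * real n)"
  have "\<forall>\<^sub>F n in sequentially. large n"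
    unfolding large_def
  proof (intro eventually_conj)
    show "\<forall>\<^sub>F n in sequentially. 1 \<le> real n"
      using eventually_ge_at_top[of 1] by eventually_elim simp
    have lin: "\<forall>\<^sub>F n in sequentially. C < B * real n" if "0 < B" for B C :: real
      using ev[OF that, of 0 C] by simp
    then have lin': "\<forall>\<^sub>F n in sequentially. C \<le> B * real n" if "0 < B" for B C :: real
      using that by (meson eventually_mono less_imp_le)
    show "\<forall>\<^sub>F n in sequentially. real (h + l) \<le> \<gamma>1 / 8 * real n"
      "\<forall>\<^sub>F n in sequentially. real (2 * (l + h + h + h) + 2 * (g + h + h) + 2 * h) \<le> \<sigma> * real n"
      "\<forall>\<^sub>F n in sequentially. real (2 * b + 2) \<le> \<omega> * real n"
      "\<forall>\<^sub>F n in sequentially. real b \<le> 1 / 8 * real n"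
      "\<forall>\<^sub>F n in sequentially. real (l + (g + h + h)) \<le> \<sigma> * \<omega> / 8 * real n"
      "\<forall>\<^sub>F n in sequentially. real (l + h + 1) \<le> \<epsilon> * \<omega> / 32 * real n"
      "\<forall>\<^sub>F n in sequentially. real (h * h * (3 + 2 * t)) < \<theta> / 2 * real n"
      by (rule lin' lin; use \<gamma>1 \<sigma>0 \<omega>0 \<epsilon>0 \<theta>0 in simp)+
    show "\<forall>\<^sub>F n in sequentially. real h * ln (real n) + 1 < 3 * \<omega> * real n"
      by (rule ev) (use \<omega>0 in simp)
    show "\<forall>\<^sub>F n in sequentially. real (l + h) * ln (real n) < \<kappa> * \<gamma>1 / 8 * real n"
      using ev[of "\<kappa> * \<gamma>1 / 8" "real (l + h)" 0] \<kappa>0 \<gamma>1 by simp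
  qed
  then obtain n0 where n0: "\<And>n. n0 \<le> n \<Longrightarrow> large n"
    unfolding eventually_sequentially by blast
  have main: "\<exists>C. hamilton_kl_cycle k l V E C \<and> properly_colored C \<phi>"
    if H: "k_graph k V E" "(k - l) dvd card V" "max n0 1 \<le> card V"
      "(1 / (2 * real (k - l)) + \<gamma>) * real (card V) \<le> real (min_hdeg (k - 1) V E)"
      "\<forall>i. real (max_hdeg l V (color_class E \<phi> i)) \<le> c * real (card V) ^ (k - l)"
    for V :: "'a set" and E \<phi>
  proof -
    have finV: "finite V" using H(1) by (simp add: k_graph_def)
    interpret coloured_graph V E \<phi> l g h c
    proof
      show "k_graph (l + h) V E" using H(1) by (simp add: hg(1)[symmetric])
      show "1 \<le> l" "1 \<le> g" "h = l + g" by (rule hg)+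
      fix S j assume S: "S \<subseteq> V" "card S = l"
      have "{e\<in>E. \<phi> e = j \<and> S \<subseteq> e} = {e\<in>color_class E \<phi> j. S \<subseteq> e}" by (auto simp: color_class_def)
      then have "card {e\<in>E. \<phi> e = j \<and> S \<subseteq> e} \<le> max_hdeg l V (color_class E \<phi> j)"
        using hdeg_bounds(2)[OF finV S, of "color_class E \<phi> j"] by (simp add: hdeg_def)
      then have "real (card {e\<in>E. \<phi> e = j \<and> S \<subseteq> e}) \<le> real (max_hdeg l V (color_class E \<phi> j))"
        by (simp only: of_nat_le_iff)
      also have "\<dots> \<le> c * real (card V) ^ h" using H(5) by (simp add: h_def)
      finally show "real (card {e\<in>E. \<phi> e = j \<and> S \<subseteq> e}) \<le> c * real (card V) ^ h" .
    qed
    have deg: "(\<sigma> + \<gamma>1) * real (card V) \<le> real (card {x\<in>V. insert x S \<in> E})"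
      if S: "S \<subseteq> V" "card S = l + h - 1" for S
    proof -
      have "(\<sigma> + \<gamma>1) * real (card V) \<le> (\<sigma> + \<gamma>) * real (card V)" using \<gamma>1 by (intro mult_right_mono) auto
      also have "\<dots> \<le> real (min_hdeg (k - 1) V E)" using H(4) by (simp add: \<sigma>_def h_def)
      also have "\<dots> \<le> real (hdeg E S)" using hdeg_bounds(1)[OF finV S, of E] by (simp add: hg(1)[symmetric])
      also have "hdeg E S = card {x\<in>V. insert x S \<in> E}"
        using S H(1) hg by (intro card_edges_through[of k]) auto
      finally show ?thesis .
    qed
    have "\<sigma> \<le> 1 / 2" using h0 by (simp add: \<sigma>_def field_simps)
    then have "(\<sigma> + \<gamma>1) * real (card V) \<le> 1 * real (card V)" using \<gamma>1 by (intro mult_right_mono) auto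
    then have cod: "codegree_ge V ((\<sigma> + \<gamma>1) * real (card V))"
      using deg by (auto simp: codegree_ge_def)
    have hd: "h dvd card V" using H(2) by (simp add: h_def)
    have "n0 \<le> card V" using H(3) by simp
    note nn = n0[OF this, unfolded large_def]
    have "\<exists>C. hamilton_kl_cycle (l + h) l V E C \<and> properly_colored C \<phi>"
      by (rule hamilton_cycle_large[OF hd refl _ \<sigma>_def \<gamma>1(1,2) cod \<alpha>_def \<mu>_def \<omega>_def \<epsilon>_def t b_def
            \<kappa>_def \<theta>_def c]) (use nn in blast)+
    then show ?thesis by (simp add: hg(1)[symmetric])
  qed
  show ?thesis
  proof (intro exI[of _ c] exI[of _ "max n0 1"] conjI allI impI c0)
    fix V :: "'a set" and E \<phi> n
    assume "k_graph k V E \<and> card V = n \<and> (k - l) dvd n \<and> n \<ge> max n0 1 \<and>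
       real (min_hdeg (k - 1) V E) \<ge> (1 / (2 * real (k - l)) + \<gamma>) * real n \<and>
       (\<forall>i. real (max_hdeg l V (color_class E \<phi> i)) \<le> c * real n ^ (k - l))"
    then show "\<exists>C. hamilton_kl_cycle k l V E C \<and> properly_colored C \<phi>" using main by blast
  qed simp
qed

end
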